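(* Let $G$ be a finite solvable group. Suppose that $\chi\in\operatorname{Irr}(G)$ is a faithful minimal character. If $\chi(1)$ is odd, then $G$ is nilpotent-by-abelian.
   Context: $\operatorname{Irr}(G)$ denotes the set of irreducible complex characters of a finite group $G$. A character $\chi$ is faithful if $\operatorname{Ker}\chi=\{g\in G\mid \chi(g)=\chi(1)\}$ is trivial. For a finite group $G$ having a non-linear irreducible character (i.e. $G$ non-abelian), $m(G)=\min\{\chi(1)\mid\chi\in\operatorname{Irr}(G),\ \chi(1)>1\}$. A character $\chi\in\operatorname{Irr}(G)$ is a minimal character if $\chi(1)=m(G)$ (so minimal characters are non-linear, and $G$ is non-abelian whenever a minimal character of $G$ is mentioned). A group is nilpotent-by-abelian if it has a nilpotent normal subgroup with abelian quotient; equivalently, its derived subgroup is nilpotent. *)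

theory Defs
  imports
    "HOL-Algebra.Algebra"
    "Jordan_Normal_Form.VS_Connect"
begin

definition mat_trace :: "'k :: comm_monoid_add mat \<Rightarrow> 'k" where
  "mat_trace A = (\<Sum>i<dim_row A. A $$ (i, i))"

definition GL :: "nat \<Rightarrow> complex mat monoid" where
  "GL n = units_of (ring_mat TYPE(complex) n ())"

definition invariant_subspace ::
  "('a, 'b) monoid_scheme \<Rightarrow> nat \<Rightarrow> ('a \<Rightarrow> complex mat) \<Rightarrow> complex vec set \<Rightarrow> bool"
where
  "invariant_subspace G n \<rho> W \<longleftrightarrow>
     VectorSpace.subspace class_ring W (module_vec TYPE(complex) n) \<and>
     (\<forall>g\<in>carrier G. \<forall>w\<in>W. \<rho> g *\<^sub>v w \<in> W)"

definition irreducible_rep ::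
  "('a, 'b) monoid_scheme \<Rightarrow> nat \<Rightarrow> ('a \<Rightarrow> complex mat) \<Rightarrow> bool"
where
  "irreducible_rep G n \<rho> \<longleftrightarrow>
     \<rho> \<in> hom G (GL n) \<and> n > 0 \<and>
     (\<forall>W. invariant_subspace G n \<rho> W \<longrightarrow> W = {0\<^sub>v n} \<or> W = carrier_vec n)"

text \<open>Characters are restricted to the carrier (with value \<open>undefined\<close> outside it), so that
  two characters are equal as functions iff they agree on the group.\<close>

definition character :: "('a, 'b) monoid_scheme \<Rightarrow> ('a \<Rightarrow> complex mat) \<Rightarrow> 'a \<Rightarrow> complex" where
  "character G \<rho> = (\<lambda>g\<in>carrier G. mat_trace (\<rho> g))"

definition Irr :: "('a, 'b) monoid_scheme \<Rightarrow> ('a \<Rightarrow> complex) set" where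
  "Irr G = {\<chi>. \<exists>n \<rho>. irreducible_rep G n \<rho> \<and> \<chi> = character G \<rho>}"

text \<open>The value \<open>\<chi>(1)\<close>, as a natural number; it is well defined for every character, and in
  particular for \<open>\<chi> \<in> Irr G\<close>.\<close>

definition char_degree :: "('a, 'b) monoid_scheme \<Rightarrow> ('a \<Rightarrow> complex) \<Rightarrow> nat" where
  "char_degree G \<chi> = (THE d. \<chi> \<one>\<^bsub>G\<^esub> = of_nat d)"

definition char_kernel :: "('a, 'b) monoid_scheme \<Rightarrow> ('a \<Rightarrow> complex) \<Rightarrow> 'a set" where
  "char_kernel G \<chi> = {g \<in> carrier G. \<chi> g = \<chi> \<one>\<^bsub>G\<^esub>}"

definition faithful_character :: "('a, 'b) monoid_scheme \<Rightarrow> ('a \<Rightarrow> complex) \<Rightarrow> bool" where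
  "faithful_character G \<chi> \<longleftrightarrow> char_kernel G \<chi> = {\<one>\<^bsub>G\<^esub>}"

text \<open>Meaningful only if \<open>G\<close> has a non-linear irreducible character; otherwise the set is empty
  and its minimum is an unspecified number. Hence \<open>minimal_character\<close> below also demands
  that \<open>\<chi>\<close> itself be non-linear.\<close>

definition min_nonlinear_degree :: "('a, 'b) monoid_scheme \<Rightarrow> nat" where
  "min_nonlinear_degree G = (LEAST d. d \<in> {char_degree G \<chi> | \<chi>. \<chi> \<in> Irr G \<and> char_degree G \<chi> > 1})"

definition minimal_character :: "('a, 'b) monoid_scheme \<Rightarrow> ('a \<Rightarrow> complex) \<Rightarrow> bool" where
  "minimal_character G \<chi> \<longleftrightarrow>
     \<chi> \<in> Irr G \<and> char_degree G \<chi> > 1 \<and> char_degree G \<chi> = min_nonlinear_degree G"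

primrec lower_central :: "('a, 'b) monoid_scheme \<Rightarrow> nat \<Rightarrow> 'a set" where
  "lower_central G 0 = carrier G"
| "lower_central G (Suc k) =
     generate G (\<Union>x \<in> lower_central G k. \<Union>y \<in> carrier G.
       {x \<otimes>\<^bsub>G\<^esub> y \<otimes>\<^bsub>G\<^esub> inv\<^bsub>G\<^esub> x \<otimes>\<^bsub>G\<^esub> inv\<^bsub>G\<^esub> y})"

definition nilpotent :: "('a, 'b) monoid_scheme \<Rightarrow> bool" where
  "nilpotent G \<longleftrightarrow> group G \<and> (\<exists>k. lower_central G k = {\<one>\<^bsub>G\<^esub>})"

definition nilpotent_by_abelian :: "('a, 'b) monoid_scheme \<Rightarrow> bool" where
  "nilpotent_by_abelian G \<longleftrightarrow>
     (\<exists>N. N \<lhd> G \<and> nilpotent (G\<lparr>carrier := N\<rparr>) \<and> comm_group (G Mod N))"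

end

theory Submission
  imports Defs "Jordan_Normal_Form.Schur_Decomposition" "Jordan_Normal_Form.DL_Rank"
begin

text \<open>Let \<open>K\<close> be the derived subgroup of \<open>G\<close> and \<open>n = \<chi>(1)\<close>. By minimality, \<open>K\<close> is in the kernel of
  every representation of degree less than \<open>n\<close>, and of every reducible one of degree at most \<open>n\<close>.
  For an abelian normal subgroup \<open>A\<close> with a weight \<open>\<mu>\<close> in the given representation, the permutation
  representation on the at most \<open>n\<close> conjugates of \<open>\<mu>\<close> shows that \<open>K\<close> fixes \<open>\<mu>\<close>, and by faithfulness \<open>K\<close>
  centralizes \<open>A\<close>.

  Let \<open>Z\<close> be the centre of \<open>K\<close>, let \<open>M \<le> K\<close> be normal in \<open>G\<close> with \<open>[M, M] \<le> Z\<close>, and let \<open>\<mu>\<close> be a weight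
  of \<open>Z\<close> with stabilizer \<open>T\<close> of index \<open>t\<close> and multiplicity \<open>m\<close>, so \<open>n = t m\<close>. The alternating form
  \<open>\<mu> [x, y]\<close> on \<open>M\<close> has values in the \<open>m\<close>-th roots of unity and \<open>M\<close> modulo its radical has order \<open>e\<^sup>2\<close>
  with \<open>e \<le> m\<close>. As \<open>m\<close> is odd, \<open>T\<close> acts on this quotient through a genuine Weil representation of
  degree \<open>e\<close>, which is reducible if \<open>e > 1\<close>. Induced to \<open>G\<close> it has degree \<open>t e \<le> n\<close>, so \<open>K\<close> acts
  trivially on the quotient; by faithfulness \<open>[K, M] \<le> Z\<close>. Applied to derived subgroups of the
  centralizer of the second centre of \<open>K\<close>, this shows that \<open>K\<close> is nilpotent of class at most two.\<close>

section \<open>Complex matrices\<close>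

text \<open>Only the stabilizer \<open>T\<close> of \<open>\<mu>\<close> preserves the form, so the
  Weil representation lives on \<open>T\<close> and has to be induced; \<open>e \<le> m\<close> is
  what keeps the induced degree within \<open>n = t m\<close>. That bound holds because the
  operators of representatives of \<open>M\<close> modulo the radical are linearly independent on
  the weight space, which has dimension \<open>m\<close>. The form has \<open>m\<close>-th roots of
  unity as values because a commutator of elements of \<open>M\<close> acts on the weight space as a
  scalar and has determinant 1 there. Oddness makes squaring harmless on the values of the form.
  This gives a parity operator of square 1 and trace 1 that commutes with the Weil operators. It is
  non-scalar for \<open>e > 1\<close>, hence the reducibility, and its eigenspaces have dimensions
  differing by one, so that a quotient of two determinants removes the projective ambiguity.
  Reducibility is exhibited throughout by a non-scalar matrix commuting with the representation.
  Solvability serves to make a derived series terminate in the last step.\<close>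

lemma mat_eqI:
  assumes "A \<in> carrier_mat n m" "B \<in> carrier_mat n m"
    "\<And>i j. i < n \<Longrightarrow> j < m \<Longrightarrow> A $$ (i,j) = B $$ (i,j)"
  shows "A = B"
  using assms by (intro eq_matI) auto

lemma sq_closed:
  "A \<in> carrier_mat n n \<Longrightarrow> B \<in> carrier_mat n n \<Longrightarrow> A * B \<in> carrier_mat n n"
  by (rule mult_carrier_mat)

lemma sq_assoc:
  fixes A B C :: "'k :: semiring_0 mat"
  shows "A \<in> carrier_mat n n \<Longrightarrow> B \<in> carrier_mat n n \<Longrightarrow> C \<in> carrier_mat n n \<Longrightarrow>
    A * B * C = A * (B * C)"
  by (rule assoc_mult_mat)

lemma sq_distrib:
  fixes A B C :: "'k :: ring mat"
  assumes "A \<in> carrier_mat n n" "B \<in> carrier_mat n n" "C \<in> carrier_mat n n"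
  shows "(A + B) * C = A * C + B * C" "A * (B + C) = A * B + A * C"
    "(A - B) * C = A * C - B * C" "A * (B - C) = A * B - A * C"
  using assms by (auto simp: add_mult_distrib_mat mult_add_distrib_mat
      minus_mult_distrib_mat mult_minus_distrib_mat)

lemma sq_smult:
  fixes A B :: "'k :: comm_semiring_0 mat"
  assumes "A \<in> carrier_mat n n" "B \<in> carrier_mat n n"
  shows "(k \<cdot>\<^sub>m A) * B = k \<cdot>\<^sub>m (A * B)" "A * (k \<cdot>\<^sub>m B) = k \<cdot>\<^sub>m (A * B)"
  using assms by (auto simp: mult_smult_distrib mult_smult_assoc_mat)

lemma mat_trace_mult_comm:
  fixes A B :: "'k :: comm_semiring_0 mat"
  assumes "A \<in> carrier_mat n m" "B \<in> carrier_mat m n"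
  shows "mat_trace (A * B) = mat_trace (B * A)"
proof -
  have "mat_trace (A * B) = (\<Sum>i<n. \<Sum>j<m. A $$ (i,j) * B $$ (j,i))"
    using assms by (auto simp: mat_trace_def scalar_prod_def atLeast0LessThan intro!: sum.cong)
  also have "\<dots> = (\<Sum>j<m. \<Sum>i<n. A $$ (i,j) * B $$ (j,i))"
    by (rule sum.swap)
  also have "\<dots> = mat_trace (B * A)"
    using assms
    by (auto simp: mat_trace_def scalar_prod_def atLeast0LessThan mult.commute intro!: sum.cong)
  finally show ?thesis .
qed

lemma mat_trace_add:
  "A \<in> carrier_mat n n \<Longrightarrow> B \<in> carrier_mat n n \<Longrightarrow> mat_trace (A + B) = mat_trace A + mat_trace B"
  by (auto simp: mat_trace_def sum.distrib)

lemma mat_trace_diff: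
  fixes A B :: "'k :: ab_group_add mat"
  shows "A \<in> carrier_mat n n \<Longrightarrow> B \<in> carrier_mat n n \<Longrightarrow> mat_trace (A - B) = mat_trace A - mat_trace B"
  by (auto simp: mat_trace_def sum_subtractf)

lemma mat_trace_smult:
  fixes A :: "'k :: semiring_0 mat"
  shows "A \<in> carrier_mat n n \<Longrightarrow> mat_trace (c \<cdot>\<^sub>m A) = c * mat_trace A"
  by (auto simp: mat_trace_def sum_distrib_left)

lemma mat_trace_one: "mat_trace (1\<^sub>m n :: 'k :: semiring_1 mat) = of_nat n"
  by (simp add: mat_trace_def)

lemma mat_trace_similar:
  fixes A B :: "'k :: comm_ring_1 mat"
  assumes "similar_mat A B" shows "mat_trace A = mat_trace B"
proof -
  from similar_matD[OF assms] obtain n P Q where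
    c: "A \<in> carrier_mat n n" "B \<in> carrier_mat n n" "P \<in> carrier_mat n n" "Q \<in> carrier_mat n n"
    and PQ: "Q * P = 1\<^sub>m n" "A = P * B * Q" by auto
  have "mat_trace A = mat_trace (P * (B * Q))" using c PQ by simp
  also have "\<dots> = mat_trace (B * Q * P)"
    using c by (intro mat_trace_mult_comm[where n = n and m = n]) auto
  also have "B * Q * P = B" using c PQ by simp
  finally show ?thesis .
qed

text \<open>The exponent is the rank of \<open>A\<close>. This gives access to determinants on the range of an
  idempotent without choosing a basis of the range.\<close>
lemma idempotent_mat:
  fixes A :: "complex mat"
  assumes A: "A \<in> carrier_mat n n" and id: "A * A = A"
  shows "\<exists>a. mat_trace A = of_nat a \<and> (\<forall>c. det (c \<cdot>\<^sub>m A + (1\<^sub>m n - A)) = c ^ a)"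
proof -
  obtain es where "char_poly A = (\<Prod> a \<leftarrow> es. [:- a, 1:])"
    using char_poly_factorized[OF A] by auto
  from schur_decomposition_exists[OF A this]
  obtain B where B: "B \<in> carrier_mat n n" "upper_triangular B" and sim: "similar_mat A B" by auto
  from similar_matD[OF sim] A obtain P Q where
    c: "P \<in> carrier_mat n n" "Q \<in> carrier_mat n n"
    and PQ: "P * Q = 1\<^sub>m n" "Q * P = 1\<^sub>m n" "A = P * B * Q"
    by (smt (verit) carrier_matD(1) insert_subset)
  have BQ: "B = Q * A * P"
  proof -
    have "Q * A * P = Q * (P * B * Q) * P" using PQ by simp
    also have "\<dots> = (Q * P) * B * (Q * P)" using c B by (simp add: sq_assoc[of _ n] del: assoc_mult_mat)
    also have "\<dots> = B" using c B PQ by simp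
    finally show ?thesis by simp
  qed
  have BB: "B * B = B"
  proof -
    have "B * B = Q * A * (P * Q) * A * P" unfolding BQ using c A by (simp add: sq_assoc[of _ n] del: assoc_mult_mat)
    also have "\<dots> = Q * (A * A) * P" using c A PQ(1) by (simp add: sq_assoc[of _ n] del: assoc_mult_mat)
    finally show ?thesis using id BQ by simp
  qed
  \<comment> \<open>Since \<open>B\<close> is triangular, the diagonal entries of
    \<open>B * B\<close> are the squares of those of \<open>B\<close>.\<close>
  have d01: "B $$ (i,i) = 0 \<or> B $$ (i,i) = 1" if i: "i < n" for i
  proof -
    have "B $$ (i,i) = (B * B) $$ (i,i)" using BB by simp
    also have "\<dots> = (\<Sum>j<n. B $$ (i,j) * B $$ (j,i))"
      using B i by (auto simp: scalar_prod_def atLeast0LessThan)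
    also have "\<dots> = (\<Sum>j\<in>{i}. B $$ (i,j) * B $$ (j,i))"
    proof (rule sum.mono_neutral_right)
      show "\<forall>j\<in>{..<n} - {i}. B $$ (i,j) * B $$ (j,i) = 0"
      proof
        fix j assume j: "j \<in> {..<n} - {i}"
        show "B $$ (i,j) * B $$ (j,i) = 0"
        proof (cases "j < i")
          case True then show ?thesis using B i by (auto simp: upper_triangular_def)
        next
          case False then have "i < j" using j by auto
          then show ?thesis using B j by (auto simp: upper_triangular_def)
        qed
      qed
    qed (use i in auto)
    finally show ?thesis by auto
  qed
  define I where "I = {i. i < n \<and> B $$ (i,i) = 1}"
  have tr: "mat_trace A = of_nat (card I)"
  proof -
    have "mat_trace A = mat_trace B" by (rule mat_trace_similar[OF sim])
    also have "\<dots> = (\<Sum>i<n. if i \<in> I then 1 else 0)"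
      using B(1) d01 unfolding mat_trace_def I_def by (intro sum.cong) auto
    also have "\<dots> = of_nat (card I)"
      by (simp add: sum.If_cases I_def Int_def Collect_conj_eq[symmetric] lessThan_def)
    finally show ?thesis .
  qed
  have dt: "det (c \<cdot>\<^sub>m A + (1\<^sub>m n - A)) = c ^ card I" for c
  proof -
    let ?A = "c \<cdot>\<^sub>m A + (1\<^sub>m n - A)" and ?B = "c \<cdot>\<^sub>m B + (1\<^sub>m n - B)"
    have "P * ?B * Q = c \<cdot>\<^sub>m (P * B * Q) + (P * 1\<^sub>m n * Q - P * B * Q)"
      using c B(1)
      by (simp add: minus_carrier_mat sq_distrib[of _ n] sq_smult[of _ n] del: assoc_mult_mat)
    then have "?A = P * ?B * Q" using c PQ by simp
    then have "similar_mat_wit ?A ?B P Q"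
      using c A B PQ unfolding similar_mat_wit_def Let_def by auto
    then have "det ?A = det ?B" using det_similar unfolding similar_mat_def by blast
    also have "\<dots> = prod_list (diag_mat ?B)"
      by (rule det_upper_triangular[of _ n]) (use B in \<open>auto simp: upper_triangular_def\<close>)
    also have "\<dots> = (\<Prod>i<n. c * B $$ (i,i) + (1 - B $$ (i,i)))"
      using B by (simp add: diag_mat_def prod.list_conv_set_nth atLeast0LessThan)
    also have "\<dots> = (\<Prod>i<n. if i \<in> I then c else 1)"
      using d01 unfolding I_def by (intro prod.cong) auto
    also have "\<dots> = c ^ card I"
      by (simp add: prod.If_cases I_def Int_def Collect_conj_eq[symmetric] lessThan_def)
    finally show ?thesis .
  qed
  show ?thesis using tr dt by blast
qed

text \<open>A maximal independent subset of \<open>W\<close> spans \<open>W\<close>; extended to a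
  basis of the whole space and listed first, it supplies the columns of \<open>Q\<close>. Both
  inequalities for \<open>r\<close> come from \<open>W\<close> being non-zero and proper.\<close>

lemma (in vec_space) subspace_adapted_basis:
  fixes W :: "'a vec set"
  assumes W: "VectorSpace.subspace class_ring W V" and W0: "W \<noteq> {0\<^sub>v n}" and W1: "W \<noteq> carrier_vec n"
  shows "\<exists>r Q. 0 < r \<and> r < n \<and> Q \<in> carrier_mat n n \<and> det Q \<noteq> 0 \<and>
    W = span (set (take r (cols Q)))"
proof -
  from W have sub: "submodule class_ring W V" unfolding subspace_def by auto
  have Wc: "W \<subseteq> carrier_vec n" using sub unfolding submodule_def by auto
  define P where "P = (\<lambda>S. S \<subseteq> W \<and> lin_indpt S)"
  have bd: "P A \<Longrightarrow> finite A \<and> card A \<le> n" for A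
    using li_le_dim[OF fin_dim, of A] Wc unfolding P_def dim_is_n by auto
  have emp: "P {}" unfolding P_def lin_dep_def by auto
  obtain A where A: "finite A" "maximal A P"
    using maximal_exists[of P n "{}"] bd emp by auto
  have AW: "A \<subseteq> W" and Ali: "lin_indpt A" using A unfolding maximal_def P_def by auto
  \<comment> \<open>Maximality among the independent sets that contain \<open>A\<close> gives a
    basis extending \<open>A\<close>.\<close>
  define P' where "P' = (\<lambda>S. A \<subseteq> S \<and> S \<subseteq> carrier_vec n \<and> lin_indpt S)"
  have bd': "P' B \<Longrightarrow> finite B \<and> card B \<le> n" for B
    using li_le_dim[OF fin_dim, of B] unfolding P'_def dim_is_n by auto
  have "P' A" using AW Wc Ali unfolding P'_def by auto
  then obtain B where B: "finite B" "maximal B P'"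
    using maximal_exists[of P' n A] bd' by auto
  have AB: "A \<subseteq> B" and Bli: "lin_indpt B" and Bc: "B \<subseteq> carrier_vec n"
    using B unfolding maximal_def P'_def by auto
  have Bmax: "S = B" if "B \<subseteq> S" "S \<subseteq> carrier_vec n" "lin_indpt S" for S
  proof -
    have "P' S" using that AB unfolding P'_def by blast
    then show ?thesis using B(2) that(1) unfolding maximal_def by blast
  qed
  have "maximal B (\<lambda>S. S \<subseteq> carrier_vec n \<and> lin_indpt S)"
    unfolding maximal_def
  proof (intro conjI allI impI)
    show "B \<subseteq> carrier_vec n" by (rule Bc)
    show "lin_indpt B" by (rule Bli)
    fix S assume "B \<subseteq> S \<and> S \<subseteq> carrier_vec n \<and> lin_indpt S"
    then show "S = B" using Bmax[of S] by simp
  qed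
  then have bas: "basis B" by (rule max_li_is_basis)
  have cardB: "card B = n" using dim_basis[OF B(1) bas] dim_is_n by simp
  have spA: "span A = W"
  proof
    show "span A \<subseteq> W" using span_is_subset[OF AW sub] .
    show "W \<subseteq> span A"
    proof
      fix w assume w: "w \<in> W"
      show "w \<in> span A"
      proof (cases "w \<in> A")
        case True then show ?thesis using in_own_span[of A] AW Wc by auto
      next
        case False
        have "lin_dep (A \<union> {w})"
        proof (rule ccontr)
          assume "\<not> lin_dep (A \<union> {w})"
          then have "P (A \<union> {w})" using AW w unfolding P_def by auto
          then have "A \<union> {w} = A" using A(2) unfolding maximal_def by blast
          then show False using False by auto
        qed
        then show ?thesis
          using lin_dep_iff_in_span[of A w] AW Wc Ali w False by auto
      qed
    qed
  qed
  obtain as where as: "set as = A" "distinct as" using finite_distinct_list[OF A(1)] by auto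
  obtain cs where cs: "set cs = B - A" "distinct cs"
    using finite_distinct_list[of "B - A"] B(1) by auto
  define Q where "Q = mat_of_cols n (as @ cs)"
  have len: "length (as @ cs) = n"
  proof -
    have "distinct (as @ cs)" using as cs by auto
    then have "length (as @ cs) = card (set (as @ cs))" by (rule distinct_card[symmetric])
    also have "set (as @ cs) = B" using as cs AB by auto
    finally show ?thesis using cardB by simp
  qed
  have Qc: "Q \<in> carrier_mat n n" unfolding Q_def using len by auto
  have colsQ: "cols Q = as @ cs"
    unfolding Q_def using as cs AB Bc by (intro cols_mat_of_cols) auto
  have "rank Q = n"
    using Qc colsQ as cs AB Bli by (intro lin_indpt_full_rank)
      (auto simp: Un_absorb1)
  then have det: "det Q \<noteq> 0" using det_rank_iff[OF Qc] by simp
  have "take (length as) (cols Q) = as" using colsQ by simp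
  then have sp: "W = span (set (take (length as) (cols Q)))" using spA as by simp
  have "as \<noteq> []" using spA as W0 span_empty by auto
  moreover have "length as \<noteq> n"
  proof
    assume "length as = n"
    then have "A = B" using len cs as AB by auto
    then show False using bas spA W1 unfolding basis_def by simp
  qed
  ultimately show ?thesis using Qc det sp len
    by (intro exI[of _ "length as"] exI[of _ Q]) auto
qed

text \<open>In a basis adapted to \<open>W\<close>, the maps \<open>f\<close> and \<open>h\<close> give the diagonal blocks of a matrix, and the
  columns of \<open>L\<close> are the basis vectors that span \<open>W\<close>.\<close>
lemma diagonal_blocks:
  fixes W :: "complex vec set"
  assumes W: "VectorSpace.subspace class_ring W (module_vec TYPE(complex) n)"
    and W0: "W \<noteq> {0\<^sub>v n}" and W1: "W \<noteq> carrier_vec n"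
  obtains r and f h :: "complex mat \<Rightarrow> complex mat" where "0 < r" "r < n"
    "\<And>A. A \<in> carrier_mat n n \<Longrightarrow> f A \<in> carrier_mat r r"
    "\<And>A. A \<in> carrier_mat n n \<Longrightarrow> h A \<in> carrier_mat (n - r) (n - r)"
    "f (1\<^sub>m n) = 1\<^sub>m r" "h (1\<^sub>m n) = 1\<^sub>m (n - r)"
    "\<And>A B. A \<in> carrier_mat n n \<Longrightarrow> B \<in> carrier_mat n n \<Longrightarrow> \<forall>w\<in>W. B *\<^sub>v w \<in> W \<Longrightarrow>
       f (A * B) = f A * f B"
    "\<And>A B. A \<in> carrier_mat n n \<Longrightarrow> B \<in> carrier_mat n n \<Longrightarrow> \<forall>w\<in>W. A *\<^sub>v w \<in> W \<Longrightarrow>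
       h (A * B) = h A * h B"
    "\<And>A c. A \<in> carrier_mat n n \<Longrightarrow> f (c \<cdot>\<^sub>m A) = c \<cdot>\<^sub>m f A"
    "\<And>A k. A \<in> carrier_mat n n \<Longrightarrow> \<forall>w\<in>W. A *\<^sub>v w \<in> W \<Longrightarrow> f A = 1\<^sub>m r \<Longrightarrow> h A = 1\<^sub>m (n - r) \<Longrightarrow>
       A ^\<^sub>m k = 1\<^sub>m n \<Longrightarrow> 0 < k \<Longrightarrow> A = 1\<^sub>m n"
    "\<exists>L\<in>carrier_mat n r. (\<forall>x\<in>carrier_vec r. L *\<^sub>v x = 0\<^sub>v n \<longrightarrow> x = 0\<^sub>v r) \<and>
       (\<forall>A\<in>carrier_mat n n. (\<forall>w\<in>W. A *\<^sub>v w \<in> W) \<longrightarrow> A * L = L * f A)"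
proof -
  interpret vec_space "TYPE(complex)" n .
  obtain r Q where r: "0 < r" "r < n" and Q: "Q \<in> carrier_mat n n" "det Q \<noteq> 0"
    and WQ: "W = span (set (take r (cols Q)))"
    using subspace_adapted_basis[OF W W0 W1] by auto
  from det_non_zero_imp_unit[OF Q, of "()"] obtain P where
    P: "P \<in> carrier_mat n n" "P * Q = 1\<^sub>m n" "Q * P = 1\<^sub>m n"
    unfolding Units_def ring_mat_def by auto
  define c where "c A = P * A * Q" for A
  have cc: "c A \<in> carrier_mat n n" if "A \<in> carrier_mat n n" for A
    using that P Q unfolding c_def by auto
  have c1: "c (1\<^sub>m n) = 1\<^sub>m n" unfolding c_def using P Q by simp
  have cmult: "c (A * B) = c A * c B" if "A \<in> carrier_mat n n" "B \<in> carrier_mat n n" for A B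
  proof -
    have "c A * c B = P * A * ((Q * P) * (B * Q))"
      unfolding c_def using that P(1) Q(1) by (simp add: sq_assoc[of _ n] del: assoc_mult_mat)
    then show ?thesis
      unfolding c_def using that P(1,3) Q(1) by (simp add: sq_assoc[of _ n] del: assoc_mult_mat)
  qed
  have cinj: "A = Q * c A * P" if "A \<in> carrier_mat n n" for A
  proof -
    have "Q * c A * P = (Q * P) * A * (Q * P)"
      unfolding c_def using that P(1) Q(1) by (simp add: sq_assoc[of _ n] del: assoc_mult_mat)
    then show ?thesis using that P by simp
  qed
  \<comment> \<open>\<open>P\<close> sends the first \<open>r\<close> columns of \<open>Q\<close> to
    unit vectors, so \<open>W\<close> lies in the space \<open>U\<close> of vectors whose image
    under \<open>P\<close> vanishes from position \<open>r\<close> on. Invariance of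
    \<open>W\<close> therefore kills the lower left block.\<close>
  have low: "c A $$ (i,j) = 0" if A: "A \<in> carrier_mat n n" and inv: "\<forall>w\<in>W. A *\<^sub>v w \<in> W"
    and j: "j < r" and i: "r \<le> i" "i < n" for A i j
  proof -
    define U where "U = {w \<in> carrier_vec n. \<forall>i. r \<le> i \<and> i < n \<longrightarrow> (P *\<^sub>v w) $ i = 0}"
    have U: "submodule class_ring U V"
      unfolding submodule_def U_def
      using P(1) vec_module by (auto simp: module_vec_def scalar_prod_add_distrib[of _ n])
    have "set (take r (cols Q)) \<subseteq> U"
    proof
      fix w assume "w \<in> set (take r (cols Q))"
      then obtain k where k: "k < r" "w = col Q k"
        using r Q by (auto simp: in_set_conv_nth)
      have "P *\<^sub>v w = unit_vec n k"
        unfolding k(2) using col_mult2[OF P(1) Q(1), of k] P(2) k r by simp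
      then show "w \<in> U" unfolding U_def using k Q r by auto
    qed
    then have WU: "W \<subseteq> U" unfolding WQ by (rule span_is_subset[OF _ U])
    have "col Q j \<in> set (take r (cols Q))"
      using j r Q by (auto simp: in_set_conv_nth intro!: exI[of _ j])
    moreover have "set (take r (cols Q)) \<subseteq> carrier_vec n"
      using Q cols_dim[of Q] by (auto dest!: in_set_takeD)
    ultimately have "col Q j \<in> W"
      unfolding WQ using in_own_span[of "set (take r (cols Q))"] by blast
    then have "A *\<^sub>v col Q j \<in> U" using inv WU by auto
    then have "(P *\<^sub>v (A *\<^sub>v col Q j)) $ i = 0" using i unfolding U_def by auto
    moreover have "col Q j \<in> carrier_vec n" using Q(1) by (intro carrier_vecI) auto
    then have "P *\<^sub>v (A *\<^sub>v col Q j) = col (c A) j"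
      unfolding c_def
      using col_mult2[of "P * A" n n Q n j] assoc_mult_mat_vec[OF P(1) A, of "col Q j"] P(1) A Q(1) j r
      by (simp del: assoc_mult_mat assoc_mult_mat_vec)
    ultimately show ?thesis using cc[OF A] i j r by simp
  qed
  define f where "f A = mat r r (\<lambda>(i,j). c A $$ (i,j))" for A
  define h where "h A = mat (n - r) (n - r) (\<lambda>(i,j). c A $$ (i + r,j + r))" for A
  have split: "(\<Sum>k<n. x k) = (\<Sum>k<r. x k) + (\<Sum>k<n - r. x (k + r))" for x :: "nat \<Rightarrow> complex"
  proof -
    have "(\<Sum>k<n. x k) = (\<Sum>k<r. x k) + (\<Sum>k=r..<n. x k)"
      using r by (metis atLeast0LessThan less_imp_le sum.atLeastLessThan_concat zero_le)
    also have "(\<Sum>k=r..<n. x k) = (\<Sum>k<n - r. x (k + r))"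
      using sum.shift_bounds_nat_ivl[of x 0 r "n - r"] r by (simp add: atLeast0LessThan)
    finally show ?thesis .
  qed
  have cent: "c (A * B) $$ (i,j) = (\<Sum>k<r. c A $$ (i,k) * c B $$ (k,j))
      + (\<Sum>k<n - r. c A $$ (i,k + r) * c B $$ (k + r,j))"
    if "A \<in> carrier_mat n n" "B \<in> carrier_mat n n" "i < n" "j < n" for A B i j
    unfolding cmult[OF that(1,2)] using cc[OF that(1)] cc[OF that(2)] that(3,4)
    by (simp add: scalar_prod_def atLeast0LessThan split)
  have fmult: "f (A * B) = f A * f B"
    if A: "A \<in> carrier_mat n n" and B: "B \<in> carrier_mat n n" "\<forall>w\<in>W. B *\<^sub>v w \<in> W" for A B
    by (rule eq_matI) (use r in \<open>auto simp: f_def cent[OF A B(1)] low[OF B] scalar_prod_def atLeast0LessThan\<close>)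
  have hmult: "h (A * B) = h A * h B"
    if A: "A \<in> carrier_mat n n" "\<forall>w\<in>W. A *\<^sub>v w \<in> W" and B: "B \<in> carrier_mat n n" for A B
    by (rule eq_matI) (use r in \<open>auto simp: h_def cent[OF A(1) B] low[OF A] scalar_prod_def atLeast0LessThan\<close>)
  \<comment> \<open>Trivial diagonal blocks make \<open>c A - 1\<close> square to zero, so the
    \<open>k\<close>-th power is \<open>1 + k (c A - 1)\<close>; in characteristic zero it is 1 only
    if \<open>c A = 1\<close>. This does the work of complete reducibility.\<close>
  have fin: "A = 1\<^sub>m n"
    if A: "A \<in> carrier_mat n n" "\<forall>w\<in>W. A *\<^sub>v w \<in> W" and fA: "f A = 1\<^sub>m r" and hA: "h A = 1\<^sub>m (n - r)"
      and k: "A ^\<^sub>m k = 1\<^sub>m n" "0 < k" for A k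
  proof -
    have b1: "c A $$ (i,j) = (if i = j then 1 else 0)" if "i < r" "j < r" for i j
      using arg_cong[OF fA, of "\<lambda>M. M $$ (i,j)"] that by (simp add: f_def)
    have b2: "c A $$ (i,j) = (if i = j then 1 else 0)" if "r \<le> i" "i < n" "r \<le> j" "j < n" for i j
      using arg_cong[OF hA, of "\<lambda>M. M $$ (i - r,j - r)"] that by (auto simp: h_def split: if_splits)
    have N0: "(c A - 1\<^sub>m n) * (c A - 1\<^sub>m n) = 0\<^sub>m n n"
    proof (rule mat_eqI[of _ n n])
      fix i j assume ij: "i < n" "j < n"
      let ?d = "\<lambda>i j. c A $$ (i,j) - (if i = j then 1 else 0)"
      have z: "?d i k * ?d k j = 0" if k: "k < n" for k
        using b1[of i k] b2[of k j] low[OF A, of k i] low[OF A, of j k] ij k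
        by (cases "k < r"; cases "i < r"; cases "j < r") auto
      have "((c A - 1\<^sub>m n) * (c A - 1\<^sub>m n)) $$ (i,j) = (\<Sum>k<n. ?d i k * ?d k j)"
        using cc[OF A(1)] ij by (auto simp: scalar_prod_def atLeast0LessThan intro!: sum.cong)
      also have "\<dots> = 0" by (intro sum.neutral ballI z) simp
      finally show "((c A - 1\<^sub>m n) * (c A - 1\<^sub>m n)) $$ (i,j) = 0\<^sub>m n n $$ (i,j)" using ij by simp
    qed (use cc[OF A(1)] in \<open>auto intro!: sq_closed minus_carrier_mat\<close>)
    have Nc: "c A - 1\<^sub>m n \<in> carrier_mat n n" by (simp add: minus_carrier_mat)
    have pw: "c (A ^\<^sub>m m) = 1\<^sub>m n + of_nat m \<cdot>\<^sub>m (c A - 1\<^sub>m n)" for m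
    proof (induction m)
      case 0
      then show ?case using A(1) c1 cc[OF A(1)] by (auto intro!: eq_matI)
    next
      case (Suc m)
      let ?N = "c A - 1\<^sub>m n"
      have "c (A ^\<^sub>m Suc m) = (1\<^sub>m n + of_nat m \<cdot>\<^sub>m ?N) * c A"
        using cmult[OF pow_carrier_mat[OF A(1)] A(1), of m] Suc.IH by simp
      also have "\<dots> = c A + of_nat m \<cdot>\<^sub>m (?N * c A)"
        using cc[OF A(1)] Nc by (simp add: sq_distrib[of _ n] sq_smult[of _ n])
      also have "?N * c A = ?N"
      proof (rule mat_eqI[of _ n n])
        have e: "?N * c A - ?N = 0\<^sub>m n n"
          using sq_distrib(4)[OF Nc cc[OF A(1)] one_carrier_mat] N0 Nc by simp
        fix i j assume ij: "i < n" "j < n"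
        then have "(?N * c A) $$ (i,j) - ?N $$ (i,j) = 0"
          using arg_cong[OF e, of "\<lambda>M. M $$ (i,j)"] by (simp del: index_mult_mat(1))
        then show "(?N * c A) $$ (i,j) = ?N $$ (i,j)" by simp
      qed (use Nc cc[OF A(1)] in \<open>auto intro: sq_closed\<close>)
      also have "c A + of_nat m \<cdot>\<^sub>m ?N = 1\<^sub>m n + of_nat (Suc m) \<cdot>\<^sub>m ?N"
        using cc[OF A(1)] by (auto intro!: eq_matI simp: algebra_simps)
      finally show ?case .
    qed
    have "c A = 1\<^sub>m n"
    proof (rule mat_eqI[of _ n n])
      fix i j assume ij: "i < n" "j < n"
      have "(1\<^sub>m n :: complex mat) $$ (i,j) = (1\<^sub>m n + of_nat k \<cdot>\<^sub>m (c A - 1\<^sub>m n)) $$ (i,j)"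
        using pw[of k] k(1) c1 by simp
      then show "c A $$ (i,j) = 1\<^sub>m n $$ (i,j)" using k(2) ij cc[OF A(1)] by simp
    qed (use cc[OF A(1)] in auto)
    then show ?thesis using cinj[OF A(1)] P Q by simp
  qed
  define L where "L = mat n r (\<lambda>(i,j). Q $$ (i,j))"
  have Lc: "L \<in> carrier_mat n r" by (simp add: L_def)
  have ALe: "(A * L) $$ (i,j) = (A * Q) $$ (i,j)" if "A \<in> carrier_mat n n" "i < n" "j < r" for A i j
    using that Q(1) r by (auto simp: L_def scalar_prod_def)
  have AL: "A * L = L * f A" if A: "A \<in> carrier_mat n n" "\<forall>w\<in>W. A *\<^sub>v w \<in> W" for A
  proof (rule mat_eqI[of _ n r])
    fix i j assume ij: "i < n" "j < r"
    have "Q * c A = (Q * P) * A * Q"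
      unfolding c_def using A(1) P(1) Q(1) by (simp add: sq_assoc[of _ n] del: assoc_mult_mat)
    then have "A * Q = Q * c A" using P(3) A(1) by simp
    then have "(A * L) $$ (i,j) = (\<Sum>k<n. Q $$ (i,k) * c A $$ (k,j))"
      using ALe[OF A(1) ij] ij r Q(1) cc[OF A(1)] by (simp add: scalar_prod_def atLeast0LessThan)
    also have "\<dots> = (\<Sum>k<r. Q $$ (i,k) * c A $$ (k,j))"
      unfolding split using low[OF A ij(2)] by simp
    also have "\<dots> = (L * f A) $$ (i,j)"
      using ij by (auto simp: L_def f_def scalar_prod_def atLeast0LessThan)
    finally show "(A * L) $$ (i,j) = (L * f A) $$ (i,j)" .
  qed (use A in \<open>auto simp: L_def f_def\<close>)
  \<comment> \<open>\<open>P * L\<close> consists of the first \<open>r\<close> columns of the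
    identity, so \<open>P\<close> recovers \<open>x\<close> from
    \<open>L *\<^sub>v x\<close>.\<close>
  have Linj: "x = 0\<^sub>v r" if x: "x \<in> carrier_vec r" "L *\<^sub>v x = 0\<^sub>v n" for x
  proof (rule eq_vecI)
    fix i assume "i < dim_vec (0\<^sub>v r :: complex vec)"
    then have i: "i < r" by simp
    have "(P * L *\<^sub>v x) $ i = (P *\<^sub>v (L *\<^sub>v x)) $ i" using assoc_mult_mat_vec[OF P(1) Lc x(1)] by simp
    also have "\<dots> = 0" unfolding x(2) using P(1) i r by (simp add: scalar_prod_def)
    finally have "0 = (P * L *\<^sub>v x) $ i" ..
    also have "\<dots> = (\<Sum>k<r. (P * L) $$ (i,k) * x $ k)"
    proof -
      have "(C *\<^sub>v x) $ i = (\<Sum>k<r. C $$ (i,k) * x $ k)" if "C \<in> carrier_mat n r" for C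
        using that x(1) i r by (auto simp: scalar_prod_def atLeast0LessThan)
      from this[OF mult_carrier_mat[OF P(1) Lc]] show ?thesis .
    qed
    also have "\<dots> = (\<Sum>k<r. if k = i then x $ k else 0)"
      using ALe[OF P(1)] P(2) i r by (intro sum.cong) auto
    also have "\<dots> = x $ i" using i by simp
    finally show "x $ i = 0\<^sub>v r $ i" using i by simp
  qed (use x in auto)
  show ?thesis
  proof (rule that[of r f h])
    show "f (1\<^sub>m n) = 1\<^sub>m r" using r by (intro eq_matI) (auto simp: f_def c1)
    show "h (1\<^sub>m n) = 1\<^sub>m (n - r)" using r by (intro eq_matI) (auto simp: h_def c1)
    show "f (a \<cdot>\<^sub>m A) = a \<cdot>\<^sub>m f A" if "A \<in> carrier_mat n n" for A a
    proof -
      have "c (a \<cdot>\<^sub>m A) = a \<cdot>\<^sub>m c A"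
        unfolding c_def using that P(1) Q(1) by (simp add: sq_smult[of _ n])
      then show ?thesis using r cc[OF that] by (intro eq_matI) (auto simp: f_def)
    qed
    show "\<exists>L\<in>carrier_mat n r. (\<forall>x\<in>carrier_vec r. L *\<^sub>v x = 0\<^sub>v n \<longrightarrow> x = 0\<^sub>v r) \<and>
       (\<forall>A\<in>carrier_mat n n. (\<forall>w\<in>W. A *\<^sub>v w \<in> W) \<longrightarrow> A * L = L * f A)"
      using Lc AL Linj by blast
  qed (use r fmult hmult fin in \<open>auto simp: f_def h_def\<close>)
qed

lemma poly_prod_list_root:
  fixes as :: "complex list"
  shows "a \<in> set as \<Longrightarrow> poly (\<Prod>a\<leftarrow>as. [:- a, 1:]) a = 0"
  by (induction as) auto

text \<open>\<open>W\<close> is an eigenspace of \<open>B\<close>: non-zero because the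
  characteristic polynomial has a root, proper because \<open>B\<close> is not scalar, and stable
  under every matrix commuting with \<open>B\<close>.\<close>

lemma nonscalar_commutant_subspace:
  fixes B :: "complex mat"
  assumes B: "B \<in> carrier_mat d d" and d: "0 < d" and ns: "\<And>c. B \<noteq> c \<cdot>\<^sub>m 1\<^sub>m d"
  obtains W where "VectorSpace.subspace class_ring W (module_vec TYPE(complex) d)"
    "W \<noteq> {0\<^sub>v d}" "W \<noteq> carrier_vec d"
    "\<forall>A\<in>carrier_mat d d. A * B = B * A \<longrightarrow> (\<forall>w\<in>W. A *\<^sub>v w \<in> W)"
proof -
  interpret vec_space "TYPE(complex)" d .
  obtain as where as: "char_poly B = (\<Prod>a\<leftarrow>as. [:- a, 1:])" "length as = d"
    using char_poly_factorized[OF B] by auto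
  then obtain c where "c \<in> set as" using d by (cases as) auto
  then have "eigenvalue B c"
    unfolding eigenvalue_root_char_poly[OF B] as(1) by (rule poly_prod_list_root)
  then obtain v where v: "v \<in> carrier_vec d" "v \<noteq> 0\<^sub>v d" "B *\<^sub>v v = c \<cdot>\<^sub>v v"
    unfolding eigenvalue_def eigenvector_def using B by auto
  define W where "W = {v \<in> carrier_vec d. B *\<^sub>v v = c \<cdot>\<^sub>v v}"
  have "submodule class_ring W V"
    unfolding submodule_def W_def using vec_module B
    by (auto simp: module_vec_def mult_add_distrib_mat_vec[OF B] mult_mat_vec[OF B]
        smult_add_distrib_vec[of _ d] smult_smult_assoc mult.commute)
  then have sub: "VectorSpace.subspace class_ring W V"
    unfolding subspace_def using vec_vs by auto
  have W0: "W \<noteq> {0\<^sub>v d}" using v unfolding W_def by auto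
  have W1: "W \<noteq> carrier_vec d"
  proof
    assume W: "W = carrier_vec d"
    have "B = c \<cdot>\<^sub>m 1\<^sub>m d"
    proof (rule mat_eqI[of _ d d])
      fix i j assume ij: "i < d" "j < d"
      have "unit_vec d j \<in> W" using W by simp
      then have "(B *\<^sub>v unit_vec d j) $ i = (c \<cdot>\<^sub>v unit_vec d j) $ i" unfolding W_def by simp
      then show "B $$ (i,j) = (c \<cdot>\<^sub>m 1\<^sub>m d) $$ (i,j)" using ij B by auto
    qed (use B in auto)
    then show False using ns by blast
  qed
  have inv: "\<forall>w\<in>W. A *\<^sub>v w \<in> W" if A: "A \<in> carrier_mat d d" "A * B = B * A" for A
  proof
    fix w assume "w \<in> W"
    then have w: "w \<in> carrier_vec d" "B *\<^sub>v w = c \<cdot>\<^sub>v w" unfolding W_def by auto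
    have "B *\<^sub>v (A *\<^sub>v w) = B * A *\<^sub>v w" using assoc_mult_mat_vec[OF B A(1) w(1)] by simp
    also have "\<dots> = A *\<^sub>v (B *\<^sub>v w)" using assoc_mult_mat_vec[OF A(1) B w(1)] A(2) by simp
    also have "\<dots> = c \<cdot>\<^sub>v (A *\<^sub>v w)" using w mult_mat_vec[OF A(1) w(1)] by simp
    finally show "A *\<^sub>v w \<in> W" using A w unfolding W_def by simp
  qed
  show ?thesis using that[OF sub W0 W1] inv by blast
qed

section \<open>Matrix representations\<close>

text \<open>Homomorphisms to \<open>GL d\<close>, spelled out so that no inverse matrices have to be
  exhibited when a representation is built; \<open>mrep_iff_hom\<close> is the equivalence.\<close>

definition mrep :: "('a, 'b) monoid_scheme \<Rightarrow> nat \<Rightarrow> ('a \<Rightarrow> complex mat) \<Rightarrow> bool" where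
  "mrep G d \<tau> \<longleftrightarrow> (\<forall>g\<in>carrier G. \<tau> g \<in> carrier_mat d d) \<and> \<tau> \<one>\<^bsub>G\<^esub> = 1\<^sub>m d \<and>
     (\<forall>g\<in>carrier G. \<forall>h\<in>carrier G. \<tau> (g \<otimes>\<^bsub>G\<^esub> h) = \<tau> g * \<tau> h)"

lemma mrepD:
  assumes "mrep G d \<tau>"
  shows "g \<in> carrier G \<Longrightarrow> \<tau> g \<in> carrier_mat d d" "\<tau> \<one>\<^bsub>G\<^esub> = 1\<^sub>m d"
    "g \<in> carrier G \<Longrightarrow> h \<in> carrier G \<Longrightarrow> \<tau> (g \<otimes>\<^bsub>G\<^esub> h) = \<tau> g * \<tau> h"
  using assms unfolding mrep_def by auto

lemma carrier_GL:
  "carrier (GL n) = {A \<in> carrier_mat n n. \<exists>B\<in>carrier_mat n n. B * A = 1\<^sub>m n \<and> A * B = 1\<^sub>m n}"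
  unfolding GL_def units_of_def Units_def ring_mat_def by auto

lemma mult_GL: "x \<otimes>\<^bsub>GL n\<^esub> y = x * y"
  unfolding GL_def units_of_def ring_mat_def by auto

lemma (in group) mrep_iff_hom: "mrep G d \<tau> \<longleftrightarrow> \<tau> \<in> hom G (GL d)"
proof
  assume \<tau>: "mrep G d \<tau>"
  note r = mrepD[OF \<tau>]
  have "\<tau> g \<in> carrier (GL d)" if g: "g \<in> carrier G" for g
  proof -
    have "\<tau> (inv g) * \<tau> g = 1\<^sub>m d" "\<tau> g * \<tau> (inv g) = 1\<^sub>m d"
      using r(2) r(3)[of g "inv g"] r(3)[of "inv g" g] g by auto
    then show ?thesis unfolding carrier_GL using r(1) g by auto
  qed
  then show "\<tau> \<in> hom G (GL d)" using r(3) by (auto simp: hom_def mult_GL)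
next
  assume \<tau>: "\<tau> \<in> hom G (GL d)"
  then have c: "\<tau> g \<in> carrier (GL d)" if "g \<in> carrier G" for g using that by (auto simp: hom_def)
  have m: "\<tau> (g \<otimes> h) = \<tau> g * \<tau> h" if "g \<in> carrier G" "h \<in> carrier G" for g h
    using \<tau> that by (auto simp: hom_def mult_GL)
  obtain B where B: "\<tau> \<one> \<in> carrier_mat d d" "B \<in> carrier_mat d d" "B * \<tau> \<one> = 1\<^sub>m d"
    using c[OF one_closed] unfolding carrier_GL by auto
  \<comment> \<open>The image of the unit is an invertible idempotent, hence the identity.\<close>
  have "\<tau> \<one> = B * \<tau> \<one> * \<tau> \<one>" using B by simp
  also have "\<dots> = B * (\<tau> \<one> * \<tau> \<one>)" by (rule sq_assoc[OF B(2,1,1)])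
  also have "\<tau> \<one> * \<tau> \<one> = \<tau> \<one>" using m[of \<one> \<one>] by simp
  finally show "mrep G d \<tau>" using B m c unfolding mrep_def carrier_GL by auto
qed

context group
begin

lemma mrep_inv:
  assumes "mrep G d \<tau>" "g \<in> carrier G"
  shows "\<tau> g * \<tau> (inv g) = 1\<^sub>m d" "\<tau> (inv g) * \<tau> g = 1\<^sub>m d"
  using mrepD(2)[OF assms(1)] mrepD(3)[OF assms(1), of g "inv g"]
    mrepD(3)[OF assms(1), of "inv g" g] assms(2) by auto

lemma mrep_pow:
  assumes "mrep G d \<tau>" "g \<in> carrier G"
  shows "\<tau> (g [^] (k :: nat)) = \<tau> g ^\<^sub>m k"
  by (induction k) (use assms mrepD[OF assms(1)] in \<open>auto\<close>)

lemma mrep_kernel_subgroup: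
  assumes "mrep G d \<tau>"
  shows "subgroup {g \<in> carrier G. \<tau> g = 1\<^sub>m d} G"
proof (rule subgroup.intro)
  fix x assume x: "x \<in> {g \<in> carrier G. \<tau> g = 1\<^sub>m d}"
  then show "inv x \<in> {g \<in> carrier G. \<tau> g = 1\<^sub>m d}"
    using mrep_inv(1)[OF assms, of x] mrepD(1)[OF assms, of "inv x"] by simp
qed (use mrepD[OF assms] in auto)

lemma irreducible_mrep:
  "irreducible_rep G d \<tau> \<longleftrightarrow> mrep G d \<tau> \<and> d > 0 \<and>
     (\<forall>W. invariant_subspace G d \<tau> W \<longrightarrow> W = {0\<^sub>v d} \<or> W = carrier_vec d)"
  unfolding irreducible_rep_def mrep_iff_hom by blast

lemma schur_scalar:
  assumes irr: "irreducible_rep G d \<tau>" and B: "B \<in> carrier_mat d d"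
    and com: "\<And>g. g \<in> carrier G \<Longrightarrow> \<tau> g * B = B * \<tau> g"
  obtains c where "B = c \<cdot>\<^sub>m 1\<^sub>m d"
proof -
  have \<tau>: "mrep G d \<tau>" and d: "0 < d"
    and ir: "\<And>W. invariant_subspace G d \<tau> W \<Longrightarrow> W = {0\<^sub>v d} \<or> W = carrier_vec d"
    using irr unfolding irreducible_mrep by auto
  have "\<exists>c. B = c \<cdot>\<^sub>m 1\<^sub>m d"
  proof (rule ccontr)
    assume "\<not> ?thesis"
    then have ns: "\<And>c. B \<noteq> c \<cdot>\<^sub>m 1\<^sub>m d" by blast
    obtain W where W: "VectorSpace.subspace class_ring W (module_vec TYPE(complex) d)"
      "W \<noteq> {0\<^sub>v d}" "W \<noteq> carrier_vec d"
      "\<forall>A\<in>carrier_mat d d. A * B = B * A \<longrightarrow> (\<forall>w\<in>W. A *\<^sub>v w \<in> W)"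
      by (rule nonscalar_commutant_subspace[OF B d ns])
    have "invariant_subspace G d \<tau> W"
      unfolding invariant_subspace_def using W mrepD(1)[OF \<tau>] com by blast
    then show False using ir W by blast
  qed
  then show ?thesis using that by blast
qed

text \<open>Both diagonal blocks with respect to \<open>W\<close> are representations of smaller
  degree, so they are trivial at \<open>k\<close>. Then \<open>\<tau> k\<close> is unipotent, and it
  has finite order because \<open>G\<close> is finite.\<close>

lemma reducible_mrep_trivial:
  assumes fin: "finite (carrier G)" and \<tau>: "mrep G d \<tau>" and W: "invariant_subspace G d \<tau> W"
    "W \<noteq> {0\<^sub>v d}" "W \<noteq> carrier_vec d" and k: "k \<in> carrier G"
    and small: "\<And>d' \<tau>'. d' < d \<Longrightarrow> mrep G d' \<tau>' \<Longrightarrow> \<tau>' k = 1\<^sub>m d'"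
  shows "\<tau> k = 1\<^sub>m d"
proof -
  have sub: "VectorSpace.subspace class_ring W (module_vec TYPE(complex) d)"
    and inv: "\<And>g. g \<in> carrier G \<Longrightarrow> \<forall>w\<in>W. \<tau> g *\<^sub>v w \<in> W"
    using W(1) unfolding invariant_subspace_def by auto
  obtain r and f h :: "complex mat \<Rightarrow> complex mat" where r: "0 < r" "r < d"
    and fc: "\<And>A. A \<in> carrier_mat d d \<Longrightarrow> f A \<in> carrier_mat r r"
    and hc: "\<And>A. A \<in> carrier_mat d d \<Longrightarrow> h A \<in> carrier_mat (d - r) (d - r)"
    and one: "f (1\<^sub>m d) = 1\<^sub>m r" "h (1\<^sub>m d) = 1\<^sub>m (d - r)"
    and fm: "\<And>A B. A \<in> carrier_mat d d \<Longrightarrow> B \<in> carrier_mat d d \<Longrightarrow> \<forall>w\<in>W. B *\<^sub>v w \<in> W \<Longrightarrow>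
       f (A * B) = f A * f B"
    and hm: "\<And>A B. A \<in> carrier_mat d d \<Longrightarrow> B \<in> carrier_mat d d \<Longrightarrow> \<forall>w\<in>W. A *\<^sub>v w \<in> W \<Longrightarrow>
       h (A * B) = h A * h B"
    and fin_ord: "\<And>A k. A \<in> carrier_mat d d \<Longrightarrow> \<forall>w\<in>W. A *\<^sub>v w \<in> W \<Longrightarrow> f A = 1\<^sub>m r \<Longrightarrow>
       h A = 1\<^sub>m (d - r) \<Longrightarrow> A ^\<^sub>m k = 1\<^sub>m d \<Longrightarrow> 0 < k \<Longrightarrow> A = 1\<^sub>m d"
    by (rule diagonal_blocks[OF sub W(2,3)]) blast
  note t = mrepD[OF \<tau>]
  have "mrep G r (\<lambda>g. f (\<tau> g))" unfolding mrep_def using t fc one fm inv by auto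
  then have fk: "f (\<tau> k) = 1\<^sub>m r" using small r by blast
  have "mrep G (d - r) (\<lambda>g. h (\<tau> g))" unfolding mrep_def using t hc one hm inv by auto
  then have hk: "h (\<tau> k) = 1\<^sub>m (d - r)" using small[of "d - r" "\<lambda>g. h (\<tau> g)"] r by auto
  have "\<tau> k ^\<^sub>m Coset.order G = 1\<^sub>m d"
    using mrep_pow[OF \<tau> k, of "Coset.order G"] pow_order_eq_1[OF k] t(2) by simp
  moreover have "0 < Coset.order G" using fin order_gt_0_iff_finite by simp
  ultimately show ?thesis using fin_ord[OF t(1)[OF k] inv[OF k] fk hk] by blast
qed

end

text \<open>Isolates what minimality contributes: a lower bound for the degrees above 1. No
  representation of degree \<open>n\<close> is singled out yet.\<close>

locale no_small_irreducible = group G for G (structure) +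
  fixes n :: nat
  assumes fin: "finite (carrier G)"
    and large: "\<And>d \<rho>. irreducible_rep G d \<rho> \<Longrightarrow> 1 < d \<Longrightarrow> n \<le> d"
begin

abbreviation K where "K \<equiv> derived G (carrier G)"

lemma K_carrier: "K \<subseteq> carrier G" using derived_in_carrier by blast

lemma linear_trivial:
  assumes \<tau>: "mrep G 1 \<tau>" and k: "k \<in> K"
  shows "\<tau> k = 1\<^sub>m 1"
proof -
  note t = mrepD[OF \<tau>]
  have com: "A * B = B * A" if "A \<in> carrier_mat 1 1" "B \<in> carrier_mat 1 1" for A B :: "complex mat"
    using that by (intro eq_matI) (auto simp: scalar_prod_def)
  have sq4: "A * (B * C) * D = (A * B) * (C * D)" if "A \<in> carrier_mat 1 1" "B \<in> carrier_mat 1 1"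
    "C \<in> carrier_mat 1 1" "D \<in> carrier_mat 1 1" for A B C D :: "complex mat"
    using that by (simp add: sq_assoc[of _ "Suc 0"])
  have "derived_set G (carrier G) \<subseteq> {g \<in> carrier G. \<tau> g = 1\<^sub>m 1}"
  proof
    fix z assume "z \<in> derived_set G (carrier G)"
    then obtain x y where xy: "x \<in> carrier G" "y \<in> carrier G" "z = x \<otimes> y \<otimes> inv x \<otimes> inv y" by auto
    have "\<tau> z = \<tau> x * \<tau> y * \<tau> (inv x) * \<tau> (inv y)" using xy t(3) by simp
    also have "\<dots> = \<tau> x * (\<tau> y * \<tau> (inv x)) * \<tau> (inv y)" using xy t(1) by (simp add: sq_assoc[of _ 1] del: One_nat_def)
    also have "\<tau> y * \<tau> (inv x) = \<tau> (inv x) * \<tau> y" using xy t(1) by (intro com) auto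
    also have "\<tau> x * (\<tau> (inv x) * \<tau> y) * \<tau> (inv y) = (\<tau> x * \<tau> (inv x)) * (\<tau> y * \<tau> (inv y))"
      using xy t(1) by (intro sq4) simp_all
    also have "\<dots> = 1\<^sub>m 1" using mrep_inv[OF \<tau>] xy by simp
    finally show "z \<in> {g \<in> carrier G. \<tau> g = 1\<^sub>m 1}" using xy by simp
  qed
  then have "K \<subseteq> {g \<in> carrier G. \<tau> g = 1\<^sub>m 1}"
    unfolding derived_def by (rule generate_subgroup_incl[OF _ mrep_kernel_subgroup[OF \<tau>]])
  then show ?thesis using k by auto
qed

text \<open>Induction on the degree: an irreducible representation of degree below \<open>n\<close>
  is linear and kills commutators, and a reducible one has blocks of smaller degree.\<close>

lemma small_mrep_trivial:
  assumes "mrep G d \<tau>" "d < n" "k \<in> K"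
  shows "\<tau> k = 1\<^sub>m d"
  using assms
proof (induction d arbitrary: \<tau> rule: less_induct)
  case (less d)
  have kc: "k \<in> carrier G" using less.prems K_carrier by auto
  show ?case
  proof (cases "d = 0")
    case True
    then show ?thesis using mrepD(1)[OF less.prems(1) kc] by auto
  next
    case False
    show ?thesis
    proof (cases "irreducible_rep G d \<tau>")
      case True
      then have "d = 1" using large[OF True] less.prems False by linarith
      then show ?thesis using linear_trivial less.prems by blast
    next
      case nirr: False
      then obtain W where "invariant_subspace G d \<tau> W" "W \<noteq> {0\<^sub>v d}" "W \<noteq> carrier_vec d"
        unfolding irreducible_mrep using less.prems False by auto
      then show ?thesis
        using reducible_mrep_trivial[OF fin less.prems(1) _ _ _ kc] less.IH less.prems by force
    qed
  qed
qed

lemma nonscalar_commutant_trivial: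
  assumes \<tau>: "mrep G d \<tau>" and d: "d \<le> n" "0 < d" and k: "k \<in> K"
    and B: "B \<in> carrier_mat d d" "\<And>g. g \<in> carrier G \<Longrightarrow> \<tau> g * B = B * \<tau> g"
      "\<And>c. B \<noteq> c \<cdot>\<^sub>m 1\<^sub>m d"
  shows "\<tau> k = 1\<^sub>m d"
proof -
  obtain W where W: "VectorSpace.subspace class_ring W (module_vec TYPE(complex) d)"
    "W \<noteq> {0\<^sub>v d}" "W \<noteq> carrier_vec d"
    "\<forall>A\<in>carrier_mat d d. A * B = B * A \<longrightarrow> (\<forall>w\<in>W. A *\<^sub>v w \<in> W)"
    by (rule nonscalar_commutant_subspace[OF B(1) d(2) B(3)])
  have "invariant_subspace G d \<tau> W"
    unfolding invariant_subspace_def using W mrepD(1)[OF \<tau>] B(2) by blast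
  moreover have "k \<in> carrier G" using k K_carrier by auto
  ultimately show ?thesis
    using reducible_mrep_trivial[OF fin \<tau> _ W(2,3)] small_mrep_trivial d k by force
qed

end

section \<open>Induced representations\<close>

text \<open>The inverses of representatives of the right cosets represent the left cosets, which is
  the side that the induced matrices use.\<close>

lemma (in group) left_transversal:
  assumes fin: "finite (carrier G)" and T: "subgroup T G"
  obtains t s where "t * card T = card (carrier G)" "\<And>i. i < t \<Longrightarrow> s i \<in> carrier G"
    "\<And>g. g \<in> carrier G \<Longrightarrow> \<exists>!i. i < t \<and> inv (s i) \<otimes> g \<in> T"
proof -
  interpret T: subgroup T G by fact
  define C where "C = rcosets T"
  have "finite C" using fin unfolding C_def RCOSETS_def by simp
  then obtain f where f: "bij_betw f {0..<card C} C" using ex_bij_betw_nat_finite by blast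
  have "\<exists>a\<in>carrier G. f i = T #> a" if "i < card C" for i
  proof -
    have "f i \<in> C" using that f by (auto simp: bij_betw_def)
    then show ?thesis unfolding C_def RCOSETS_def by auto
  qed
  then obtain a where a: "\<And>i. i < card C \<Longrightarrow> a i \<in> carrier G \<and> f i = T #> a i" by metis
  have iff: "a i \<otimes> g \<in> T \<longleftrightarrow> f i = T #> inv g" if i: "i < card C" and g: "g \<in> carrier G" for i g
  proof
    assume "a i \<otimes> g \<in> T"
    then have "a i \<in> T #> inv g"
      using a[OF i] g unfolding r_coset_def by (auto intro!: bexI[of _ "a i \<otimes> g"] simp: m_assoc)
    then show "f i = T #> inv g" using a[OF i] repr_independence[of "a i" T "inv g"] T g by simp
  next
    assume "f i = T #> inv g"
    then have "a i \<in> T #> inv g" using a[OF i] rcos_self[of "a i" T] T by simp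
    then obtain h where "h \<in> T" "a i = h \<otimes> inv g" unfolding r_coset_def by auto
    then show "a i \<otimes> g \<in> T" using g by (simp add: m_assoc)
  qed
  show ?thesis
  proof (rule that[of "card C" "\<lambda>i. inv (a i)"])
    show "card C * card T = card (carrier G)"
      unfolding C_def using lagrange_finite[OF fin T] by (simp add: Coset.order_def)
    fix g assume g: "g \<in> carrier G"
    have "T #> inv g \<in> C" unfolding C_def RCOSETS_def using g by auto
    then have "T #> inv g \<in> f ` {0..<card C}" using f by (simp add: bij_betw_def)
    then obtain i where i: "i < card C" "f i = T #> inv g" by auto
    have inj: "i' = i" if "i' < card C" "f i' = T #> inv g" for i'
      using f i that inj_onD[of f "{0..<card C}" i' i] by (simp add: bij_betw_def)
    have ii: "inv (inv (a i')) = a i'" if "i' < card C" for i' using a[OF that] by simp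
    show "\<exists>!i. i < card C \<and> inv (inv (a i)) \<otimes> g \<in> T"
    proof (rule ex1I[of _ i])
      show "i < card C \<and> inv (inv (a i)) \<otimes> g \<in> T" using i iff[OF i(1) g] ii[OF i(1)] by simp
      fix i' assume "i' < card C \<and> inv (inv (a i')) \<otimes> g \<in> T"
      then show "i' = i" using iff[OF _ g, of i'] ii[of i'] inj[of i'] by simp
    qed
  qed (use a in auto)
qed

text \<open>An index below \<open>t * e\<close> encodes a pair by quotient and remainder. This
  serves both the block matrices of induced representations and, with \<open>t = e = n\<close>,
  matrices flattened to vectors.\<close>

lemma sum_div_mod:
  fixes t e :: nat
  shows "(\<Sum>q<t * e. F (q div e) (q mod e)) = (\<Sum>j<t. \<Sum>b<e. F j b :: 'c :: comm_monoid_add)"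
proof -
  have "(\<Sum>q<t * e. F (q div e) (q mod e)) = (\<Sum>j<t. \<Sum>q=j * e..<j * e + e. F (q div e) (q mod e))"
    by (rule sum.nat_group[symmetric])
  also have "\<dots> = (\<Sum>j<t. \<Sum>b<e. F j b)"
  proof (rule sum.cong[OF refl])
    fix j :: nat
    have "(\<Sum>q=j * e..<j * e + e. F (q div e) (q mod e))
        = (\<Sum>b=0..<e. F ((b + j * e) div e) ((b + j * e) mod e))"
      using sum.shift_bounds_nat_ivl[of "\<lambda>q. F (q div e) (q mod e)" 0 "j * e" e] by (simp add: add.commute)
    also have "\<dots> = (\<Sum>b<e. F j b)" by (auto simp: atLeast0LessThan intro!: sum.cong)
    finally show "(\<Sum>q=j * e..<j * e + e. F (q div e) (q mod e)) = (\<Sum>b<e. F j b)" .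
  qed
  finally show ?thesis .
qed

lemma div_mod_less:
  assumes "p < t * (e :: nat)" shows "p div e < t" "p mod e < e"
  using assms by (auto simp: less_mult_imp_div_less intro!: mod_less_divisor gr0I)

lemma mult_mat_blocks:
  assumes "A \<in> carrier_mat (t * e) (t * e)" "B \<in> carrier_mat (t * e) (t * e)"
    "p < t * e" "r < t * e"
    "\<And>q. q < t * e \<Longrightarrow> A $$ (p,q) = F (q div e) (q mod e)"
    "\<And>q. q < t * e \<Longrightarrow> B $$ (q,r) = H (q div e) (q mod e)"
  shows "(A * B) $$ (p,r) = (\<Sum>j<t. \<Sum>b<e. F j b * H j b)"
proof -
  have "(A * B) $$ (p,r) = (\<Sum>q<t * e. A $$ (p,q) * B $$ (q,r))"
    using assms(1-4) by (auto simp: scalar_prod_def atLeast0LessThan)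
  also have "\<dots> = (\<Sum>q<t * e. F (q div e) (q mod e) * H (q div e) (q mod e))"
    using assms(5,6) by auto
  also have "\<dots> = (\<Sum>j<t. \<Sum>b<e. F j b * H j b)" by (rule sum_div_mod)
  finally show ?thesis .
qed

text \<open>The block matrix with \<open>\<sigma>\<close> of
  \<open>s\<^sub>i\<inverse> g s\<^sub>j\<close> as block \<open>(i,j)\<close> if that element lies
  in \<open>T\<close>, and 0 otherwise; the row \<open>p\<close> belongs to the coset
  \<open>p div e\<close> and the basis vector \<open>p mod e\<close>.\<close>

definition induced :: "('a, 'b) monoid_scheme \<Rightarrow> 'a set \<Rightarrow> nat \<Rightarrow> (nat \<Rightarrow> 'a) \<Rightarrow> nat \<Rightarrow>
    ('a \<Rightarrow> complex mat) \<Rightarrow> 'a \<Rightarrow> complex mat" where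
  "induced G T t s e \<sigma> g = mat (t * e) (t * e) (\<lambda>(p,q).
     if inv\<^bsub>G\<^esub> (s (p div e)) \<otimes>\<^bsub>G\<^esub> g \<otimes>\<^bsub>G\<^esub> s (q div e) \<in> T
     then \<sigma> (inv\<^bsub>G\<^esub> (s (p div e)) \<otimes>\<^bsub>G\<^esub> g \<otimes>\<^bsub>G\<^esub> s (q div e)) $$ (p mod e, q mod e) else 0)"

locale transversal = group G for G (structure) +
  fixes T :: "'a set" and t :: nat and s :: "nat \<Rightarrow> 'a"
  assumes T: "subgroup T G"
    and s: "\<And>i. i < t \<Longrightarrow> s i \<in> carrier G"
    and uniq: "\<And>g. g \<in> carrier G \<Longrightarrow> \<exists>!i. i < t \<and> inv (s i) \<otimes> g \<in> T"
begin

lemma coset_diag: "i < t \<Longrightarrow> j < t \<Longrightarrow> inv (s i) \<otimes> s j \<in> T \<longleftrightarrow> i = j"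
  using uniq[OF s, of j] subgroup.one_closed[OF T] s[of j] by (metis l_inv)

lemma coset_index:
  assumes "g \<in> carrier G" "k < t"
  obtains j where "j < t" "inv (s j) \<otimes> g \<otimes> s k \<in> T"
    "\<And>j'. j' < t \<Longrightarrow> inv (s j') \<otimes> g \<otimes> s k \<in> T \<Longrightarrow> j' = j"
proof -
  have eq: "inv (s j) \<otimes> g \<otimes> s k = inv (s j) \<otimes> (g \<otimes> s k)" if "j < t" for j
    using assms s that by (simp add: m_assoc)
  obtain j where j: "j < t" "inv (s j) \<otimes> (g \<otimes> s k) \<in> T"
    "\<And>j'. j' < t \<Longrightarrow> inv (s j') \<otimes> (g \<otimes> s k) \<in> T \<Longrightarrow> j' = j"
    using uniq[of "g \<otimes> s k"] assms s by auto
  show ?thesis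
  proof (rule that[OF j(1)])
    show "inv (s j) \<otimes> g \<otimes> s k \<in> T" unfolding eq[OF j(1)] by (rule j(2))
    fix j' assume j': "j' < t" "inv (s j') \<otimes> g \<otimes> s k \<in> T"
    show "j' = j" using j'(2) unfolding eq[OF j'(1)] by (rule j(3)[OF j'(1)])
  qed
qed

lemma mrep_induced:
  assumes \<sigma>: "mrep (G\<lparr>carrier := T\<rparr>) e \<sigma>"
  shows "mrep G (t * e) (induced G T t s e \<sigma>)"
proof -
  have \<sigma>c: "\<And>x. x \<in> T \<Longrightarrow> \<sigma> x \<in> carrier_mat e e" and \<sigma>1: "\<sigma> \<one> = 1\<^sub>m e"
    and \<sigma>m: "\<And>x y. x \<in> T \<Longrightarrow> y \<in> T \<Longrightarrow> \<sigma> (x \<otimes> y) = \<sigma> x * \<sigma> y"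
    using mrepD[OF \<sigma>] by auto
  have c: "induced G T t s e \<sigma> g \<in> carrier_mat (t * e) (t * e)" for g by (simp add: induced_def)
  have one: "induced G T t s e \<sigma> \<one> = 1\<^sub>m (t * e)"
  proof (rule mat_eqI[of _ "t * e" "t * e"])
    fix p q assume pq: "p < t * e" "q < t * e"
    note d = div_mod_less[OF pq(1)] div_mod_less[OF pq(2)]
    have "inv (s (p div e)) \<otimes> \<one> \<otimes> s (q div e) = inv (s (p div e)) \<otimes> s (q div e)"
      using d s by simp
    moreover have "p = q \<longleftrightarrow> p div e = q div e \<and> p mod e = q mod e"
      by (metis div_mult_mod_eq)
    moreover have "inv (s (p div e)) \<otimes> s (p div e) = \<one>" using d s by simp
    ultimately show "induced G T t s e \<sigma> \<one> $$ (p,q) = 1\<^sub>m (t * e) $$ (p,q)"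
      using pq d \<sigma>1 coset_diag[OF d(1) d(3)] by (auto simp: induced_def)
  qed (auto simp: induced_def)
  have mult: "induced G T t s e \<sigma> (g \<otimes> h) = induced G T t s e \<sigma> g * induced G T t s e \<sigma> h"
    if g: "g \<in> carrier G" and h: "h \<in> carrier G" for g h
  proof (rule mat_eqI[of _ "t * e" "t * e"])
    fix p r assume pr: "p < t * e" "r < t * e"
    note d = div_mod_less[OF pr(1)] div_mod_less[OF pr(2)]
    let ?i = "p div e" and ?a = "p mod e" and ?k = "r div e" and ?c = "r mod e"
    let ?x = "\<lambda>j. inv (s ?i) \<otimes> g \<otimes> s j" and ?y = "\<lambda>j. inv (s j) \<otimes> h \<otimes> s ?k"
    define F where "F j b = (if ?x j \<in> T then \<sigma> (?x j) $$ (?a,b) else 0)" for j b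
    define H where "H j b = (if ?y j \<in> T then \<sigma> (?y j) $$ (b,?c) else 0)" for j b
    \<comment> \<open>The block column \<open>?k\<close> of the second factor has a single non-zero
      block, in row \<open>j\<close>; this collapses the sum over the blocks.\<close>
    obtain j where j: "j < t" "?y j \<in> T" "\<And>j'. j' < t \<Longrightarrow> ?y j' \<in> T \<Longrightarrow> j' = j"
      using coset_index[OF h d(3)] by blast
    have xy: "?x j \<otimes> ?y j = inv (s ?i) \<otimes> (g \<otimes> h) \<otimes> s ?k"
    proof -
      have "?x j \<otimes> ?y j = inv (s ?i) \<otimes> g \<otimes> (s j \<otimes> inv (s j)) \<otimes> h \<otimes> s ?k"
        using s[OF d(1)] s[OF d(3)] s[OF j(1)] g h by (simp only: m_assoc m_closed inv_closed)
      then show ?thesis using s[OF d(1)] s[OF d(3)] s[OF j(1)] g h by (simp add: m_assoc)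
    qed
    have xc: "?x j \<in> carrier G" using s[OF d(1)] s[OF j(1)] g by simp
    have "(induced G T t s e \<sigma> g * induced G T t s e \<sigma> h) $$ (p,r) = (\<Sum>j<t. \<Sum>b<e. F j b * H j b)"
      by (rule mult_mat_blocks[OF c c pr]) (use pr in \<open>auto simp: induced_def F_def H_def\<close>)
    also have "\<dots> = (\<Sum>j\<in>{j}. \<Sum>b<e. F j b * H j b)"
    proof (rule sum.mono_neutral_right)
      have "H i b = 0" if "i < t" "i \<noteq> j" for i b
        using j(3)[OF that(1)] that(2) unfolding H_def by auto
      then show "\<forall>i\<in>{..<t} - {j}. (\<Sum>b<e. F i b * H i b) = 0" by simp
    qed (use j(1) in auto)
    also have "\<dots> = (\<Sum>b<e. F j b * H j b)" by simp
    also have "\<dots> = (if ?x j \<otimes> ?y j \<in> T then \<sigma> (?x j \<otimes> ?y j) $$ (?a,?c) else 0)"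
    proof (cases "?x j \<in> T")
      case True
      then have "\<sigma> (?x j \<otimes> ?y j) $$ (?a,?c) = (\<Sum>b<e. F j b * H j b)"
        using \<sigma>m[OF True j(2)] \<sigma>c[OF True] \<sigma>c[OF j(2)] j(2) d
        by (auto simp: F_def H_def scalar_prod_def atLeast0LessThan)
      then show ?thesis using True j(2) subgroup.m_closed[OF T] by simp
    next
      case False
      have "?x j = ?x j \<otimes> ?y j \<otimes> inv (?y j)"
        using xc subgroup.mem_carrier[OF T j(2)] by (simp only: m_assoc r_inv inv_closed r_one)
      then have "?x j \<otimes> ?y j \<notin> T"
        using False subgroup.m_closed[OF T] subgroup.m_inv_closed[OF T j(2)] by metis
      then show ?thesis using False by (simp add: F_def)
    qed
    also have "\<dots> = induced G T t s e \<sigma> (g \<otimes> h) $$ (p,r)"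
      unfolding xy using pr by (simp add: induced_def)
    finally show "induced G T t s e \<sigma> (g \<otimes> h) $$ (p,r)
      = (induced G T t s e \<sigma> g * induced G T t s e \<sigma> h) $$ (p,r)" ..
  qed (auto simp: induced_def)
  show ?thesis unfolding mrep_def using c one mult by blast
qed

text \<open>Reads off the diagonal block of the coset \<open>i\<close>. As \<open>0 < e\<close>,
  that block has a diagonal entry 1, which excludes the default value 0 and so puts the conjugate
  into \<open>T\<close>.\<close>

lemma induced_eq_oneD:
  assumes \<sigma>: "mrep (G\<lparr>carrier := T\<rparr>) e \<sigma>" and e: "0 < e" and i: "i < t"
    and eq: "induced G T t s e \<sigma> g = 1\<^sub>m (t * e)"
  shows "inv (s i) \<otimes> g \<otimes> s i \<in> T" "\<sigma> (inv (s i) \<otimes> g \<otimes> s i) = 1\<^sub>m e"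
proof -
  let ?x = "inv (s i) \<otimes> g \<otimes> s i"
  have lt: "i * e + a < t * e" if "a < e" for a
  proof -
    have "i * e + a < Suc i * e" using that by simp
    also have "\<dots> \<le> t * e" using i by (intro mult_le_mono1) simp
    finally show ?thesis .
  qed
  have ent: "(if ?x \<in> T then \<sigma> ?x $$ (a,b) else 0) = (if a = b then 1 else 0)" if "a < e" "b < e" for a b
  proof -
    have "(i * e + a) div e = i" "(i * e + a) mod e = a" "(i * e + b) div e = i" "(i * e + b) mod e = b"
      using that by auto
    then show ?thesis
      using arg_cong[OF eq, of "\<lambda>M. M $$ (i * e + a, i * e + b)"] lt[OF that(1)] lt[OF that(2)]
      by (simp add: induced_def cong: if_cong)
  qed
  show x: "?x \<in> T" using ent[OF e e] by (auto split: if_splits)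
  then show "\<sigma> ?x = 1\<^sub>m e"
    using ent mrepD(1)[OF \<sigma>, of ?x] by (intro eq_matI) auto
qed

text \<open>Endomorphisms of \<open>\<sigma>\<close> extend to the induced representation as block
  diagonal matrices with all blocks equal to \<open>J\<close>. This is how the reducibility of
  \<open>\<sigma>\<close> is passed on.\<close>

lemma induced_commutant:
  assumes \<sigma>: "mrep (G\<lparr>carrier := T\<rparr>) e \<sigma>" and J: "J \<in> carrier_mat e e"
    and com: "\<And>x. x \<in> T \<Longrightarrow> \<sigma> x * J = J * \<sigma> x"
  shows "induced G T t s e \<sigma> g * mat (t * e) (t * e) (\<lambda>(p,q). if p div e = q div e then J $$ (p mod e,q mod e) else 0)
    = mat (t * e) (t * e) (\<lambda>(p,q). if p div e = q div e then J $$ (p mod e,q mod e) else 0) * induced G T t s e \<sigma> g"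
    (is "?I * ?J = ?J * ?I")
proof (rule eq_matI)
  have c: "?I \<in> carrier_mat (t * e) (t * e)" "?J \<in> carrier_mat (t * e) (t * e)"
    by (auto simp: induced_def)
  fix p r assume "p < dim_row (?J * ?I)" "r < dim_col (?J * ?I)"
  then have pr: "p < t * e" "r < t * e" using c by auto
  note d = div_mod_less[OF pr(1)] div_mod_less[OF pr(2)]
  let ?i = "p div e" and ?a = "p mod e" and ?k = "r div e" and ?c = "r mod e"
  let ?x = "inv (s ?i) \<otimes> g \<otimes> s ?k"
  define F where "F j b = (if inv (s ?i) \<otimes> g \<otimes> s j \<in> T
    then \<sigma> (inv (s ?i) \<otimes> g \<otimes> s j) $$ (?a,b) else 0)" for j b
  define H where "H j b = (if inv (s j) \<otimes> g \<otimes> s ?k \<in> T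
    then \<sigma> (inv (s j) \<otimes> g \<otimes> s ?k) $$ (b,?c) else 0)" for j b
  have "(?I * ?J) $$ (p,r) = (\<Sum>j<t. \<Sum>b<e. F j b * (if j = ?k then J $$ (b,?c) else 0))"
    by (rule mult_mat_blocks[OF c pr]) (use pr in \<open>auto simp: induced_def F_def\<close>)
  also have "\<dots> = (\<Sum>j\<in>{?k}. \<Sum>b<e. F j b * (if j = ?k then J $$ (b,?c) else 0))"
    by (rule sum.mono_neutral_right) (use d in \<open>auto intro!: sum.neutral\<close>)
  also have "\<dots> = (if ?x \<in> T then (\<sigma> ?x * J) $$ (?a,?c) else 0)"
    using d J mrepD(1)[OF \<sigma>, of ?x] by (auto simp: F_def scalar_prod_def atLeast0LessThan)
  also have "\<dots> = (if ?x \<in> T then (J * \<sigma> ?x) $$ (?a,?c) else 0)" using com by simp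
  also have "\<dots> = (\<Sum>j\<in>{?i}. \<Sum>b<e. (if ?i = j then J $$ (?a,b) else 0) * H j b)"
    using d J mrepD(1)[OF \<sigma>, of ?x] by (auto simp: H_def scalar_prod_def atLeast0LessThan)
  also have "\<dots> = (\<Sum>j<t. \<Sum>b<e. (if ?i = j then J $$ (?a,b) else 0) * H j b)"
    by (rule sum.mono_neutral_left) (use d in \<open>auto intro!: sum.neutral\<close>)
  also have "\<dots> = (?J * ?I) $$ (p,r)"
    by (rule mult_mat_blocks[OF c(2,1) pr, symmetric]) (use pr in \<open>auto simp: induced_def H_def\<close>)
  finally show "(?I * ?J) $$ (p,r) = (?J * ?I) $$ (p,r)" .
qed (auto simp: induced_def)

text \<open>Inducing the trivial representation gives the permutation matrices on the cosets of
  \<open>T\<close>; all their row and column sums are 1, so they commute with the all-ones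
  matrix.\<close>

lemma permutation_commutant:
  assumes g: "g \<in> carrier G"
  shows "induced G T t s 1 (\<lambda>_. 1\<^sub>m 1) g * mat t t (\<lambda>_. 1) = mat t t (\<lambda>_. 1) * induced G T t s 1 (\<lambda>_. 1\<^sub>m 1) g"
    (is "?I * ?J = ?J * ?I")
proof (rule mat_eqI[of _ t t])
  have ent: "?I $$ (i,j) = (if inv (s i) \<otimes> g \<otimes> s j \<in> T then 1 else 0)" if "i < t" "j < t" for i j
    using that by (simp add: induced_def)
  fix i k assume ik: "i < t" "k < t"
  \<comment> \<open>Turns the row sum for \<open>g\<close> into a column sum for the inverse of
    \<open>g\<close>, where \<open>coset_index\<close> applies.\<close>
  have inv_sw: "inv (s i) \<otimes> g \<otimes> s j \<in> T \<longleftrightarrow> inv (s j) \<otimes> inv g \<otimes> s i \<in> T" if "j < t" for j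
  proof -
    have "inv (inv (s i) \<otimes> g \<otimes> s j) = inv (s j) \<otimes> inv g \<otimes> s i"
      using s[OF ik(1)] s[OF that] g by (simp add: inv_mult_group m_assoc)
    moreover have "inv (s i) \<otimes> g \<otimes> s j \<in> carrier G" using s[OF ik(1)] s[OF that] g by simp
    ultimately show ?thesis using subgroup.m_inv_closed[OF T] inv_inv by metis
  qed
  obtain j where j: "j < t" "inv (s j) \<otimes> inv g \<otimes> s i \<in> T"
    "\<And>j'. j' < t \<Longrightarrow> inv (s j') \<otimes> inv g \<otimes> s i \<in> T \<Longrightarrow> j' = j"
    using coset_index[of "inv g" i] g ik by auto
  obtain l where l: "l < t" "inv (s l) \<otimes> g \<otimes> s k \<in> T"
    "\<And>j'. j' < t \<Longrightarrow> inv (s j') \<otimes> g \<otimes> s k \<in> T \<Longrightarrow> j' = l"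
    using coset_index[of g k] g ik by auto
  have "(?I * ?J) $$ (i,k) = (\<Sum>q<t. if inv (s i) \<otimes> g \<otimes> s q \<in> T then 1 else 0)"
    using ik by (auto simp: scalar_prod_def atLeast0LessThan ent induced_def intro!: sum.cong)
  also have "\<dots> = (\<Sum>q<t. if q = j then 1 else 0)"
  proof (rule sum.cong[OF refl])
    fix q assume "q \<in> {..<t}"
    then have "inv (s i) \<otimes> g \<otimes> s q \<in> T \<longleftrightarrow> q = j" using inv_sw[of q] j by blast
    then show "(if inv (s i) \<otimes> g \<otimes> s q \<in> T then 1 else 0) = (if q = j then 1 else 0)" by simp
  qed
  also have "\<dots> = (\<Sum>q<t. if q = l then 1 else 0)" using j(1) l(1) by simp
  also have "\<dots> = (\<Sum>q<t. if inv (s q) \<otimes> g \<otimes> s k \<in> T then 1 else 0)"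
  proof (rule sum.cong[OF refl])
    fix q assume "q \<in> {..<t}"
    then have "inv (s q) \<otimes> g \<otimes> s k \<in> T \<longleftrightarrow> q = l" using l by blast
    then show "(if q = l then 1 else 0) = (if inv (s q) \<otimes> g \<otimes> s k \<in> T then 1 else 0)" by simp
  qed
  also have "\<dots> = (?J * ?I) $$ (i,k)"
    using ik by (auto simp: scalar_prod_def atLeast0LessThan ent induced_def intro!: sum.cong)
  finally show "(?I * ?J) $$ (i,k) = (?J * ?I) $$ (i,k)" .
qed (auto simp: induced_def)

end

section \<open>Consequences of induction for the derived subgroup\<close>

context no_small_irreducible
begin

lemma K_conj: "k \<in> K \<Longrightarrow> g \<in> carrier G \<Longrightarrow> g \<otimes> k \<otimes> inv g \<in> K"
  using normal.inv_op_closed2[OF derived_self_is_normal] by blast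

lemma mrep_transversal_trivial:
  assumes "transversal G T t s" and \<sigma>: "mrep (G\<lparr>carrier := T\<rparr>) e \<sigma>" and e: "0 < e"
    and triv: "\<And>k. k \<in> K \<Longrightarrow> induced G T t s e \<sigma> k = 1\<^sub>m (t * e)" and k: "k \<in> K"
  shows "k \<in> T" "\<sigma> k = 1\<^sub>m e"
proof -
  interpret transversal G T t s by fact
  obtain i where i: "i < t" using uniq[OF one_closed] by auto
  \<comment> \<open>Chosen so that the diagonal block of \<open>k'\<close> at the coset
    \<open>i\<close> is \<open>\<sigma> k\<close>; normality of \<open>K\<close> keeps
    \<open>k'\<close> in \<open>K\<close>.\<close>
  define k' where "k' = s i \<otimes> k \<otimes> inv (s i)"
  have kc: "k \<in> carrier G" using k K_carrier by auto
  have k': "k' \<in> K" unfolding k'_def using K_conj[OF k s[OF i]] .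
  have eq: "inv (s i) \<otimes> k' \<otimes> s i = k"
  proof -
    have "inv (s i) \<otimes> k' \<otimes> s i = (inv (s i) \<otimes> s i) \<otimes> k \<otimes> (inv (s i) \<otimes> s i)"
      unfolding k'_def using kc s[OF i] by (simp only: m_assoc m_closed inv_closed)
    then show ?thesis using kc s[OF i] by simp
  qed
  show "k \<in> T" "\<sigma> k = 1\<^sub>m e" using induced_eq_oneD[OF \<sigma> e i triv[OF k']] unfolding eq .
qed

lemma transversal_exists:
  assumes T: "subgroup T G" and t: "t * card T = card (carrier G)"
  obtains s where "transversal G T t s"
proof -
  obtain t' s where s: "t' * card T = card (carrier G)" "\<And>i. i < t' \<Longrightarrow> s i \<in> carrier G"
    "\<And>g. g \<in> carrier G \<Longrightarrow> \<exists>!i. i < t' \<and> inv (s i) \<otimes> g \<in> T"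
    using left_transversal[OF fin T] by blast
  have "card T \<noteq> 0" using T fin by (metis card_0_eq empty_iff finite_subset subgroup.one_closed subgroup.subset)
  then have tt: "t' = t" using t s(1) mult_right_cancel[of "card T" t' t] by simp
  have "transversal G T t s"
    by (intro transversal.intro transversal_axioms.intro group_axioms) (use T s tt in auto)
  then show ?thesis by (rule that)
qed

text \<open>The induced representation has degree \<open>t * e \<le> n\<close> and commutes with the
  block diagonal extension of \<open>J\<close>, which is not scalar either; so \<open>K\<close> acts
  trivially on it and hence through \<open>\<sigma>\<close>.\<close>

lemma subgroup_mrep_trivial:
  assumes T: "subgroup T G" and t: "t * card T = card (carrier G)"
    and \<sigma>: "mrep (G\<lparr>carrier := T\<rparr>) e \<sigma>" and e: "0 < e" "t * e \<le> n"
    and J: "J \<in> carrier_mat e e" "\<And>x. x \<in> T \<Longrightarrow> \<sigma> x * J = J * \<sigma> x" "\<And>c. J \<noteq> c \<cdot>\<^sub>m 1\<^sub>m e"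
    and k: "k \<in> K"
  shows "k \<in> T" "\<sigma> k = 1\<^sub>m e"
proof -
  obtain s where "transversal G T t s" by (rule transversal_exists[OF T t])
  then interpret transversal G T t s .
  obtain i0 where i0: "i0 < t" using uniq[OF one_closed] by auto
  let ?J = "mat (t * e) (t * e) (\<lambda>(p,q). if p div e = q div e then J $$ (p mod e,q mod e) else 0)"
  have ns: "?J \<noteq> c \<cdot>\<^sub>m 1\<^sub>m (t * e)" for c
  proof
    assume eq: "?J = c \<cdot>\<^sub>m 1\<^sub>m (t * e)"
    have le: "e \<le> t * e" using i0 by simp
    have "J = c \<cdot>\<^sub>m 1\<^sub>m e"
    proof (rule mat_eqI[of _ e e])
      fix a b assume ab: "a < e" "b < e"
      then show "J $$ (a,b) = (c \<cdot>\<^sub>m 1\<^sub>m e) $$ (a,b)"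
        using arg_cong[OF eq, of "\<lambda>M. M $$ (a,b)"] le by simp
    qed (use J in auto)
    then show False using J(3) by blast
  qed
  have "induced G T t s e \<sigma> k = 1\<^sub>m (t * e)" if "k \<in> K" for k
    by (rule nonscalar_commutant_trivial[OF mrep_induced[OF \<sigma>] e(2) _ that _ induced_commutant[OF \<sigma> J(1,2)] ns])
      (use e i0 in auto)
  then show "k \<in> T" "\<sigma> k = 1\<^sub>m e"
    using mrep_transversal_trivial[OF transversal_axioms \<sigma> e(1) _ k] by blast+
qed

text \<open>For \<open>t > 1\<close> the permutation representation on the cosets of
  \<open>T\<close> is reducible, since the all-ones matrix is not scalar; so \<open>K\<close> fixes
  every coset.\<close>

lemma small_index_contains_K:
  assumes T: "subgroup T G" and t: "t * card T = card (carrier G)" "t \<le> n"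
  shows "K \<subseteq> T"
proof
  fix k assume k: "k \<in> K"
  obtain s where "transversal G T t s" by (rule transversal_exists[OF T t(1)])
  then interpret transversal G T t s .
  obtain i0 where i0: "i0 < t" using uniq[OF one_closed] by auto
  have \<sigma>: "mrep (G\<lparr>carrier := T\<rparr>) 1 (\<lambda>_. 1\<^sub>m 1)" unfolding mrep_def by simp
  show "k \<in> T"
  proof (cases "t = 1")
    case True
    then have "T = carrier G"
      using t(1) fin subgroup.subset[OF T] by (metis card_subset_eq mult_1)
    then show ?thesis using k K_carrier by auto
  next
    case False
    then have t2: "1 < t" using i0 by simp
    let ?J = "mat t t (\<lambda>_. 1 :: complex)"
    have ns: "?J \<noteq> c \<cdot>\<^sub>m 1\<^sub>m (t * 1)" for c
    proof
      assume eq: "?J = c \<cdot>\<^sub>m 1\<^sub>m (t * 1)"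
      show False using arg_cong[OF eq, of "\<lambda>M. M $$ (0,1)"] t2 by simp
    qed
    have "induced G T t s 1 (\<lambda>_. 1\<^sub>m 1) k = 1\<^sub>m (t * 1)" if "k \<in> K" for k
      by (rule nonscalar_commutant_trivial[OF mrep_induced[OF \<sigma>] _ _ that _ permutation_commutant ns])
        (use t t2 in auto)
    then show ?thesis
      using mrep_transversal_trivial(1)[OF transversal_axioms \<sigma> _ _ k] by simp
  qed
qed

end

section \<open>Sums of matrices over a finite set\<close>

text \<open>Matrices have no zero of unspecified size, so the sum is taken entrywise in a prescribed
  dimension \<open>e\<close>.\<close>

definition msum :: "nat \<Rightarrow> ('x \<Rightarrow> complex mat) \<Rightarrow> 'x set \<Rightarrow> complex mat" where
  "msum e F S = mat e e (\<lambda>(a,b). \<Sum>x\<in>S. F x $$ (a,b))"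

lemma msum_carrier [simp]: "msum e F S \<in> carrier_mat e e"
  by (simp add: msum_def)

lemma mult_msum:
  assumes "C \<in> carrier_mat e e" "\<And>x. x \<in> S \<Longrightarrow> F x \<in> carrier_mat e e"
  shows "C * msum e F S = msum e (\<lambda>x. C * F x) S"
proof (rule mat_eqI[of _ e e])
  fix a b assume ab: "a < e" "b < e"
  have "(C * msum e F S) $$ (a,b) = (\<Sum>k<e. \<Sum>x\<in>S. C $$ (a,k) * F x $$ (k,b))"
    using assms(1) ab by (auto simp: msum_def scalar_prod_def atLeast0LessThan sum_distrib_left)
  also have "\<dots> = (\<Sum>x\<in>S. \<Sum>k<e. C $$ (a,k) * F x $$ (k,b))" by (rule sum.swap)
  also have "\<dots> = (\<Sum>x\<in>S. (C * F x) $$ (a,b))"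
    by (rule sum.cong[OF refl], drule assms(2))
      (use assms(1) ab in \<open>auto simp: scalar_prod_def atLeast0LessThan\<close>)
  also have "\<dots> = msum e (\<lambda>x. C * F x) S $$ (a,b)" using ab by (simp add: msum_def)
  finally show "(C * msum e F S) $$ (a,b) = msum e (\<lambda>x. C * F x) S $$ (a,b)" .
qed (use assms(1) in \<open>auto simp: msum_def\<close>)

lemma msum_mult:
  assumes "C \<in> carrier_mat e e" "\<And>x. x \<in> S \<Longrightarrow> F x \<in> carrier_mat e e"
  shows "msum e F S * C = msum e (\<lambda>x. F x * C) S"
proof (rule mat_eqI[of _ e e])
  fix a b assume ab: "a < e" "b < e"
  have "(msum e F S * C) $$ (a,b) = (\<Sum>k<e. \<Sum>x\<in>S. F x $$ (a,k) * C $$ (k,b))"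
    using assms(1) ab by (auto simp: msum_def scalar_prod_def atLeast0LessThan sum_distrib_right)
  also have "\<dots> = (\<Sum>x\<in>S. \<Sum>k<e. F x $$ (a,k) * C $$ (k,b))" by (rule sum.swap)
  also have "\<dots> = (\<Sum>x\<in>S. (F x * C) $$ (a,b))"
    by (rule sum.cong[OF refl], drule assms(2))
      (use assms(1) ab in \<open>auto simp: scalar_prod_def atLeast0LessThan\<close>)
  also have "\<dots> = msum e (\<lambda>x. F x * C) S $$ (a,b)" using ab by (simp add: msum_def)
  finally show "(msum e F S * C) $$ (a,b) = msum e (\<lambda>x. F x * C) S $$ (a,b)" .
qed (use assms(1) in \<open>auto simp: msum_def\<close>)

lemma msum_cong: "(\<And>x. x \<in> S \<Longrightarrow> F x = H x) \<Longrightarrow> msum e F S = msum e H S"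
  by (simp add: msum_def)

lemma msum_reindex: "bij_betw f S S' \<Longrightarrow> msum e (\<lambda>x. F (f x)) S = msum e F S'"
  unfolding msum_def using sum.reindex_bij_betw[of f S S'] by (intro cong_mat) auto

lemma mat_trace_msum:
  assumes "\<And>x. x \<in> S \<Longrightarrow> F x \<in> carrier_mat e e"
  shows "mat_trace (msum e F S) = (\<Sum>x\<in>S. mat_trace (F x))"
proof -
  have "mat_trace (msum e F S) = (\<Sum>i<e. \<Sum>x\<in>S. F x $$ (i,i))"
    by (simp add: mat_trace_def msum_def)
  also have "\<dots> = (\<Sum>x\<in>S. \<Sum>i<e. F x $$ (i,i))" by (rule sum.swap)
  also have "\<dots> = (\<Sum>x\<in>S. mat_trace (F x))"
    by (rule sum.cong[OF refl], drule assms) (simp add: mat_trace_def carrier_matD(1))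
  finally show ?thesis .
qed

definition unit_mat :: "nat \<Rightarrow> nat \<Rightarrow> nat \<Rightarrow> complex mat" where
  "unit_mat e i j = mat e e (\<lambda>(a,b). if a = i \<and> b = j then 1 else 0)"

lemma unit_mat_carrier [simp]: "unit_mat e i j \<in> carrier_mat e e"
  by (simp add: unit_mat_def)

lemma mult_unit_mat_mult:
  assumes A: "A \<in> carrier_mat e e" and B: "B \<in> carrier_mat e e" and ij: "i < e" "j < e" "a < e" "b < e"
  shows "(A * unit_mat e i j * B) $$ (a,b) = A $$ (a,i) * B $$ (j,b)"
proof -
  have 1: "(A * unit_mat e i j) $$ (a,k) = (if k = j then A $$ (a,i) else 0)" if "k < e" for k
  proof -
    have "(A * unit_mat e i j) $$ (a,k) = (\<Sum>l<e. A $$ (a,l) * (if l = i \<and> k = j then 1 else 0))"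
      using A ij that by (auto simp: unit_mat_def scalar_prod_def atLeast0LessThan)
    also have "\<dots> = (\<Sum>l<e. if l = i then (if k = j then A $$ (a,l) else 0) else 0)"
      by (rule sum.cong) auto
    also have "\<dots> = (if k = j then A $$ (a,i) else 0)" using ij by simp
    finally show ?thesis .
  qed
  have c: "A * unit_mat e i j \<in> carrier_mat e e" by (rule mult_carrier_mat[OF A unit_mat_carrier])
  have "(C * B) $$ (a,b) = (\<Sum>k<e. C $$ (a,k) * B $$ (k,b))" if "C \<in> carrier_mat e e" for C
    using that B ij by (auto simp: scalar_prod_def atLeast0LessThan)
  from this[OF c]
  have "(A * unit_mat e i j * B) $$ (a,b) = (\<Sum>k<e. (A * unit_mat e i j) $$ (a,k) * B $$ (k,b))" .
  also have "\<dots> = (\<Sum>k<e. if k = j then A $$ (a,i) * B $$ (k,b) else 0)"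
    using 1 by (intro sum.cong) auto
  also have "\<dots> = A $$ (a,i) * B $$ (j,b)" using ij by simp
  finally show ?thesis .
qed

lemma mat_trace_unit_mat_mult:
  assumes B: "B \<in> carrier_mat e e" and ij: "i < e" "j < e"
  shows "mat_trace (unit_mat e i j * B) = B $$ (j,i)"
proof -
  have "mat_trace (unit_mat e i j * B) = (\<Sum>a<e. (1\<^sub>m e * unit_mat e i j * B) $$ (a,a))"
    using B by (simp add: mat_trace_def unit_mat_def)
  also have "\<dots> = (\<Sum>a<e. if a = i then B $$ (j,a) else 0)"
    using mult_unit_mat_mult[OF one_carrier_mat B ij] ij by (intro sum.cong) auto
  also have "\<dots> = B $$ (j,i)" using ij by simp
  finally show ?thesis .
qed

lemma mat_trace_conj:
  fixes A B C :: "complex mat"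
  assumes "A \<in> carrier_mat e e" "B \<in> carrier_mat e e" "C \<in> carrier_mat e e" "C * A = 1\<^sub>m e"
  shows "mat_trace (A * B * C) = mat_trace B"
proof -
  have "mat_trace (A * B * C) = mat_trace (C * (A * B))"
    using assms by (intro mat_trace_mult_comm[of _ e e]) auto
  also have "C * (A * B) = C * A * B" using sq_assoc[OF assms(3,1,2)] by simp
  finally show ?thesis using assms by simp
qed

lemma odd_root_of_unity:
  fixes c :: complex
  assumes "c ^ 2 = 1" "c ^ N = 1" "odd N"
  shows "c = 1"
proof -
  obtain k where "N = 2 * k + 1" using assms(3) oddE by blast
  then have "c ^ N = (c ^ 2) ^ k * c" by (simp add: power_mult power_add)
  then show ?thesis using assms by simp
qed

section \<open>The Weil representation\<close>

text \<open>An alternating bicharacter, written multiplicatively. \<open>M\<close> may be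
  non-abelian; only its quotient by the radical \<open>R\<close> is abelian. The law
  \<open>alt\<close> is mere skew symmetry, and the odd exponent \<open>N\<close> strengthens it to
  \<open>form_self\<close>.\<close>

locale odd_form = group G for G (structure) +
  fixes M :: "'a set" and \<beta> :: "'a \<Rightarrow> 'a \<Rightarrow> complex" and N :: nat
  assumes M: "subgroup M G" and finM: "finite M"
    and form_add_left: "x \<in> M \<Longrightarrow> y \<in> M \<Longrightarrow> z \<in> M \<Longrightarrow> \<beta> (x \<otimes> y) z = \<beta> x z * \<beta> y z"
    and alt: "x \<in> M \<Longrightarrow> y \<in> M \<Longrightarrow> \<beta> x y * \<beta> y x = 1"
    and oddN: "odd N" and root: "x \<in> M \<Longrightarrow> y \<in> M \<Longrightarrow> \<beta> x y ^ N = 1"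
begin

definition R where "R = {x \<in> M. \<forall>y\<in>M. \<beta> x y = 1}"

lemma Mc: "x \<in> M \<Longrightarrow> x \<in> carrier G" using subgroup.mem_carrier[OF M] .
lemma M1: "\<one> \<in> M" using subgroup.one_closed[OF M] .
lemma Mm: "x \<in> M \<Longrightarrow> y \<in> M \<Longrightarrow> x \<otimes> y \<in> M" using subgroup.m_closed[OF M] .
lemma Mi: "x \<in> M \<Longrightarrow> inv x \<in> M" using subgroup.m_inv_closed[OF M] .

lemma form_nonzero: "x \<in> M \<Longrightarrow> y \<in> M \<Longrightarrow> \<beta> x y \<noteq> 0" using alt[of x y] by auto

lemma form_swap: "x \<in> M \<Longrightarrow> y \<in> M \<Longrightarrow> \<beta> x y = inverse (\<beta> y x)"
  using alt[of x y] form_nonzero[of y x] by (simp add: field_simps)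

lemma form_add_right: "x \<in> M \<Longrightarrow> y \<in> M \<Longrightarrow> z \<in> M \<Longrightarrow> \<beta> x (y \<otimes> z) = \<beta> x y * \<beta> x z"
  using form_swap[of x "y \<otimes> z"] form_swap[of x y] form_swap[of x z] form_add_left[of y z x] Mm[of y z] by simp

lemma form_self: "x \<in> M \<Longrightarrow> \<beta> x x = 1"
  using odd_root_of_unity[of "\<beta> x x" N] alt[of x x] root[of x x] oddN by (simp add: power2_eq_square)

lemma form_one_left: "y \<in> M \<Longrightarrow> \<beta> \<one> y = 1"
  using form_add_left[of \<one> \<one> y] form_nonzero[of \<one> y] M1 by simp

lemma form_inv_left: "x \<in> M \<Longrightarrow> y \<in> M \<Longrightarrow> \<beta> (inv x) y = inverse (\<beta> x y)"
proof -
  assume xy: "x \<in> M" "y \<in> M"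
  have "\<beta> (inv x) y * \<beta> x y = 1" using form_add_left[of "inv x" x y] xy Mi Mc form_one_left by simp
  then show ?thesis using form_nonzero[OF xy] by (simp add: field_simps)
qed

lemma form_inv_right: "x \<in> M \<Longrightarrow> y \<in> M \<Longrightarrow> \<beta> x (inv y) = inverse (\<beta> x y)"
  using form_swap[of x "inv y"] form_swap[of x y] form_inv_left[of y x] Mi by simp

lemma RM: "x \<in> R \<Longrightarrow> x \<in> M" by (simp add: R_def)
lemma R_left: "x \<in> R \<Longrightarrow> y \<in> M \<Longrightarrow> \<beta> x y = 1" by (simp add: R_def)
lemma R_right: "x \<in> R \<Longrightarrow> y \<in> M \<Longrightarrow> \<beta> y x = 1" using form_swap[of y x] RM R_left by simp
lemma R1: "\<one> \<in> R" using form_one_left M1 by (simp add: R_def)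
lemma R_inv: "x \<in> R \<Longrightarrow> inv x \<in> R" by (simp add: R_def form_inv_left Mi)
lemma finR: "finite R" using finM by (simp add: R_def)
lemma cardR: "0 < card R" using finR R1 by (auto simp: card_gt_0_iff)

text \<open>\<open>Q\<close> represents the Heisenberg group of the form: the cocycle is \<open>\<beta>\<close> itself, so the commutator
  form is \<open>\<beta>\<^sup>2\<close>, which has the same radical because the order of \<open>\<beta>\<close> is odd. Having the canonical
  cocycle is what makes every isometry of \<open>\<beta>\<close> permute the operators \<open>Q\<close>.\<close>
definition heis :: "nat \<Rightarrow> ('a \<Rightarrow> complex mat) \<Rightarrow> bool" where
  "heis d Q \<longleftrightarrow> (\<forall>x\<in>M. Q x \<in> carrier_mat d d) \<and> (\<forall>r\<in>R. Q r = 1\<^sub>m d) \<and>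
     (\<forall>x\<in>M. \<forall>y\<in>M. Q x * Q y = \<beta> x y \<cdot>\<^sub>m Q (x \<otimes> y))"

lemma heisD:
  assumes "heis d Q"
  shows "x \<in> M \<Longrightarrow> Q x \<in> carrier_mat d d" "r \<in> R \<Longrightarrow> Q r = 1\<^sub>m d"
    "x \<in> M \<Longrightarrow> y \<in> M \<Longrightarrow> Q x * Q y = \<beta> x y \<cdot>\<^sub>m Q (x \<otimes> y)"
  using assms unfolding heis_def by auto

text \<open>A twisted regular representation. The basis is indexed by the distinct characters
  \<open>f i\<close> among the \<open>\<beta> z\<close>; \<open>Q x\<close> multiplies a character
  by \<open>\<beta> x\<close> and scales by the inverse of its value at \<open>x\<close>, which
  produces the cocycle.\<close>

lemma heis_exists: "\<exists>d Q. 0 < d \<and> heis d Q"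
proof -
  define \<Phi> where "\<Phi> = (\<lambda>x. restrict (\<beta> x) M) ` M"
  have fin\<Phi>: "finite \<Phi>" using finM by (simp add: \<Phi>_def)
  define t where "t = card \<Phi>"
  obtain f where f: "bij_betw f {0..<t} \<Phi>" unfolding t_def using ex_bij_betw_nat_finite[OF fin\<Phi>] by blast
  have inj: "i = j" if "i < t" "j < t" "\<And>y. y \<in> M \<Longrightarrow> f i y = f j y" for i j
  proof -
    have "f i \<in> \<Phi>" "f j \<in> \<Phi>" using f that by (auto simp: bij_betw_def)
    then have "f i = f j" using that(3) unfolding \<Phi>_def by (auto simp: restrict_def fun_eq_iff)
    then show ?thesis using f that inj_onD[of f "{0..<t}" i j] by (simp add: bij_betw_def)
  qed
  have rep: "\<exists>z\<in>M. \<forall>y\<in>M. f i y = \<beta> z y" if "i < t" for i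
  proof -
    have "f i \<in> \<Phi>" using f that by (auto simp: bij_betw_def)
    then show ?thesis unfolding \<Phi>_def by auto
  qed
  have ex: "\<exists>i<t. \<forall>y\<in>M. f i y = \<beta> z y" if "z \<in> M" for z
  proof -
    have "restrict (\<beta> z) M \<in> f ` {0..<t}" using f that by (auto simp: bij_betw_def \<Phi>_def)
    then obtain i where "i < t" "f i = restrict (\<beta> z) M" by auto
    then show ?thesis by auto
  qed
  have step: "\<exists>j<t. (\<forall>u\<in>M. f j u = \<beta> y u * f k u) \<and>
      (\<forall>j'<t. (\<forall>u\<in>M. f j' u = \<beta> y u * f k u) \<longrightarrow> j' = j)" if k: "k < t" and y: "y \<in> M" for k y
  proof -
    obtain z where z: "z \<in> M" "\<forall>u\<in>M. f k u = \<beta> z u" using rep[OF k] by blast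
    obtain j where j: "j < t" "\<forall>u\<in>M. f j u = \<beta> (y \<otimes> z) u" using ex[of "y \<otimes> z"] y z Mm by auto
    have "f j u = \<beta> y u * f k u" if "u \<in> M" for u using that j z y form_add_left by simp
    moreover have "j' = j" if "j' < t" "\<forall>u\<in>M. f j' u = \<beta> y u * f k u" for j'
      using inj[OF that(1) j(1)] that(2) j z y form_add_left by simp
    ultimately show ?thesis using j(1) by blast
  qed
  define c where "c x i j \<longleftrightarrow> (\<forall>u\<in>M. f i u = \<beta> x u * f j u)" for x i j
  define Q where "Q x = mat t t (\<lambda>(i,j). if c x i j then inverse (f j x) else 0)" for x
  have "0 < t" unfolding t_def using fin\<Phi> M1 by (auto simp: card_gt_0_iff \<Phi>_def)
  moreover have "heis t Q"
    unfolding heis_def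
  proof (intro conjI ballI)
    fix x assume "x \<in> M" show "Q x \<in> carrier_mat t t" by (simp add: Q_def)
  next
    fix r assume r: "r \<in> R"
    show "Q r = 1\<^sub>m t"
    proof (rule mat_eqI[of _ t t])
      fix i j assume ij: "i < t" "j < t"
      have "c r i j \<longleftrightarrow> (\<forall>u\<in>M. f i u = f j u)" unfolding c_def using R_left[OF r] by simp
      then have "c r i j \<longleftrightarrow> i = j" using inj[OF ij] by blast
      moreover have "f j r = 1" using rep[OF ij(2)] R_right[OF r] RM[OF r] by auto
      ultimately show "Q r $$ (i,j) = 1\<^sub>m t $$ (i,j)" using ij by (simp add: Q_def)
    qed (auto simp: Q_def)
  next
    fix x y assume xy: "x \<in> M" "y \<in> M"
    show "Q x * Q y = \<beta> x y \<cdot>\<^sub>m Q (x \<otimes> y)"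
    proof (rule mat_eqI[of _ t t])
      fix i k assume ik: "i < t" "k < t"
      obtain j where j: "j < t" "c y j k" "\<forall>j'<t. c y j' k \<longrightarrow> j' = j"
        using step[OF ik(2) xy(2)] unfolding c_def by blast
      obtain z where z: "z \<in> M" "\<forall>u\<in>M. f k u = \<beta> z u" using rep[OF ik(2)] by blast
      have fj: "f j u = \<beta> y u * f k u" if "u \<in> M" for u using j(2) that unfolding c_def by blast
      have cc: "c x i j \<longleftrightarrow> c (x \<otimes> y) i k"
        unfolding c_def using fj form_add_left xy by (simp add: mult.assoc)
      have "(Q x * Q y) $$ (i,k) = (\<Sum>l<t. Q x $$ (i,l) * Q y $$ (l,k))"
        using ik by (auto simp: Q_def scalar_prod_def atLeast0LessThan)
      also have "\<dots> = (\<Sum>l\<in>{j}. Q x $$ (i,l) * Q y $$ (l,k))"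
      proof (rule sum.mono_neutral_right)
        show "\<forall>l\<in>{..<t} - {j}. Q x $$ (i,l) * Q y $$ (l,k) = 0"
        proof
          fix l assume l: "l \<in> {..<t} - {j}"
          then have "\<not> c y l k" using j(3) by blast
          then show "Q x $$ (i,l) * Q y $$ (l,k) = 0" using l ik by (simp add: Q_def)
        qed
      qed (use j(1) in auto)
      also have "\<dots> = (if c x i j then inverse (f j x) * inverse (f k y) else 0)"
        using ik j(1,2) by (simp add: Q_def)
      also have "\<dots> = (if c (x \<otimes> y) i k then \<beta> x y * inverse (f k (x \<otimes> y)) else 0)"
        unfolding cc using fj[OF xy(1)] z xy Mm[OF xy] form_add_right[OF z(1) xy] form_swap[OF xy(2,1)]
        by (simp add: field_simps)
      also have "\<dots> = (\<beta> x y \<cdot>\<^sub>m Q (x \<otimes> y)) $$ (i,k)" using ik by (simp add: Q_def)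
      finally show "(Q x * Q y) $$ (i,k) = (\<beta> x y \<cdot>\<^sub>m Q (x \<otimes> y)) $$ (i,k)" .
    qed (auto simp: Q_def)
  qed
  ultimately show ?thesis by blast
qed

section \<open>Traces and averages for Heisenberg representations\<close>

lemma heis_one: "heis d Q \<Longrightarrow> Q \<one> = 1\<^sub>m d"
  using heisD(2) R1 by blast

lemma heis_inv:
  assumes "heis d Q" "x \<in> M"
  shows "Q x * Q (inv x) = 1\<^sub>m d" "Q (inv x) * Q x = 1\<^sub>m d"
  using heisD(3)[OF assms(1), of x "inv x"] heisD(3)[OF assms(1), of "inv x" x] assms(2) Mi Mc
    form_inv_left[of x x] form_inv_right[of x x] form_self[of x] heis_one[OF assms(1)]
  by (auto intro!: eq_matI)

lemma heis_R:
  assumes Q: "heis d Q" and "x \<in> M" "r \<in> R"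
  shows "Q (x \<otimes> r) = Q x"
proof -
  have "Q x * Q r = Q (x \<otimes> r)"
    using heisD(3)[OF Q, of x r] R_right[of r x] RM assms by (auto intro!: eq_matI)
  then show ?thesis using heisD(1)[OF Q, of x] heisD(2)[OF Q, of r] assms by simp
qed

text \<open>The form has values in a commutative group, so it is trivial on the quotient of
  \<open>x \<otimes> y\<close> and \<open>y \<otimes> x\<close>, which therefore lies in
  \<open>R\<close>.\<close>

lemma heis_commute:
  assumes Q: "heis d Q" and xy: "x \<in> M" "y \<in> M"
  shows "Q (y \<otimes> x) = Q (x \<otimes> y)"
proof -
  let ?r = "inv (x \<otimes> y) \<otimes> (y \<otimes> x)"
  have m: "x \<otimes> y \<in> M" "y \<otimes> x \<in> M" using xy Mm by auto
  have "\<beta> ?r u = 1" if "u \<in> M" for u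
    using form_add_left[of "inv (x \<otimes> y)" "y \<otimes> x" u] form_inv_left[of "x \<otimes> y" u] form_add_left[of x y u] form_add_left[of y x u]
      that m xy Mi form_nonzero by (simp add: field_simps)
  then have "?r \<in> R" unfolding R_def using m Mm Mi by simp
  then have "Q (x \<otimes> y \<otimes> ?r) = Q (x \<otimes> y)" using heis_R[OF Q m(1)] by blast
  moreover have "x \<otimes> y \<otimes> ?r = y \<otimes> x"
    using m Mc by (simp add: m_assoc[symmetric] r_inv)
  ultimately show ?thesis by simp
qed

text \<open>Conjugation by \<open>Q y\<close> multiplies \<open>Q x\<close> by the square of
  \<open>\<beta> y x\<close>. For a \<open>y\<close> with \<open>\<beta> x y \<noteq> 1\<close> this
  square differs from 1, because the values have odd order.\<close>

lemma heis_trace: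
  assumes Q: "heis d Q" and x: "x \<in> M" "x \<notin> R"
  shows "mat_trace (Q x) = 0"
proof -
  obtain y where y: "y \<in> M" "\<beta> x y \<noteq> 1" using x unfolding R_def by auto
  note c = heisD(1)[OF Q x(1)] heisD(1)[OF Q y(1)] heisD(1)[OF Q Mi[OF y(1)]]
  have 1: "Q y * Q x = (\<beta> y x ^ 2) \<cdot>\<^sub>m (Q x * Q y)"
    using heisD(3)[OF Q y(1) x(1)] heisD(3)[OF Q x(1) y(1)] heis_commute[OF Q x(1) y(1)]
      alt[OF x(1) y(1)] heisD(1)[OF Q Mm[OF x(1) y(1)]]
    by (auto intro!: eq_matI simp: power2_eq_square mult.assoc mult.left_commute)
  have "mat_trace (Q x) = mat_trace (Q y * Q x * Q (inv y))"
    using mat_trace_conj[OF c(2,1,3)] heis_inv[OF Q y(1)] by simp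
  also have "Q y * Q x * Q (inv y) = (\<beta> y x ^ 2) \<cdot>\<^sub>m (Q x * Q y * Q (inv y))"
    unfolding 1 using c by (simp add: sq_smult[of _ d] del: assoc_mult_mat)
  also have "Q x * Q y * Q (inv y) = Q x"
    using sq_assoc[OF c] heis_inv[OF Q y(1)] c by simp
  also have "mat_trace (\<beta> y x ^ 2 \<cdot>\<^sub>m Q x) = \<beta> y x ^ 2 * mat_trace (Q x)"
    by (rule mat_trace_smult[OF c(1)])
  finally have "(\<beta> y x ^ 2 - 1) * mat_trace (Q x) = 0" by (simp add: algebra_simps)
  moreover have "\<beta> y x ^ 2 \<noteq> 1"
    using odd_root_of_unity[of "\<beta> y x" N] root[OF y(1) x(1)] oddN y form_swap[OF x(1) y(1)] by auto
  ultimately show ?thesis by simp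
qed

lemma heis_trace_R: "heis d Q \<Longrightarrow> x \<in> R \<Longrightarrow> mat_trace (Q x) = of_nat d"
  using heisD(2) mat_trace_one by metis

lemma translate_bij: "y \<in> M \<Longrightarrow> bij_betw (\<lambda>x. y \<otimes> x) M M"
  by (rule bij_betw_byWitness[of _ "\<lambda>x. inv y \<otimes> x"])
    (use Mm Mi Mc in \<open>auto simp: m_assoc[symmetric]\<close>)

lemma form_sum:
  assumes u: "u \<in> M"
  shows "(\<Sum>x\<in>M. \<beta> x u) = (if u \<in> R then of_nat (card M) else 0)"
proof (cases "u \<in> R")
  case True
  then show ?thesis using R_right by simp
next
  case False
  then obtain y where y: "y \<in> M" "\<beta> u y \<noteq> 1" using u unfolding R_def by auto
  have "(\<Sum>x\<in>M. \<beta> x u) = (\<Sum>x\<in>M. \<beta> (y \<otimes> x) u)"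
    by (rule sum.reindex_bij_betw[OF translate_bij[OF y(1)], symmetric])
  also have "\<dots> = \<beta> y u * (\<Sum>x\<in>M. \<beta> x u)"
    unfolding sum_distrib_left using form_add_left y u by (intro sum.cong) auto
  finally have "(\<beta> y u - 1) * (\<Sum>x\<in>M. \<beta> x u) = 0" by (simp add: algebra_simps)
  moreover have "\<beta> y u \<noteq> 1" using form_swap[OF u y(1)] y(2) by auto
  ultimately show ?thesis using False by simp
qed

text \<open>The averaging of Schur's lemma for a projective representation. It works because the two
  cocycle factors agree: \<open>Y y * Y x\<close> and \<open>Q (inv (y \<otimes> x)) * Q y\<close>
  both contribute \<open>\<beta> y x\<close>.\<close>

lemma average_intertwines:
  assumes Q: "heis d Q" and Y: "heis d Y" and A: "A \<in> carrier_mat d d" and y: "y \<in> M"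
  shows "Y y * msum d (\<lambda>x. Y x * A * Q (inv x)) M = msum d (\<lambda>x. Y x * A * Q (inv x)) M * Q y"
proof -
  note c = heisD(1)[OF Q] heisD(1)[OF Y]
  let ?F = "\<lambda>x. Y x * A * Q (inv x)"
  have Fc: "?F x \<in> carrier_mat d d" if "x \<in> M" for x
    using c[OF that] c[OF Mi[OF that]] A by simp
  have trm: "Y y * ?F x = ?F (y \<otimes> x) * Q y" if x: "x \<in> M" for x
  proof -
    note xx = c[OF x] c[OF Mi[OF x]] c[OF y] c[OF Mm[OF y x]] c[OF Mi[OF Mm[OF y x]]]
    have e: "inv (y \<otimes> x) \<otimes> y = inv x"
      using x y Mc by (simp add: inv_mult_group m_assoc)
    have b: "\<beta> (inv (y \<otimes> x)) y = \<beta> y x"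
      using form_inv_left[OF Mm[OF y x] y] form_add_left[OF y x y] form_self[OF y] form_swap[OF y x] by simp
    have "Y y * ?F x = Y y * Y x * A * Q (inv x)"
      using xx A by (simp add: sq_assoc[of _ d] del: assoc_mult_mat)
    also have "\<dots> = \<beta> y x \<cdot>\<^sub>m (Y (y \<otimes> x) * A * Q (inv x))"
      unfolding heisD(3)[OF Y y x] using xx A by (simp add: sq_smult[of _ d] del: assoc_mult_mat)
    also have "\<dots> = Y (y \<otimes> x) * A * (Q (inv (y \<otimes> x)) * Q y)"
      unfolding heisD(3)[OF Q Mi[OF Mm[OF y x]] y] e b
      using xx A by (simp add: sq_smult[of _ d] del: assoc_mult_mat)
    also have "\<dots> = ?F (y \<otimes> x) * Q y"
      using xx A by (simp add: sq_assoc[of _ d] del: assoc_mult_mat)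
    finally show ?thesis .
  qed
  have "Y y * msum d ?F M = msum d (\<lambda>x. Y y * ?F x) M"
    by (rule mult_msum[OF c(2)[OF y] Fc])
  also have "\<dots> = msum d (\<lambda>x. ?F (y \<otimes> x) * Q y) M"
    by (rule msum_cong[OF trm])
  also have "\<dots> = msum d (\<lambda>x. ?F x * Q y) M"
    using msum_reindex[OF translate_bij[OF y], of d "\<lambda>x. ?F x * Q y"] by simp
  also have "\<dots> = msum d ?F M * Q y"
    by (rule msum_mult[OF c(1)[OF y] Fc, symmetric])
  finally show ?thesis .
qed

end

text \<open>Minimality of the degree takes the place of irreducibility. It gives Schur's lemma for
  every Heisenberg representation of degree \<open>e\<close> and not just for \<open>Q\<close>,
  which matters for the conjugates of \<open>Q\<close>.\<close>

locale odd_form_irreducible = odd_form +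
  fixes e :: nat and Q :: "'a \<Rightarrow> complex mat"
  assumes heisQ: "heis e Q" and e0: "0 < e"
    and minimal: "heis d Y \<Longrightarrow> 0 < d \<Longrightarrow> e \<le> d"
begin

lemmas Qc = heisD(1)[OF heisQ]

text \<open>For a non-scalar \<open>B\<close>, the block of \<open>Y\<close> on an eigenspace of
  \<open>B\<close> would be a Heisenberg representation of degree below \<open>e\<close>.\<close>

lemma heis_schur:
  assumes Y: "heis e Y" and B: "B \<in> carrier_mat e e" and com: "\<And>x. x \<in> M \<Longrightarrow> Y x * B = B * Y x"
  shows "\<exists>c. B = c \<cdot>\<^sub>m 1\<^sub>m e"
proof (rule ccontr)
  assume "\<not> ?thesis"
  then have ns: "\<And>c. B \<noteq> c \<cdot>\<^sub>m 1\<^sub>m e" by blast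
  obtain W where W: "VectorSpace.subspace class_ring W (module_vec TYPE(complex) e)"
    "W \<noteq> {0\<^sub>v e}" "W \<noteq> carrier_vec e"
    "\<forall>A\<in>carrier_mat e e. A * B = B * A \<longrightarrow> (\<forall>w\<in>W. A *\<^sub>v w \<in> W)"
    by (rule nonscalar_commutant_subspace[OF B e0 ns])
  have inv: "\<forall>w\<in>W. Y x *\<^sub>v w \<in> W" if "x \<in> M" for x
    using W(4) heisD(1)[OF Y that] com[OF that] by blast
  obtain r and f h :: "complex mat \<Rightarrow> complex mat" where r: "0 < r" "r < e"
    and fc: "\<And>A. A \<in> carrier_mat e e \<Longrightarrow> f A \<in> carrier_mat r r"
    and one: "f (1\<^sub>m e) = 1\<^sub>m r"
    and fm: "\<And>A B. A \<in> carrier_mat e e \<Longrightarrow> B \<in> carrier_mat e e \<Longrightarrow> \<forall>w\<in>W. B *\<^sub>v w \<in> W \<Longrightarrow>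
       f (A * B) = f A * f B"
    and fs: "\<And>A c. A \<in> carrier_mat e e \<Longrightarrow> f (c \<cdot>\<^sub>m A) = c \<cdot>\<^sub>m f A"
    by (rule diagonal_blocks[OF W(1-3)]) blast
  have "heis r (\<lambda>x. f (Y x))"
    unfolding heis_def
  proof (intro conjI ballI)
    fix x y assume xy: "x \<in> M" "y \<in> M"
    have "f (Y x) * f (Y y) = f (Y x * Y y)"
      using fm[OF heisD(1)[OF Y xy(1)] heisD(1)[OF Y xy(2)] inv[OF xy(2)]] by simp
    then show "f (Y x) * f (Y y) = \<beta> x y \<cdot>\<^sub>m f (Y (x \<otimes> y))"
      using heisD(3)[OF Y xy] fs[OF heisD(1)[OF Y Mm[OF xy]]] by simp
  qed (use fc one heisD(1,2)[OF Y] in auto)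
  then show False using minimal r by force
qed

text \<open>Schur orthogonality. Each average \<open>?S i j\<close> is scalar, with a constant found
  from its trace; the sum of the entries \<open>?S i j $$ (i,j)\<close> is then computed in two
  ways.\<close>

lemma degree_square: "e * e * card R = card M"
proof -
  let ?S = "\<lambda>i j. msum e (\<lambda>x. Q x * unit_mat e i j * Q (inv x)) M"
  have Fc: "Q x * unit_mat e i j * Q (inv x) \<in> carrier_mat e e" if "x \<in> M" for x i j
    by (rule mult_carrier_mat[OF mult_carrier_mat[OF Qc[OF that] unit_mat_carrier] Qc[OF Mi[OF that]]])
  have diag: "of_nat e * ?S i j $$ (i,j) = (if i = j then of_nat (card M) else 0)" if ij: "i < e" "j < e" for i j
  proof -
    obtain c where c: "?S i j = c \<cdot>\<^sub>m 1\<^sub>m e"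
      using heis_schur[OF heisQ msum_carrier average_intertwines[OF heisQ heisQ unit_mat_carrier]] by blast
    have "of_nat e * c = mat_trace (?S i j)"
      unfolding c by (simp add: mat_trace_smult[of _ e] mat_trace_one)
    also have "\<dots> = (\<Sum>x\<in>M. mat_trace (Q x * unit_mat e i j * Q (inv x)))"
      by (rule mat_trace_msum[OF Fc])
    also have "\<dots> = (\<Sum>x\<in>M. mat_trace (unit_mat e i j))"
      by (rule sum.cong[OF refl], rule mat_trace_conj) (use Qc Mi heis_inv[OF heisQ] in auto)
    also have "mat_trace (unit_mat e i j) = (if i = j then 1 else 0)"
      using mat_trace_unit_mat_mult[OF one_carrier_mat ij] ij
      by (simp add: right_mult_one_mat[OF unit_mat_carrier] eq_commute)
    finally show ?thesis unfolding c using ij by auto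
  qed
  have "of_nat e * (\<Sum>i<e. \<Sum>j<e. ?S i j $$ (i,j)) = (\<Sum>i<e. \<Sum>j<e. if i = j then of_nat (card M) else (0 :: complex))"
    unfolding sum_distrib_left using diag by (intro sum.cong) auto
  also have "\<dots> = of_nat e * of_nat (card M)" by simp
  finally have "(\<Sum>i<e. \<Sum>j<e. ?S i j $$ (i,j)) = of_nat (card M)" using e0 by simp
  \<comment> \<open>Summed the other way, the entries combine to products of traces of
    \<open>Q x\<close> and \<open>Q (inv x)\<close>, of which only those with
    \<open>x \<in> R\<close> survive.\<close>
  moreover have "(\<Sum>i<e. \<Sum>j<e. ?S i j $$ (i,j)) = of_nat (card R) * (of_nat e * of_nat e)"
  proof -
    have "(\<Sum>i<e. \<Sum>j<e. ?S i j $$ (i,j)) = (\<Sum>i<e. \<Sum>j<e. \<Sum>x\<in>M. Q x $$ (i,i) * Q (inv x) $$ (j,j))"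
    proof (intro sum.cong refl)
      fix i j assume "i \<in> {..<e}" "j \<in> {..<e}"
      then have ij: "i < e" "j < e" by auto
      then have "?S i j $$ (i,j) = (\<Sum>x\<in>M. (Q x * unit_mat e i j * Q (inv x)) $$ (i,j))"
        by (simp add: msum_def)
      also have "\<dots> = (\<Sum>x\<in>M. Q x $$ (i,i) * Q (inv x) $$ (j,j))"
        using mult_unit_mat_mult[OF Qc Qc[OF Mi] ij ij] by (intro sum.cong) auto
      finally show "?S i j $$ (i,j) = (\<Sum>x\<in>M. Q x $$ (i,i) * Q (inv x) $$ (j,j))" .
    qed
    also have "\<dots> = (\<Sum>i<e. \<Sum>x\<in>M. \<Sum>j<e. Q x $$ (i,i) * Q (inv x) $$ (j,j))"
      by (intro sum.cong refl sum.swap)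
    also have "\<dots> = (\<Sum>x\<in>M. \<Sum>i<e. \<Sum>j<e. Q x $$ (i,i) * Q (inv x) $$ (j,j))" by (rule sum.swap)
    also have "\<dots> = (\<Sum>x\<in>M. mat_trace (Q x) * mat_trace (Q (inv x)))"
      by (intro sum.cong refl) (simp add: mat_trace_def sum_product carrier_matD(1)[OF Qc] Mi)
    also have "\<dots> = (\<Sum>x\<in>R. mat_trace (Q x) * mat_trace (Q (inv x)))"
      by (rule sum.mono_neutral_right) (use finM RM heis_trace[OF heisQ] in auto)
    also have "\<dots> = (\<Sum>x\<in>R. of_nat e * of_nat e)"
    proof (rule sum.cong[OF refl])
      fix x assume x: "x \<in> R"
      then have "inv x \<in> R" by (rule R_inv)
      then show "mat_trace (Q x) * mat_trace (Q (inv x)) = of_nat e * of_nat e"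
        using heis_trace_R[OF heisQ] x by simp
    qed
    finally show ?thesis by simp
  qed
  ultimately have "(of_nat (e * e * card R) :: complex) = of_nat (card M)" by (simp add: mult.commute)
  then show ?thesis by (simp only: of_nat_eq_iff)
qed

text \<open>Uniqueness in the style of Stone and von Neumann: some averaged unit matrix is a
  non-zero intertwiner, and Schur's lemma makes it invertible.\<close>

lemma intertwiner:
  assumes Y: "heis e Y"
  obtains w w' where "w \<in> carrier_mat e e" "w' \<in> carrier_mat e e" "w * w' = 1\<^sub>m e" "w' * w = 1\<^sub>m e"
    "\<And>y. y \<in> M \<Longrightarrow> w * Q y = Y y * w"
proof -
  note Yc = heisD(1)[OF Y]
  let ?S = "\<lambda>i. msum e (\<lambda>x. Y x * unit_mat e i 0 * Q (inv x)) M"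
  \<comment> \<open>The sum isolates the traces of \<open>Y x\<close>, which vanish outside
    \<open>R\<close>; it equals \<open>card R * e\<close>, so some average is non-zero.\<close>
  have "(\<Sum>i<e. ?S i $$ (i,0)) \<noteq> 0"
  proof -
    have "(\<Sum>i<e. ?S i $$ (i,0)) = (\<Sum>i<e. \<Sum>x\<in>M. Y x $$ (i,i) * Q (inv x) $$ (0,0))"
    proof (intro sum.cong refl)
      fix i assume "i \<in> {..<e}"
      then have i: "i < e" by auto
      then have "?S i $$ (i,0) = (\<Sum>x\<in>M. (Y x * unit_mat e i 0 * Q (inv x)) $$ (i,0))"
        using e0 by (simp add: msum_def)
      also have "\<dots> = (\<Sum>x\<in>M. Y x $$ (i,i) * Q (inv x) $$ (0,0))"
        using mult_unit_mat_mult[OF Yc Qc[OF Mi] i e0 i e0] by (intro sum.cong) auto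
      finally show "?S i $$ (i,0) = (\<Sum>x\<in>M. Y x $$ (i,i) * Q (inv x) $$ (0,0))" .
    qed
    also have "\<dots> = (\<Sum>x\<in>M. \<Sum>i<e. Y x $$ (i,i) * Q (inv x) $$ (0,0))" by (rule sum.swap)
    also have "\<dots> = (\<Sum>x\<in>M. mat_trace (Y x) * Q (inv x) $$ (0,0))"
      using Yc by (intro sum.cong) (auto simp: mat_trace_def sum_distrib_right carrier_matD(1))
    also have "\<dots> = (\<Sum>x\<in>R. mat_trace (Y x) * Q (inv x) $$ (0,0))"
      by (rule sum.mono_neutral_right) (use finM RM heis_trace[OF Y] in auto)
    also have "\<dots> = (\<Sum>x\<in>R. of_nat e)"
    proof (rule sum.cong[OF refl])
      fix x assume x: "x \<in> R"
      then have "inv x \<in> R" by (rule R_inv)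
      then show "mat_trace (Y x) * Q (inv x) $$ (0,0) = of_nat e"
        using heis_trace_R[OF Y x] heisD(2)[OF heisQ] e0 by simp
    qed
    finally show ?thesis using cardR e0 by simp
  qed
  then obtain i where i: "i < e" "?S i $$ (i,0) \<noteq> 0" by (meson lessThan_iff sum.not_neutral_contains_not_neutral)
  define w where "w = ?S i"
  have wc: "w \<in> carrier_mat e e" unfolding w_def by simp
  have w: "Y y * w = w * Q y" if "y \<in> M" for y
    unfolding w_def by (rule average_intertwines[OF heisQ Y unit_mat_carrier that])
  \<comment> \<open>The transposed position: the scalar \<open>v * w\<close> has trace
    \<open>card M\<close> times the trace of \<open>?B * w\<close>, which is the entry of
    \<open>w\<close> known to be non-zero.\<close>
  let ?B = "unit_mat e 0 i"
  define v where "v = msum e (\<lambda>x. Q x * ?B * Y (inv x)) M"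
  have vc: "v \<in> carrier_mat e e" unfolding v_def by simp
  have v: "Q y * v = v * Y y" if "y \<in> M" for y
    unfolding v_def by (rule average_intertwines[OF Y heisQ unit_mat_carrier that])
  have Fc: "Q x * ?B * Y (inv x) \<in> carrier_mat e e" if "x \<in> M" for x
    by (rule mult_carrier_mat[OF mult_carrier_mat[OF Qc[OF that] unit_mat_carrier] Yc[OF Mi[OF that]]])
  have "Q y * (v * w) = v * w * Q y" if y: "y \<in> M" for y
  proof -
    have "Q y * (v * w) = Q y * v * w" using sq_assoc[OF Qc[OF y] vc wc] by simp
    also have "\<dots> = v * (Y y * w)" unfolding v[OF y] by (rule sq_assoc[OF vc Yc[OF y] wc])
    also have "\<dots> = v * w * Q y" unfolding w[OF y] by (rule sq_assoc[OF vc wc Qc[OF y], symmetric])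
    finally show ?thesis .
  qed
  then obtain c where c: "v * w = c \<cdot>\<^sub>m 1\<^sub>m e"
    using heis_schur[OF heisQ mult_carrier_mat[OF vc wc]] by blast
  have "of_nat e * c = mat_trace (v * w)"
    unfolding c by (simp add: mat_trace_smult[of _ e] mat_trace_one)
  also have "v * w = msum e (\<lambda>x. Q x * ?B * Y (inv x) * w) M"
    unfolding v_def by (rule msum_mult[OF wc Fc])
  also have "mat_trace \<dots> = (\<Sum>x\<in>M. mat_trace (Q x * ?B * Y (inv x) * w))"
    by (rule mat_trace_msum[OF mult_carrier_mat[OF Fc wc]])
  also have "\<dots> = (\<Sum>x\<in>M. mat_trace (?B * w))"
  proof (rule sum.cong[OF refl])
    fix x assume x: "x \<in> M"
    note cc = Qc[OF x] Qc[OF Mi[OF x]] Yc[OF Mi[OF x]] wc unit_mat_carrier[of e 0 i]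
    have "Q x * ?B * Y (inv x) * w = Q x * ?B * (Y (inv x) * w)"
      using cc by (simp add: sq_assoc[of _ e] sq_closed[of _ e] del: assoc_mult_mat)
    also have "\<dots> = Q x * (?B * w) * Q (inv x)"
      unfolding w[OF Mi[OF x]] using cc by (simp add: sq_assoc[of _ e] sq_closed[of _ e] del: assoc_mult_mat)
    finally show "mat_trace (Q x * ?B * Y (inv x) * w) = mat_trace (?B * w)"
      using mat_trace_conj[OF cc(1) mult_carrier_mat[OF cc(5) wc] cc(2)] heis_inv[OF heisQ x] by simp
  qed
  also have "mat_trace (?B * w) = w $$ (i,0)" by (rule mat_trace_unit_mat_mult[OF wc e0 i(1)])
  finally have "c \<noteq> 0" using i(2) finM M1 unfolding w_def[symmetric] by (auto simp: card_eq_0_iff)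
  define w' where "w' = inverse c \<cdot>\<^sub>m v"
  have w'c: "w' \<in> carrier_mat e e" unfolding w'_def using vc by simp
  have w'w: "w' * w = 1\<^sub>m e"
    unfolding w'_def sq_smult(1)[OF vc wc] c using \<open>c \<noteq> 0\<close> by (intro eq_matI) auto
  show ?thesis
    by (rule that[OF wc w'c mat_mult_left_right_inverse[OF w'c wc w'w] w'w w[symmetric]])
qed

text \<open>The parity operator: it sends \<open>Q x\<close> to \<open>Q (inv x)\<close>, and its eigenspaces have dimensions
  \<open>(e + 1) / 2\<close> and \<open>(e - 1) / 2\<close>.\<close>
definition J where "J = inverse (of_nat (card R * e)) \<cdot>\<^sub>m msum e Q M"

lemma Jc: "J \<in> carrier_mat e e" by (simp add: J_def)

lemma J_trace: "mat_trace J = 1"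
proof -
  have "mat_trace (msum e Q M) = (\<Sum>x\<in>M. mat_trace (Q x))" by (rule mat_trace_msum[OF Qc])
  also have "\<dots> = (\<Sum>x\<in>R. mat_trace (Q x))"
    by (rule sum.mono_neutral_right) (use finM RM heis_trace[OF heisQ] in auto)
  also have "\<dots> = of_nat (card R * e)" using heis_trace_R[OF heisQ] by simp
  finally show ?thesis unfolding J_def using cardR e0 by (simp add: mat_trace_smult[of _ e] field_simps)
qed

lemma J_square: "J * J = 1\<^sub>m e"
proof -
  let ?m = "msum e Q M"
  have trm: "Q x * ?m = msum e (\<lambda>u. \<beta> x u \<cdot>\<^sub>m Q u) M" if x: "x \<in> M" for x
  proof -
    have "Q x * ?m = msum e (\<lambda>y. Q x * Q y) M" by (rule mult_msum[OF Qc[OF x] Qc])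
    \<comment> \<open>As \<open>\<beta> x x = 1\<close>, the cocycle depends on the product
      \<open>x \<otimes> y\<close> alone. After reindexing, the sum over \<open>x\<close> becomes a
      character sum, which selects \<open>R\<close>.\<close>
    also have "\<dots> = msum e (\<lambda>y. \<beta> x (x \<otimes> y) \<cdot>\<^sub>m Q (x \<otimes> y)) M"
      using heisD(3)[OF heisQ x] form_add_right[OF x x] form_self[OF x] by (intro msum_cong) auto
    also have "\<dots> = msum e (\<lambda>u. \<beta> x u \<cdot>\<^sub>m Q u) M"
      using msum_reindex[OF translate_bij[OF x], of e "\<lambda>u. \<beta> x u \<cdot>\<^sub>m Q u"] by simp
    finally show ?thesis .
  qed
  have "?m * ?m = msum e (\<lambda>x. Q x * ?m) M" by (rule msum_mult[OF msum_carrier Qc])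
  also have "\<dots> = msum e (\<lambda>x. msum e (\<lambda>u. \<beta> x u \<cdot>\<^sub>m Q u) M) M" by (rule msum_cong[OF trm])
  also have "\<dots> = of_nat (card M * card R) \<cdot>\<^sub>m 1\<^sub>m e"
  proof (rule mat_eqI[of _ e e])
    fix a b assume ab: "a < e" "b < e"
    have "msum e (\<lambda>x. msum e (\<lambda>u. \<beta> x u \<cdot>\<^sub>m Q u) M) M $$ (a,b)
        = (\<Sum>x\<in>M. \<Sum>u\<in>M. (\<beta> x u \<cdot>\<^sub>m Q u) $$ (a,b))"
      using ab by (simp add: msum_def)
    also have "\<dots> = (\<Sum>x\<in>M. \<Sum>u\<in>M. \<beta> x u * Q u $$ (a,b))"
      using ab carrier_matD[OF Qc] by (intro sum.cong refl) simp
    also have "\<dots> = (\<Sum>u\<in>M. \<Sum>x\<in>M. \<beta> x u * Q u $$ (a,b))" by (rule sum.swap)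
    also have "\<dots> = (\<Sum>u\<in>M. if u \<in> R then of_nat (card M) * Q u $$ (a,b) else 0)"
      unfolding sum_distrib_right[symmetric] using form_sum by (intro sum.cong) auto
    also have "\<dots> = (\<Sum>u\<in>R. of_nat (card M) * Q u $$ (a,b))"
      using finM RM by (intro sum.mono_neutral_cong_right) auto
    also have "\<dots> = (of_nat (card M * card R) \<cdot>\<^sub>m 1\<^sub>m e) $$ (a,b)"
      using heisD(2)[OF heisQ] ab by simp
    finally show "msum e (\<lambda>x. msum e (\<lambda>u. \<beta> x u \<cdot>\<^sub>m Q u) M) M $$ (a,b)
      = (of_nat (card M * card R) \<cdot>\<^sub>m 1\<^sub>m e) $$ (a,b)" .
  qed (auto simp: msum_def)
  finally have mm: "?m * ?m = of_nat (card M * card R) \<cdot>\<^sub>m 1\<^sub>m e" .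
  let ?k = "inverse (of_nat (card R * e)) :: complex"
  have "J * J = (?k * ?k) \<cdot>\<^sub>m (?m * ?m)"
    unfolding J_def by (intro eq_matI) (auto simp: sq_smult[of _ e] mult.assoc)
  also have "\<dots> = (?k * ?k * of_nat (card M * card R)) \<cdot>\<^sub>m 1\<^sub>m e" unfolding mm by (intro eq_matI) auto
  \<comment> \<open>By \<open>degree_square\<close>, \<open>card M * card R\<close> is the square of
    \<open>card R * e\<close>; this explains the normalization of \<open>J\<close>.\<close>
  also have "?k * ?k * of_nat (card M * card R) = 1"
    unfolding degree_square[symmetric] using cardR e0 by (simp add: field_simps)
  finally show ?thesis by (auto intro: eq_matI)
qed

text \<open>A scalar \<open>c\<close> with trace 1 and square 1 satisfies \<open>e c = 1\<close> and
  \<open>c\<^sup>2 = 1\<close>, hence \<open>e = 1\<close>.\<close>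

lemma J_nonscalar: "1 < e \<Longrightarrow> J \<noteq> c \<cdot>\<^sub>m 1\<^sub>m e"
proof
  assume e: "1 < e" and c: "J = c \<cdot>\<^sub>m 1\<^sub>m e"
  have 1: "of_nat e * c = 1" using J_trace unfolding c by (simp add: mat_trace_smult[of _ e] mat_trace_one mult.commute)
  have "(J * J) $$ (0,0) = c * c" unfolding c using e by (simp add: sq_smult[of _ e])
  then have 2: "c * c = 1" unfolding J_square using e by simp
  have "(of_nat (e * e) :: complex) = (of_nat e * c) * (of_nat e * c)" using 2 by (simp add: algebra_simps)
  then have "(of_nat (e * e) :: complex) = of_nat 1" using 1 by simp
  then have "e * e = 1" by (simp only: of_nat_eq_iff)
  then show False using e by simp
qed

end

text \<open>When \<open>w\<close> commutes with \<open>A\<close>, the matrix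
  \<open>A * w + (1\<^sub>m e - A)\<close> is \<open>w\<close> on the range of \<open>A\<close> and
  the identity on the complementary range. Its determinant is thus that of \<open>w\<close> on the
  range of \<open>A\<close>.\<close>

lemma det_on_idempotent_mult:
  fixes A w w' :: "complex mat"
  assumes A: "A \<in> carrier_mat e e" "A * A = A"
    and w: "w \<in> carrier_mat e e" "A * w = w * A" and w': "w' \<in> carrier_mat e e"
  shows "det (A * (w * w') + (1\<^sub>m e - A)) = det (A * w + (1\<^sub>m e - A)) * det (A * w' + (1\<^sub>m e - A))"
proof -
  let ?B = "1\<^sub>m e - A"
  have B: "?B \<in> carrier_mat e e" using A by (simp add: minus_carrier_mat)
  have AB: "A * ?B = 0\<^sub>m e e" "?B * A = 0\<^sub>m e e" "?B * ?B = ?B"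
  proof -
    have "A * ?B = A * 1\<^sub>m e - A * A" by (rule sq_distrib(4)[OF A(1) one_carrier_mat A(1)])
    then show 1: "A * ?B = 0\<^sub>m e e" using A by simp
    have "?B * A = 1\<^sub>m e * A - A * A" by (rule sq_distrib(3)[OF one_carrier_mat A(1) A(1)])
    then show "?B * A = 0\<^sub>m e e" using A by simp
    have "?B * ?B = 1\<^sub>m e * ?B - A * ?B" by (rule sq_distrib(3)[OF one_carrier_mat A(1) B])
    then show "?B * ?B = ?B" using 1 A by (auto intro!: eq_matI)
  qed
  have c: "A * w \<in> carrier_mat e e" "A * w' \<in> carrier_mat e e" using A w w' by (auto intro: sq_closed)
  have "(A * w + ?B) * (A * w' + ?B) = A * w * (A * w' + ?B) + ?B * (A * w' + ?B)"
    using c B by (intro sq_distrib(1)) auto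
  also have "A * w * (A * w' + ?B) = A * w * (A * w') + A * w * ?B"
    using c B by (intro sq_distrib(2)) auto
  also have "A * w * (A * w') = w * (A * A) * w'"
    unfolding w(2) using A(1) w(1) w' by (simp add: sq_assoc[of _ e] del: assoc_mult_mat)
  also have "\<dots> = A * (w * w')"
    unfolding A(2) w(2)[symmetric] using A(1) w(1) w' by (simp add: sq_assoc[of _ e] del: assoc_mult_mat)
  also have "A * w * ?B = 0\<^sub>m e e"
    unfolding w(2) using sq_assoc[OF w(1) A(1) B] AB(1) w(1) by simp
  also have "?B * (A * w' + ?B) = ?B * (A * w') + ?B * ?B"
    using c B by (intro sq_distrib(2)) auto
  also have "?B * (A * w') = 0\<^sub>m e e"
    using sq_assoc[OF B A(1) w'] AB(2) w' by simp
  finally have eq: "(A * w + ?B) * (A * w' + ?B) = A * (w * w') + ?B"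
    using A w w' B unfolding AB(3) by (simp add: sq_closed[of _ e])
  show ?thesis
    unfolding eq[symmetric] using c B by (intro det_mult[of _ e]) auto
qed

section \<open>Linearizing the projective representation\<close>

context odd_form_irreducible
begin

text \<open>With \<open>E'\<close> below, the projections onto the eigenspaces of \<open>J\<close>
  for the eigenvalues 1 and -1.\<close>

definition E where "E = inverse 2 \<cdot>\<^sub>m (1\<^sub>m e + J)"
definition E' where "E' = 1\<^sub>m e - E"

lemma Ec: "E \<in> carrier_mat e e" "E' \<in> carrier_mat e e"
  using Jc by (auto simp: E_def E'_def)

lemma E_square: "E * E = E"
proof -
  have "(1\<^sub>m e + J) * (1\<^sub>m e + J) = 1\<^sub>m e * (1\<^sub>m e + J) + J * (1\<^sub>m e + J)"
    using Jc by (intro sq_distrib(1)) auto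
  also have "J * (1\<^sub>m e + J) = J * 1\<^sub>m e + J * J"
    using Jc by (intro sq_distrib(2)) auto
  finally have "(1\<^sub>m e + J) * (1\<^sub>m e + J) = 2 \<cdot>\<^sub>m (1\<^sub>m e + J)"
    using Jc unfolding J_square by (auto intro!: eq_matI)
  then show ?thesis
    unfolding E_def using Jc by (auto simp: sq_smult[of _ e] intro!: eq_matI)
qed

lemma E'_square: "E' * E' = E'"
proof -
  have "E' * E' = 1\<^sub>m e * E' - E * E'"
    unfolding E'_def using Ec by (intro sq_distrib(3)) (auto simp: minus_carrier_mat)
  also have "E * E' = E * 1\<^sub>m e - E * E"
    unfolding E'_def using Ec by (intro sq_distrib(4)) auto
  finally show ?thesis unfolding E_square using Ec by (auto intro!: eq_matI)
qed

text \<open>Numerator and denominator are determinants on the two eigenspaces of \<open>J\<close>. Their dimensions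
  differ by one, so \<open>scalar\<close> is homogeneous of degree \<open>-1\<close>, and multiplying each projective operator
  \<open>w\<close> by \<open>scalar w\<close> turns a projective representation commuting with \<open>J\<close> into a genuine one.\<close>
definition scalar where
  "scalar w = det (E' * w + (1\<^sub>m e - E')) / det (E * w + (1\<^sub>m e - E))"

lemma E_commute:
  assumes "w \<in> carrier_mat e e" "w * J = J * w"
  shows "E * w = w * E" "E' * w = w * E'"
proof -
  show 1: "E * w = w * E"
    unfolding E_def using assms Jc sq_distrib(1)[OF one_carrier_mat Jc assms(1)]
      sq_distrib(2)[OF assms(1) one_carrier_mat Jc]
    by (simp add: sq_smult[of _ e])
  show "E' * w = w * E'"
    unfolding E'_def using 1 assms Ec sq_distrib(3)[OF one_carrier_mat Ec(1) assms(1)]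
      sq_distrib(4)[OF assms(1) one_carrier_mat Ec(1)] by simp
qed

text \<open>With \<open>x / 0 = 0\<close> quotients multiply even where a denominator vanishes, so
  multiplicativity passes directly from the determinants to their quotient.\<close>

lemma scalar_mult:
  assumes "w \<in> carrier_mat e e" "w * J = J * w" "w' \<in> carrier_mat e e"
  shows "scalar (w * w') = scalar w * scalar w'"
  unfolding scalar_def
  using det_on_idempotent_mult[OF Ec(1) E_square assms(1) E_commute(1)[OF assms(1,2)] assms(3)]
    det_on_idempotent_mult[OF Ec(2) E'_square assms(1) E_commute(2)[OF assms(1,2)] assms(3)]
  by simp

text \<open>Since \<open>J\<close> has trace 1, the traces of \<open>E\<close> and \<open>E'\<close>
  are \<open>(e + 1) / 2\<close> and \<open>(e - 1) / 2\<close>; so the two powers of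
  \<open>c\<close> have exponents differing by one.\<close>

lemma scalar_scalar:
  assumes "c \<noteq> 0" shows "scalar (c \<cdot>\<^sub>m 1\<^sub>m e) = inverse c"
proof -
  obtain a where a: "mat_trace E = of_nat a" "\<And>c. det (c \<cdot>\<^sub>m E + (1\<^sub>m e - E)) = c ^ a"
    using idempotent_mat[OF Ec(1) E_square] by blast
  obtain b where b: "mat_trace E' = of_nat b" "\<And>c. det (c \<cdot>\<^sub>m E' + (1\<^sub>m e - E')) = c ^ b"
    using idempotent_mat[OF Ec(2) E'_square] by blast
  have tE: "mat_trace E = (of_nat e + 1) / 2"
    unfolding E_def using Jc J_trace
    by (simp add: mat_trace_smult[of _ e] mat_trace_add[of _ e] mat_trace_one)
  have tE': "mat_trace E' = of_nat e - mat_trace E"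
    unfolding E'_def using Ec by (simp add: mat_trace_diff[of _ e] mat_trace_one)
  have "(of_nat a :: complex) = of_nat (b + 1)"
  proof -
    have h1: "of_nat a * 2 = 1 + (of_nat e :: complex)" using tE a by (simp add: field_simps)
    have h2: "(of_nat e :: complex) = of_nat a + of_nat b" using tE' a b by (simp add: algebra_simps)
    show ?thesis using h1 unfolding h2 mult_2_right by simp
  qed
  then have ab: "a = b + 1" by (simp only: of_nat_eq_iff)
  have "E * (c \<cdot>\<^sub>m 1\<^sub>m e) = c \<cdot>\<^sub>m E" "E' * (c \<cdot>\<^sub>m 1\<^sub>m e) = c \<cdot>\<^sub>m E'"
    using Ec by (simp_all add: sq_smult[of _ e])
  then have "scalar (c \<cdot>\<^sub>m 1\<^sub>m e) = c ^ b / c ^ a" unfolding scalar_def by (simp only: a(2) b(2))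
  then show ?thesis unfolding ab using assms by (simp add: field_simps)
qed

lemma scalar_smult:
  assumes "c \<noteq> 0" "w \<in> carrier_mat e e"
  shows "scalar (c \<cdot>\<^sub>m w) = inverse c * scalar w"
proof -
  have "c \<cdot>\<^sub>m w = (c \<cdot>\<^sub>m 1\<^sub>m e) * w" using assms by (simp add: sq_smult[of _ e])
  moreover have "(c \<cdot>\<^sub>m 1\<^sub>m e) * J = J * (c \<cdot>\<^sub>m 1\<^sub>m e)" using Jc by (simp add: sq_smult[of _ e])
  ultimately show ?thesis using scalar_mult[of "c \<cdot>\<^sub>m 1\<^sub>m e" w] scalar_scalar assms by simp
qed

lemma scalar_commutant:
  assumes "c \<noteq> 0" shows "scalar (c \<cdot>\<^sub>m 1\<^sub>m e) \<cdot>\<^sub>m (c \<cdot>\<^sub>m 1\<^sub>m e) = 1\<^sub>m e"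
  using scalar_scalar[OF assms] assms by (auto intro!: eq_matI)

text \<open>\<open>Q (x \<otimes> inv y)\<close> is a non-zero multiple of the identity, so its
  trace does not vanish, as it would outside \<open>R\<close>.\<close>

lemma equal_operators:
  assumes x: "x \<in> M" and y: "y \<in> M" and eq: "Q x = Q y"
  shows "x \<otimes> inv y \<in> R"
proof (rule ccontr)
  let ?z = "x \<otimes> inv y"
  assume nR: "?z \<notin> R"
  have z: "?z \<in> M" using x y Mm Mi by simp
  have zy: "?z \<otimes> y = x" using x y Mc by (simp add: m_assoc)
  have "Q ?z = Q ?z * (Q y * Q (inv y))"
    using heis_inv[OF heisQ y] Qc[OF z] by simp
  also have "\<dots> = Q ?z * Q y * Q (inv y)" by (rule sq_assoc[OF Qc[OF z] Qc[OF y] Qc[OF Mi[OF y]], symmetric])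
  also have "Q ?z * Q y = \<beta> ?z y \<cdot>\<^sub>m Q y" unfolding heisD(3)[OF heisQ z y] zy eq ..
  also have "\<dots> * Q (inv y) = \<beta> ?z y \<cdot>\<^sub>m 1\<^sub>m e"
    using sq_smult(1)[OF Qc[OF y] Qc[OF Mi[OF y]]] heis_inv[OF heisQ y] by simp
  finally have "mat_trace (Q ?z) = \<beta> ?z y * of_nat e"
    by (simp add: mat_trace_smult[of _ e] mat_trace_one)
  then show False using heis_trace[OF heisQ z nR] form_nonzero[OF z y] e0 by simp
qed

text \<open>An element \<open>g\<close> of \<open>T\<close> preserves the form, so twisting
  \<open>Q\<close> by conjugation with \<open>g\<close> gives another Heisenberg representation of
  degree \<open>e\<close>. The intertwiner between the two is unique up to a scalar, and
  \<open>scalar\<close> picks out a multiplicative choice.\<close>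

lemma weil_mrep:
  assumes T: "subgroup T G"
    and conj: "\<And>g x. g \<in> T \<Longrightarrow> x \<in> M \<Longrightarrow> g \<otimes> x \<otimes> inv g \<in> M"
    and inv\<beta>: "\<And>g x y. g \<in> T \<Longrightarrow> x \<in> M \<Longrightarrow> y \<in> M \<Longrightarrow>
      \<beta> (g \<otimes> x \<otimes> inv g) (g \<otimes> y \<otimes> inv g) = \<beta> x y"
  obtains W where "mrep (G\<lparr>carrier := T\<rparr>) e W" "\<forall>g\<in>T. W g * J = J * W g"
    "\<forall>g\<in>T. W g = 1\<^sub>m e \<longrightarrow> (\<forall>x\<in>M. g \<otimes> x \<otimes> inv g \<otimes> inv x \<in> R)"
proof -
  note Tc = subgroup.mem_carrier[OF T] and Ti = subgroup.m_inv_closed[OF T]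
    and Tm = subgroup.m_closed[OF T] and T1 = subgroup.one_closed[OF T]
  have cm: "g \<otimes> x \<otimes> inv g \<otimes> (g \<otimes> y \<otimes> inv g) = g \<otimes> (x \<otimes> y) \<otimes> inv g"
    if "g \<in> T" "x \<in> M" "y \<in> M" for g x y
  proof -
    have "g \<otimes> x \<otimes> inv g \<otimes> (g \<otimes> y \<otimes> inv g) = g \<otimes> x \<otimes> (inv g \<otimes> g) \<otimes> y \<otimes> inv g"
      using Tc[OF that(1)] Mc[OF that(2)] Mc[OF that(3)] by (simp only: m_assoc m_closed inv_closed)
    then show ?thesis using Tc[OF that(1)] Mc[OF that(2)] Mc[OF that(3)] by (simp add: m_assoc)
  qed
  have ci: "g \<otimes> (inv g \<otimes> y \<otimes> inv (inv g)) \<otimes> inv g = y" if "g \<in> T" "y \<in> M" for g y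
  proof -
    have "g \<otimes> (inv g \<otimes> y \<otimes> inv (inv g)) \<otimes> inv g = (g \<otimes> inv g) \<otimes> y \<otimes> (g \<otimes> inv g)"
      using Tc[OF that(1)] Mc[OF that(2)] by (simp only: m_assoc m_closed inv_closed inv_inv)
    then show ?thesis using Tc[OF that(1)] Mc[OF that(2)] by simp
  qed
  have cR: "g \<otimes> r \<otimes> inv g \<in> R" if g: "g \<in> T" and r: "r \<in> R" for g r
    unfolding R_def
  proof (intro CollectI conjI ballI)
    show "g \<otimes> r \<otimes> inv g \<in> M" using conj g RM[OF r] .
    fix y assume y: "y \<in> M"
    let ?y = "inv g \<otimes> y \<otimes> inv (inv g)"
    have "?y \<in> M" using conj[OF Ti[OF g] y] .
    then show "\<beta> (g \<otimes> r \<otimes> inv g) y = 1"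
      using inv\<beta>[OF g RM[OF r], of ?y] ci[OF g y] R_left[OF r] by simp
  qed
  have heisg: "heis e (\<lambda>y. Q (g \<otimes> y \<otimes> inv g))" if g: "g \<in> T" for g
    unfolding heis_def
  proof (intro conjI ballI)
    fix x y assume xy: "x \<in> M" "y \<in> M"
    show "Q (g \<otimes> x \<otimes> inv g) * Q (g \<otimes> y \<otimes> inv g) = \<beta> x y \<cdot>\<^sub>m Q (g \<otimes> (x \<otimes> y) \<otimes> inv g)"
      using heisD(3)[OF heisQ conj[OF g xy(1)] conj[OF g xy(2)]] inv\<beta>[OF g xy] cm[OF g xy] by simp
  qed (use conj g cR heisD(1,2)[OF heisQ] in auto)
  have "\<exists>w w'. w \<in> carrier_mat e e \<and> w' \<in> carrier_mat e e \<and> w * w' = 1\<^sub>m e \<and> w' * w = 1\<^sub>m e \<and>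
      (\<forall>y\<in>M. w * Q y = Q (g \<otimes> y \<otimes> inv g) * w)" if g: "g \<in> T" for g
  proof -
    obtain w w' where "w \<in> carrier_mat e e" "w' \<in> carrier_mat e e" "w * w' = 1\<^sub>m e" "w' * w = 1\<^sub>m e"
      "\<And>y. y \<in> M \<Longrightarrow> w * Q y = Q (g \<otimes> y \<otimes> inv g) * w"
      by (rule intertwiner[OF heisg[OF g]]) blast
    then show ?thesis by blast
  qed
  then obtain w w' where wc: "\<And>g. g \<in> T \<Longrightarrow> w g \<in> carrier_mat e e"
    and w'c: "\<And>g. g \<in> T \<Longrightarrow> w' g \<in> carrier_mat e e"
    and ww': "\<And>g. g \<in> T \<Longrightarrow> w g * w' g = 1\<^sub>m e" and w'w: "\<And>g. g \<in> T \<Longrightarrow> w' g * w g = 1\<^sub>m e"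
    and wQ: "\<And>g y. g \<in> T \<Longrightarrow> y \<in> M \<Longrightarrow> w g * Q y = Q (g \<otimes> y \<otimes> inv g) * w g"
    by metis
  have conj_bij: "bij_betw (\<lambda>y. g \<otimes> y \<otimes> inv g) M M" if g: "g \<in> T" for g
    by (rule bij_betw_byWitness[of _ "\<lambda>y. inv g \<otimes> y \<otimes> inv (inv g)"])
      (use ci[OF g] ci[OF Ti[OF g]] conj[OF g] conj[OF Ti[OF g]] Tc[OF g] in auto)
  \<comment> \<open>\<open>J\<close> is a multiple of the sum of all \<open>Q y\<close>, and
    conjugation by \<open>g\<close> permutes \<open>M\<close>.\<close>
  have wJ: "w g * J = J * w g" if g: "g \<in> T" for g
  proof -
    have "w g * msum e Q M = msum e (\<lambda>y. w g * Q y) M" by (rule mult_msum[OF wc[OF g] Qc])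
    also have "\<dots> = msum e (\<lambda>y. Q (g \<otimes> y \<otimes> inv g) * w g) M" by (rule msum_cong[OF wQ[OF g]])
    also have "\<dots> = msum e (\<lambda>y. Q y * w g) M"
      by (rule msum_reindex[OF conj_bij[OF g], of e "\<lambda>y. Q y * w g"])
    also have "\<dots> = msum e Q M * w g" by (rule msum_mult[OF wc[OF g] Qc, symmetric])
    finally show ?thesis unfolding J_def using wc[OF g] by (simp add: sq_smult[of _ e])
  qed
  \<comment> \<open>Schur's lemma for \<open>w' g * v\<close>, which commutes with all
    \<open>Q y\<close>.\<close>
  have multiple: "\<exists>c. c \<noteq> 0 \<and> v = c \<cdot>\<^sub>m w g"
    if g: "g \<in> T" and v: "v \<in> carrier_mat e e" and u: "u \<in> carrier_mat e e" "v * u = 1\<^sub>m e"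
      and vQ: "\<And>y. y \<in> M \<Longrightarrow> v * Q y = Q (g \<otimes> y \<otimes> inv g) * v" for g v u
  proof -
    note c = wc[OF g] w'c[OF g]
    have "Q y * (w' g * v) = w' g * v * Q y" if y: "y \<in> M" for y
    proof -
      let ?y = "Q (g \<otimes> y \<otimes> inv g)"
      have yc: "?y \<in> carrier_mat e e" "Q y \<in> carrier_mat e e" using Qc conj[OF g y] y by auto
      have 1: "Q y * w' g = w' g * ?y"
      proof -
        have "Q y * w' g = (w' g * w g) * Q y * w' g" using w'w[OF g] c yc by simp
        also have "\<dots> = w' g * (w g * Q y) * w' g"
          using c yc by (simp add: sq_assoc[of _ e] sq_closed[of _ e] del: assoc_mult_mat)
        also have "\<dots> = w' g * ?y * (w g * w' g)"
          unfolding wQ[OF g y] using c yc by (simp add: sq_assoc[of _ e] sq_closed[of _ e] del: assoc_mult_mat)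
        also have "\<dots> = w' g * ?y" using ww'[OF g] c yc by (simp add: sq_closed[of _ e])
        finally show ?thesis .
      qed
      have "Q y * (w' g * v) = Q y * w' g * v" by (rule sq_assoc[OF yc(2) c(2) v, symmetric])
      also have "\<dots> = w' g * (?y * v)" unfolding 1 by (rule sq_assoc[OF c(2) yc(1) v])
      also have "\<dots> = w' g * v * Q y" unfolding vQ[OF y, symmetric] by (rule sq_assoc[OF c(2) v yc(2), symmetric])
      finally show ?thesis .
    qed
    then obtain a where a: "w' g * v = a \<cdot>\<^sub>m 1\<^sub>m e"
      using heis_schur[OF heisQ mult_carrier_mat[OF c(2) v]] by blast
    have "w g * (w' g * v) = w g * w' g * v" by (rule sq_assoc[OF c v, symmetric])
    then have eq: "v = a \<cdot>\<^sub>m w g" unfolding a using ww'[OF g] v c by (simp add: sq_smult[of _ e])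
    have "a \<noteq> 0"
    proof
      assume "a = 0"
      then have "v = 0\<^sub>m e e" using eq c by auto
      then have "(1\<^sub>m e :: complex mat) = 0\<^sub>m e e" using u by simp
      then have "(1\<^sub>m e :: complex mat) $$ (0,0) = 0\<^sub>m e e $$ (0,0)" by (rule arg_cong)
      then show False using e0 by simp
    qed
    then show ?thesis using eq by blast
  qed
  define W where "W g = scalar (w g) \<cdot>\<^sub>m w g" for g
  have Wc: "W g \<in> carrier_mat e e" if "g \<in> T" for g using wc[OF that] by (simp add: W_def)
  \<comment> \<open>As \<open>scalar\<close> has degree -1, the matrix
    \<open>scalar v \<cdot>\<^sub>m v\<close> depends only on the line spanned by \<open>v\<close>;
    the arbitrary choice of \<open>w g\<close> is thereby forgotten.\<close>
  have norm: "scalar v \<cdot>\<^sub>m v = W g" if "g \<in> T" "v = c \<cdot>\<^sub>m w g" "c \<noteq> 0" for g v c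
    unfolding W_def that(2) using scalar_smult[OF that(3) wc[OF that(1)]] that(3) by (auto intro!: eq_matI)
  have one: "W \<one> = 1\<^sub>m e"
  proof -
    have "\<exists>c. c \<noteq> 0 \<and> 1\<^sub>m e = c \<cdot>\<^sub>m w \<one>"
      by (rule multiple[OF T1 _ one_carrier_mat]) (use Mc left_mult_one_mat[OF Qc] right_mult_one_mat[OF Qc] in auto)
    then obtain c where "c \<noteq> 0" "1\<^sub>m e = c \<cdot>\<^sub>m w \<one>" by blast
    from norm[OF T1 this(2,1)] have "W \<one> = scalar (1\<^sub>m e) \<cdot>\<^sub>m 1\<^sub>m e" by simp
    moreover have "1 \<cdot>\<^sub>m 1\<^sub>m e = (1\<^sub>m e :: complex mat)" by (intro eq_matI) auto
    ultimately show ?thesis using scalar_commutant[of 1] by simp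
  qed
  have mult: "W (g \<otimes> h) = W g * W h" if g: "g \<in> T" and h: "h \<in> T" for g h
  proof -
    note c = wc[OF g] wc[OF h] w'c[OF g] w'c[OF h]
    have "\<exists>c. c \<noteq> 0 \<and> w g * w h = c \<cdot>\<^sub>m w (g \<otimes> h)"
    proof (rule multiple[OF Tm[OF g h] mult_carrier_mat[OF c(1,2)] mult_carrier_mat[OF c(4,3)]])
      have "w g * w h * (w' h * w' g) = w g * (w h * w' h) * w' g"
        using c by (simp add: sq_assoc[of _ e] sq_closed[of _ e] del: assoc_mult_mat)
      then show "w g * w h * (w' h * w' g) = 1\<^sub>m e" using ww' g h c by simp
      fix y assume y: "y \<in> M"
      let ?y = "h \<otimes> y \<otimes> inv h"
      have yM: "?y \<in> M" using conj[OF h y] .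
      have gy: "g \<otimes> ?y \<otimes> inv g = g \<otimes> h \<otimes> y \<otimes> inv (g \<otimes> h)"
        using Tc[OF g] Tc[OF h] Mc[OF y] by (simp add: m_assoc inv_mult_group)
      note yc = Qc[OF y] Qc[OF yM] Qc[OF conj[OF g yM]]
      have "w g * w h * Q y = w g * (w h * Q y)" by (rule sq_assoc[OF c(1,2) yc(1)])
      also have "\<dots> = w g * Q ?y * w h" unfolding wQ[OF h y] by (rule sq_assoc[OF c(1) yc(2) c(2), symmetric])
      also have "\<dots> = Q (g \<otimes> ?y \<otimes> inv g) * (w g * w h)"
        unfolding wQ[OF g yM] by (rule sq_assoc[OF yc(3) c(1,2)])
      finally show "w g * w h * Q y = Q (g \<otimes> h \<otimes> y \<otimes> inv (g \<otimes> h)) * (w g * w h)" unfolding gy .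
    qed
    then obtain a where "a \<noteq> 0" "w g * w h = a \<cdot>\<^sub>m w (g \<otimes> h)" by blast
    from norm[OF Tm[OF g h] this(2,1)] have "W (g \<otimes> h) = scalar (w g * w h) \<cdot>\<^sub>m (w g * w h)" by simp
    also have "\<dots> = W g * W h"
      unfolding W_def scalar_mult[OF c(1) wJ[OF g] c(2)] using c
      by (auto simp: sq_smult[of _ e] sq_closed[of _ e] mult.assoc intro!: eq_matI)
    finally show ?thesis .
  qed
  have WJ: "W g * J = J * W g" if "g \<in> T" for g
    unfolding W_def using wJ[OF that] wc[OF that] Jc by (simp add: sq_smult[of _ e])
  have ker: "g \<otimes> x \<otimes> inv g \<otimes> inv x \<in> R" if g: "g \<in> T" "W g = 1\<^sub>m e" and x: "x \<in> M" for g x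
  proof -
    let ?s = "scalar (w g)" and ?y = "g \<otimes> x \<otimes> inv g"
    have "Q ?y * W g = W g * Q x"
      unfolding W_def using wQ[OF g(1) x] wc[OF g(1)] Qc[OF x] Qc[OF conj[OF g(1) x]]
      by (simp add: sq_smult[of _ e])
    then have "Q ?y = Q x" using g(2) Qc[OF x] Qc[OF conj[OF g(1) x]] by simp
    then show ?thesis using equal_operators[OF conj[OF g(1) x] x] by simp
  qed
  show ?thesis
    by (rule that[of W]) (use Wc one mult WJ ker in \<open>auto simp: mrep_def\<close>)
qed

end

text \<open>Removes the auxiliary choice of \<open>Q\<close>: \<open>e\<close> is the least degree
  of a Heisenberg representation, and one exists by \<open>heis_exists\<close>.\<close>

lemma (in odd_form) weil_representation:
  assumes T: "subgroup T G"
    and conj: "\<And>g x. g \<in> T \<Longrightarrow> x \<in> M \<Longrightarrow> g \<otimes> x \<otimes> inv g \<in> M"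
    and inv\<beta>: "\<And>g x y. g \<in> T \<Longrightarrow> x \<in> M \<Longrightarrow> y \<in> M \<Longrightarrow>
      \<beta> (g \<otimes> x \<otimes> inv g) (g \<otimes> y \<otimes> inv g) = \<beta> x y"
  obtains e W J where "0 < e" "e * e * card R = card M" "mrep (G\<lparr>carrier := T\<rparr>) e W"
    "J \<in> carrier_mat e e" "\<forall>g\<in>T. W g * J = J * W g" "1 < e \<longrightarrow> (\<forall>c. J \<noteq> c \<cdot>\<^sub>m 1\<^sub>m e)"
    "\<forall>g\<in>T. W g = 1\<^sub>m e \<longrightarrow> (\<forall>x\<in>M. g \<otimes> x \<otimes> inv g \<otimes> inv x \<in> R)"
proof -
  define e where "e = (LEAST d. 0 < d \<and> (\<exists>Y. heis d Y))"
  have "0 < e \<and> (\<exists>Y. heis e Y)" unfolding e_def using heis_exists LeastI_ex[of "\<lambda>d. 0 < d \<and> (\<exists>Y. heis d Y)"] by blast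
  then obtain Q where Q: "0 < e" "heis e Q" by blast
  have min: "e \<le> d" if "heis d Y" "0 < d" for d Y
    unfolding e_def by (rule Least_le) (use that in blast)
  interpret odd_form_irreducible G M \<beta> N e Q
    by unfold_locales (use Q min in auto)
  obtain W where W: "mrep (G\<lparr>carrier := T\<rparr>) e W" "\<forall>g\<in>T. W g * J = J * W g"
    "\<forall>g\<in>T. W g = 1\<^sub>m e \<longrightarrow> (\<forall>x\<in>M. g \<otimes> x \<otimes> inv g \<otimes> inv x \<in> R)"
    by (rule weil_mrep[OF T conj inv\<beta>])
  show ?thesis by (rule that[OF Q(1) degree_square W(1) Jc W(2) _ W(3)]) (use J_nonscalar in blast)
qed

section \<open>Weights of abelian normal subgroups\<close>

text \<open>Induction on \<open>d\<close>: unless all \<open>F a\<close> are scalar, an eigenspace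
  of a non-scalar one is stable under the others. The eigenvector found for the smaller blocks is
  carried back by \<open>L\<close>.\<close>

lemma common_eigenvector:
  fixes F :: "'x \<Rightarrow> complex mat"
  assumes "0 < d" "\<And>a. a \<in> S \<Longrightarrow> F a \<in> carrier_mat d d"
    "\<And>a b. a \<in> S \<Longrightarrow> b \<in> S \<Longrightarrow> F a * F b = F b * F a"
  shows "\<exists>v\<in>carrier_vec d. v \<noteq> 0\<^sub>v d \<and> (\<forall>a\<in>S. \<exists>c. F a *\<^sub>v v = c \<cdot>\<^sub>v v)"
  using assms
proof (induction d arbitrary: F rule: less_induct)
  case (less d)
  show ?case
  proof (cases "\<forall>b\<in>S. \<exists>c. F b = c \<cdot>\<^sub>m 1\<^sub>m d")
    case True
    have "(unit_vec d 0 :: complex vec) \<noteq> 0\<^sub>v d"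
    proof
      assume "(unit_vec d 0 :: complex vec) = 0\<^sub>v d"
      then have "(unit_vec d 0 :: complex vec) $ 0 = 0\<^sub>v d $ 0" by simp
      then show False using less.prems(1) by simp
    qed
    moreover have "\<exists>c. F a *\<^sub>v unit_vec d 0 = c \<cdot>\<^sub>v unit_vec d 0" if a: "a \<in> S" for a
    proof -
      obtain c where "F a = c \<cdot>\<^sub>m 1\<^sub>m d" using True a by blast
      then have "F a *\<^sub>v unit_vec d 0 = c \<cdot>\<^sub>v unit_vec d 0"
        using less.prems(1) by (intro eq_vecI) auto
      then show ?thesis by blast
    qed
    ultimately show ?thesis by (intro bexI[of _ "unit_vec d 0"]) auto
  next
    case False
    then obtain b where b: "b \<in> S" and ns: "\<And>c. F b \<noteq> c \<cdot>\<^sub>m 1\<^sub>m d" by blast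
    obtain W where W: "VectorSpace.subspace class_ring W (module_vec TYPE(complex) d)"
      "W \<noteq> {0\<^sub>v d}" "W \<noteq> carrier_vec d"
      "\<forall>A\<in>carrier_mat d d. A * F b = F b * A \<longrightarrow> (\<forall>w\<in>W. A *\<^sub>v w \<in> W)"
      by (rule nonscalar_commutant_subspace[OF less.prems(2)[OF b] less.prems(1) ns])
    have inv: "\<forall>w\<in>W. F a *\<^sub>v w \<in> W" if "a \<in> S" for a
      using W(4) less.prems(2)[OF that] less.prems(3)[OF that b] by blast
    obtain r and f h :: "complex mat \<Rightarrow> complex mat" where r: "0 < r" "r < d"
      and fc: "\<And>A. A \<in> carrier_mat d d \<Longrightarrow> f A \<in> carrier_mat r r"
      and fm: "\<And>A B. A \<in> carrier_mat d d \<Longrightarrow> B \<in> carrier_mat d d \<Longrightarrow> \<forall>w\<in>W. B *\<^sub>v w \<in> W \<Longrightarrow>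
         f (A * B) = f A * f B"
      and ex: "\<exists>L\<in>carrier_mat d r. (\<forall>x\<in>carrier_vec r. L *\<^sub>v x = 0\<^sub>v d \<longrightarrow> x = 0\<^sub>v r) \<and>
         (\<forall>A\<in>carrier_mat d d. (\<forall>w\<in>W. A *\<^sub>v w \<in> W) \<longrightarrow> A * L = L * f A)"
      by (rule diagonal_blocks[OF W(1-3)]) blast
    from ex obtain L where L: "L \<in> carrier_mat d r"
      and Linj: "\<And>x. x \<in> carrier_vec r \<Longrightarrow> L *\<^sub>v x = 0\<^sub>v d \<Longrightarrow> x = 0\<^sub>v r"
      and AL: "\<And>A. A \<in> carrier_mat d d \<Longrightarrow> \<forall>w\<in>W. A *\<^sub>v w \<in> W \<Longrightarrow> A * L = L * f A" by blast
    have "\<exists>v\<in>carrier_vec r. v \<noteq> 0\<^sub>v r \<and> (\<forall>a\<in>S. \<exists>c. f (F a) *\<^sub>v v = c \<cdot>\<^sub>v v)"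
    proof (rule less.IH[OF r(2,1)])
      fix a c assume ac: "a \<in> S" "c \<in> S"
      show "f (F a) * f (F c) = f (F c) * f (F a)"
        using fm[OF less.prems(2)[OF ac(1)] less.prems(2)[OF ac(2)] inv[OF ac(2)]]
          fm[OF less.prems(2)[OF ac(2)] less.prems(2)[OF ac(1)] inv[OF ac(1)]]
          less.prems(3)[OF ac] by simp
    qed (use fc less.prems(2) in blast)
    then obtain v where v: "v \<in> carrier_vec r" "v \<noteq> 0\<^sub>v r"
      and ev: "\<And>a. a \<in> S \<Longrightarrow> \<exists>c. f (F a) *\<^sub>v v = c \<cdot>\<^sub>v v" by blast
    have "\<exists>c. F a *\<^sub>v (L *\<^sub>v v) = c \<cdot>\<^sub>v (L *\<^sub>v v)" if a: "a \<in> S" for a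
    proof -
      obtain c where c: "f (F a) *\<^sub>v v = c \<cdot>\<^sub>v v" using ev[OF a] by blast
      note Fa = less.prems(2)[OF a]
      have "F a *\<^sub>v (L *\<^sub>v v) = F a * L *\<^sub>v v" by (rule assoc_mult_mat_vec[OF Fa L v(1), symmetric])
      also have "\<dots> = L *\<^sub>v (f (F a) *\<^sub>v v)"
        unfolding AL[OF Fa inv[OF a]] by (rule assoc_mult_mat_vec[OF L fc[OF Fa] v(1)])
      also have "\<dots> = c \<cdot>\<^sub>v (L *\<^sub>v v)" unfolding c by (rule mult_mat_vec[OF L v(1)])
      finally show ?thesis by blast
    qed
    moreover have "L *\<^sub>v v \<in> carrier_vec d" using L v by simp
    moreover have "L *\<^sub>v v \<noteq> 0\<^sub>v d" using Linj[OF v(1)] v(2) by blast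
    ultimately show ?thesis by blast
  qed
qed

text \<open>The rank-one operators \<open>Z \<mapsto> tr (B v * Z) A v\<close> on matrices sum to an idempotent of trace \<open>q\<close>
  below the idempotent \<open>Z \<mapsto> P * Z * P\<close> of trace \<open>m\<^sup>2\<close>.\<close>
lemma dual_family_bound:
  fixes P :: "complex mat"
  assumes P: "P \<in> carrier_mat n n" "P * P = P" "mat_trace P = of_nat m"
    and A: "\<And>v. v < q \<Longrightarrow> A v \<in> carrier_mat n n" "\<And>v. v < q \<Longrightarrow> P * A v = A v" "\<And>v. v < q \<Longrightarrow> A v * P = A v"
    and B: "\<And>v. v < q \<Longrightarrow> B v \<in> carrier_mat n n" "\<And>v. v < q \<Longrightarrow> P * B v = B v" "\<And>v. v < q \<Longrightarrow> B v * P = B v"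
    and dual: "\<And>v w. v < q \<Longrightarrow> w < q \<Longrightarrow> mat_trace (B v * A w) = (if v = w then 1 else 0)"
  shows "q \<le> m * m"
proof -
  have ent: "(C * D) $$ (i,j) = (\<Sum>k<b. C $$ (i,k) * D $$ (k,j))"
    if "C \<in> carrier_mat a b" "D \<in> carrier_mat b c" "i < a" "j < c" for C D :: "complex mat" and a b c i j
    using that by (auto simp: scalar_prod_def atLeast0LessThan)
  have pair: "(\<Sum>a<n. \<Sum>b<n. B v $$ (b,a) * A w $$ (a,b)) = (if v = w then 1 else 0)"
    if vw: "v < q" "w < q" for v w
  proof -
    have "mat_trace (B v * A w) = (\<Sum>b<n. \<Sum>a<n. B v $$ (b,a) * A w $$ (a,b))"
      using ent[OF B(1)[OF vw(1)] A(1)[OF vw(2)]] B(1)[OF vw(1)] by (simp add: mat_trace_def)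
    also have "\<dots> = (\<Sum>a<n. \<Sum>b<n. B v $$ (b,a) * A w $$ (a,b))" by (rule sum.swap)
    finally show ?thesis using dual[OF vw] by simp
  qed
  have ent3: "(\<Sum>a<n. \<Sum>b<n. P $$ (i,a) * C $$ (a,b) * P $$ (b,j)) = C $$ (i,j)"
    if C: "C \<in> carrier_mat n n" "P * C = C" "C * P = C" and ij: "i < n" "j < n" for C :: "complex mat" and i j
  proof -
    have "(\<Sum>a<n. \<Sum>b<n. P $$ (i,a) * C $$ (a,b) * P $$ (b,j)) = (\<Sum>a<n. P $$ (i,a) * (C * P) $$ (a,j))"
      using ent[OF C(1) P(1) _ ij(2)] by (intro sum.cong) (auto simp: sum_distrib_left mult.assoc)
    also have "\<dots> = (P * C) $$ (i,j)" unfolding C(3) by (rule ent[OF P(1) C(1) ij, symmetric])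
    finally show ?thesis by (simp add: C(2))
  qed
  \<comment> \<open>Matrices are flattened to vectors of length \<open>n * n\<close>, those in
    \<open>U\<close> transposed, so that \<open>U * V\<close> is the table of traces of
    \<open>B v * A w\<close>. \<open>E\<close> is the matrix of the map that sends \<open>Z\<close>
    to \<open>P * Z * P\<close>.\<close>
  define V where "V = mat (n * n) q (\<lambda>(p,v). A v $$ (p div n, p mod n))"
  define U where "U = mat q (n * n) (\<lambda>(v,p). B v $$ (p mod n, p div n))"
  define E where "E = mat (n * n) (n * n) (\<lambda>(p,r). P $$ (p div n, r div n) * P $$ (r mod n, p mod n))"
  have c: "V \<in> carrier_mat (n * n) q" "U \<in> carrier_mat q (n * n)" "E \<in> carrier_mat (n * n) (n * n)"
    by (auto simp: V_def U_def E_def)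
  have UV: "U * V = 1\<^sub>m q"
  proof (rule mat_eqI[of _ q q])
    fix v w assume vw: "v < q" "w < q"
    have "(U * V) $$ (v,w) = (\<Sum>p<n * n. B v $$ (p mod n, p div n) * A w $$ (p div n, p mod n))"
      unfolding ent[OF c(2,1) vw] using vw by (intro sum.cong) (auto simp: U_def V_def)
    also have "\<dots> = (\<Sum>a<n. \<Sum>b<n. B v $$ (b,a) * A w $$ (a,b))" by (rule sum_div_mod)
    finally show "(U * V) $$ (v,w) = 1\<^sub>m q $$ (v,w)" using pair[OF vw] vw by simp
  qed (use c in auto)
  have EV: "E * V = V"
  proof (rule mat_eqI[of _ "n * n" q])
    fix p v assume pv: "p < n * n" "v < q"
    note d = div_mod_less[OF pv(1)]
    have "(E * V) $$ (p,v) = (\<Sum>r<n * n. P $$ (p div n, r div n) * A v $$ (r div n, r mod n) * P $$ (r mod n, p mod n))"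
      unfolding ent[OF c(3,1) pv] using pv by (intro sum.cong) (auto simp: E_def V_def)
    also have "\<dots> = (\<Sum>a<n. \<Sum>b<n. P $$ (p div n, a) * A v $$ (a,b) * P $$ (b, p mod n))" by (rule sum_div_mod)
    also have "\<dots> = V $$ (p,v)" unfolding ent3[OF A[OF pv(2)] d] using pv by (simp add: V_def)
    finally show "(E * V) $$ (p,v) = V $$ (p,v)" .
  qed (use c in auto)
  have UE: "U * E = U"
  proof (rule mat_eqI[of _ q "n * n"])
    fix v r assume vr: "v < q" "r < n * n"
    note d = div_mod_less[OF vr(2)]
    have "(U * E) $$ (v,r) = (\<Sum>p<n * n. P $$ (r mod n, p mod n) * B v $$ (p mod n, p div n) * P $$ (p div n, r div n))"
      unfolding ent[OF c(2,3) vr] using vr by (intro sum.cong) (auto simp: E_def U_def)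
    also have "\<dots> = (\<Sum>a<n. \<Sum>b<n. P $$ (r mod n, b) * B v $$ (b,a) * P $$ (a, r div n))" by (rule sum_div_mod)
    also have "\<dots> = (\<Sum>b<n. \<Sum>a<n. P $$ (r mod n, b) * B v $$ (b,a) * P $$ (a, r div n))" by (rule sum.swap)
    also have "\<dots> = U $$ (v,r)" unfolding ent3[OF B[OF vr(1)] d(2,1)] using vr by (simp add: U_def)
    finally show "(U * E) $$ (v,r) = U $$ (v,r)" .
  qed (use c in auto)
  have EE: "E * E = E"
  proof (rule mat_eqI[of _ "n * n" "n * n"])
    fix p r assume pr: "p < n * n" "r < n * n"
    note d = div_mod_less[OF pr(1)] div_mod_less[OF pr(2)]
    have "(E * E) $$ (p,r) = (\<Sum>s<n * n. (P $$ (p div n, s div n) * P $$ (s div n, r div n)) *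
        (P $$ (r mod n, s mod n) * P $$ (s mod n, p mod n)))"
      unfolding ent[OF c(3,3) pr] using pr by (intro sum.cong) (auto simp: E_def)
    also have "\<dots> = (\<Sum>a<n. \<Sum>b<n. (P $$ (p div n, a) * P $$ (a, r div n)) * (P $$ (r mod n, b) * P $$ (b, p mod n)))"
      by (rule sum_div_mod)
    also have "\<dots> = (P * P) $$ (p div n, r div n) * (P * P) $$ (r mod n, p mod n)"
      using ent[OF P(1) P(1)] d by (simp add: sum_product)
    finally show "(E * E) $$ (p,r) = E $$ (p,r)" using pr by (simp add: P(2) E_def)
  qed (use c in auto)
  define F where "F = V * U"
  have Fc: "F \<in> carrier_mat (n * n) (n * n)" unfolding F_def using c by simp
  have EF: "E * F = F" unfolding F_def using assoc_mult_mat[OF c(3,1,2)] EV by simp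
  have FE: "F * E = F" unfolding F_def assoc_mult_mat[OF c(1,2,3)] UE ..
  have FF: "F * F = F"
  proof -
    have "F * F = V * (U * (V * U))" unfolding F_def by (rule assoc_mult_mat[OF c(1,2) Fc[unfolded F_def]])
    also have "U * (V * U) = U" using assoc_mult_mat[OF c(2,1,2)] UV c(2) by simp
    finally show ?thesis unfolding F_def .
  qed
  have Dc: "E - F \<in> carrier_mat (n * n) (n * n)" by (rule minus_carrier_mat[OF Fc])
  \<comment> \<open>\<open>E - F\<close> is idempotent, so its trace \<open>m * m - q\<close> is a
    natural number.\<close>
  have "(E - F) * (E - F) = E * (E - F) - F * (E - F)" by (rule sq_distrib(3)[OF c(3) Fc Dc])
  also have "E * (E - F) = E - F" unfolding sq_distrib(4)[OF c(3,3) Fc] EE EF ..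
  also have "F * (E - F) = F - F" unfolding sq_distrib(4)[OF Fc c(3) Fc] FE FF ..
  finally have "(E - F) * (E - F) = E - F" using c Fc by (auto intro!: eq_matI)
  then obtain a where a: "mat_trace (E - F) = of_nat a" using idempotent_mat[OF Dc] by blast
  have "mat_trace E = (\<Sum>p<n * n. P $$ (p div n, p div n) * P $$ (p mod n, p mod n))"
    by (simp add: mat_trace_def E_def)
  also have "\<dots> = (\<Sum>i<n. \<Sum>j<n. P $$ (i,i) * P $$ (j,j))" by (rule sum_div_mod)
  also have "\<dots> = of_nat (m * m)" using P(1,3) by (simp add: mat_trace_def sum_product[symmetric])
  finally have trE: "mat_trace E = of_nat (m * m)" .
  have trF: "mat_trace F = of_nat q"
    unfolding F_def mat_trace_mult_comm[OF c(1,2)] UV by (rule mat_trace_one)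
  have "of_nat a = (of_nat (m * m) - of_nat q :: complex)"
    using a mat_trace_diff[OF c(3) Fc] trE trF by simp
  then have "of_nat (a + q) = (of_nat (m * m) :: complex)" by simp
  then have "a + q = m * m" by (simp only: of_nat_eq_iff)
  then show ?thesis by simp
qed

section \<open>Commutators and the weight spaces of the given representation\<close>

context group
begin

lemma cancel_inv_left: "x \<in> carrier G \<Longrightarrow> y \<in> carrier G \<Longrightarrow> inv x \<otimes> (x \<otimes> y) = y"
  by (simp add: m_assoc[symmetric])

lemma cancel_left_inv: "x \<in> carrier G \<Longrightarrow> y \<in> carrier G \<Longrightarrow> x \<otimes> (inv x \<otimes> y) = y"
  by (simp add: m_assoc[symmetric])

lemmas word_simps = m_assoc inv_mult_group cancel_inv_left cancel_left_inv

text \<open>The convention is that of \<open>derived_set\<close> and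
  \<open>lower_central\<close>.\<close>

definition comm :: "'a \<Rightarrow> 'a \<Rightarrow> 'a" where
  "comm x y = x \<otimes> y \<otimes> inv x \<otimes> inv y"

lemma comm_closed: "x \<in> carrier G \<Longrightarrow> y \<in> carrier G \<Longrightarrow> comm x y \<in> carrier G"
  by (simp add: comm_def)

lemma comm_conj:
  "g \<in> carrier G \<Longrightarrow> x \<in> carrier G \<Longrightarrow> y \<in> carrier G \<Longrightarrow>
    g \<otimes> comm x y \<otimes> inv g = comm (g \<otimes> x \<otimes> inv g) (g \<otimes> y \<otimes> inv g)"
  by (simp add: comm_def word_simps)

lemma comm_eq_one_iff:
  assumes "x \<in> carrier G" "y \<in> carrier G"
  shows "comm x y = \<one> \<longleftrightarrow> x \<otimes> y = y \<otimes> x"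
proof
  assume "comm x y = \<one>"
  then have "comm x y \<otimes> (y \<otimes> x) = y \<otimes> x" using assms by simp
  then show "x \<otimes> y = y \<otimes> x" using assms by (simp add: comm_def word_simps)
next
  assume "x \<otimes> y = y \<otimes> x"
  then show "comm x y = \<one>" using assms unfolding comm_def by (simp add: word_simps)
qed

lemma comm_inv: "x \<in> carrier G \<Longrightarrow> y \<in> carrier G \<Longrightarrow> inv (comm x y) = comm y x"
  by (simp add: comm_def word_simps)

end

locale minimal_rep = no_small_irreducible G n for G (structure) and n +
  fixes \<rho> :: "'a \<Rightarrow> complex mat"
  assumes irr: "irreducible_rep G n \<rho>"
    and faithful: "g \<in> carrier G \<Longrightarrow> \<rho> g = 1\<^sub>m n \<Longrightarrow> g = \<one>"
begin

lemma rep: "mrep G n \<rho>" and n0: "0 < n"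
  using irr unfolding irreducible_mrep by auto

lemmas \<rho>c = mrepD(1)[OF rep] and \<rho>1 = mrepD(2)[OF rep] and \<rho>m = mrepD(3)[OF rep]

text \<open>The vectors fixed by a conjugation-invariant set form an invariant subspace, which is
  everything as soon as it is non-zero. This turns identities for a single weight into identities in
  \<open>G\<close>.\<close>

lemma fixing_trivial:
  assumes S: "S \<subseteq> carrier G" "\<And>g x. g \<in> carrier G \<Longrightarrow> x \<in> S \<Longrightarrow> g \<otimes> x \<otimes> inv g \<in> S"
    and v: "v \<in> carrier_vec n" "v \<noteq> 0\<^sub>v n" "\<And>x. x \<in> S \<Longrightarrow> \<rho> x *\<^sub>v v = v"
    and x: "x \<in> S"
  shows "x = \<one>"
proof -
  interpret vec_space "TYPE(complex)" n .
  define U where "U = {u \<in> carrier_vec n. \<forall>x\<in>S. \<rho> x *\<^sub>v u = u}"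
  have Sc: "\<rho> x \<in> carrier_mat n n" if "x \<in> S" for x using \<rho>c S(1) that by blast
  have Sz: "\<rho> x *\<^sub>v 0\<^sub>v n = 0\<^sub>v n" if "x \<in> S" for x
    using Sc[OF that] by (intro eq_vecI) (auto simp: scalar_prod_def)
  have "submodule class_ring U V"
    unfolding submodule_def U_def using vec_module Sc Sz
    by (auto simp: module_vec_def mult_add_distrib_mat_vec[OF Sc] mult_mat_vec[OF Sc])
  then have sub: "VectorSpace.subspace class_ring U V"
    unfolding VectorSpace.subspace_def using vec_vs by auto
  have inv: "\<rho> g *\<^sub>v u \<in> U" if g: "g \<in> carrier G" and u: "u \<in> U" for g u
  proof -
    have uc: "u \<in> carrier_vec n" and fix_u: "\<And>x. x \<in> S \<Longrightarrow> \<rho> x *\<^sub>v u = u" using u unfolding U_def by auto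
    have "\<rho> x *\<^sub>v (\<rho> g *\<^sub>v u) = \<rho> g *\<^sub>v u" if x: "x \<in> S" for x
    proof -
      have xc: "x \<in> carrier G" using x S(1) by blast
      let ?y = "inv g \<otimes> x \<otimes> inv (inv g)"
      have y: "?y \<in> S" by (rule S(2)) (use g x in auto)
      have yc: "?y \<in> carrier G" using y S(1) by blast
      have gy: "g \<otimes> ?y = x \<otimes> g" using g xc by (simp add: word_simps)
      have "\<rho> x *\<^sub>v (\<rho> g *\<^sub>v u) = \<rho> (x \<otimes> g) *\<^sub>v u"
        unfolding \<rho>m[OF xc g] by (rule assoc_mult_mat_vec[OF \<rho>c[OF xc] \<rho>c[OF g] uc, symmetric])
      also have "\<dots> = \<rho> g *\<^sub>v (\<rho> ?y *\<^sub>v u)"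
        unfolding gy[symmetric] \<rho>m[OF g yc] by (rule assoc_mult_mat_vec[OF \<rho>c[OF g] \<rho>c[OF yc] uc])
      finally show ?thesis unfolding fix_u[OF y] .
    qed
    then show ?thesis unfolding U_def using \<rho>c[OF g] uc by simp
  qed
  have "invariant_subspace G n \<rho> U" unfolding invariant_subspace_def using sub inv by blast
  moreover have "U \<noteq> {0\<^sub>v n}" using v unfolding U_def by blast
  ultimately have U: "U = carrier_vec n" using irr unfolding irreducible_mrep by blast
  have "\<rho> x = 1\<^sub>m n"
  proof (rule mat_eqI[of _ n n])
    fix i j assume ij: "i < n" "j < n"
    have "unit_vec n j \<in> U" using U by simp
    then have "(\<rho> x *\<^sub>v unit_vec n j) $ i = (unit_vec n j :: complex vec) $ i"
      using x unfolding U_def by simp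
    then show "\<rho> x $$ (i,j) = 1\<^sub>m n $$ (i,j)" using ij Sc[OF x] by auto
  qed (use Sc[OF x] in auto)
  then show ?thesis using faithful x S(1) by blast
qed

end

text \<open>The vector \<open>v\<close> is kept with \<open>\<mu>\<close> because it makes
  \<open>\<mu>\<close> multiplicative and the weight space non-zero, and because elements of
  \<open>A\<close> on which \<open>\<mu>\<close> is 1 fix it.\<close>

locale weight = minimal_rep G n \<rho> for G (structure) and n \<rho> +
  fixes A :: "'a set" and \<mu> :: "'a \<Rightarrow> complex" and v :: "complex vec"
  assumes A: "A \<lhd> G" and abel: "a \<in> A \<Longrightarrow> b \<in> A \<Longrightarrow> a \<otimes> b = b \<otimes> a"
    and v: "v \<in> carrier_vec n" "v \<noteq> 0\<^sub>v n"
    and eig: "a \<in> A \<Longrightarrow> \<rho> a *\<^sub>v v = \<mu> a \<cdot>\<^sub>v v"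
begin

lemma Asub: "subgroup A G" using A by (rule normal_imp_subgroup)
lemma Ac: "a \<in> A \<Longrightarrow> a \<in> carrier G" using subgroup.mem_carrier[OF Asub] .
lemma A1: "\<one> \<in> A" using subgroup.one_closed[OF Asub] .
lemma Am: "a \<in> A \<Longrightarrow> b \<in> A \<Longrightarrow> a \<otimes> b \<in> A" using subgroup.m_closed[OF Asub] .
lemma Ai: "a \<in> A \<Longrightarrow> inv a \<in> A" using subgroup.m_inv_closed[OF Asub] .
lemma Aconj: "g \<in> carrier G \<Longrightarrow> a \<in> A \<Longrightarrow> g \<otimes> a \<otimes> inv g \<in> A"
  using normal.inv_op_closed2[OF A] .
lemma finA: "finite A" using fin subgroup.subset[OF Asub] finite_subset by blast

lemma smult_v_cancel: "c \<cdot>\<^sub>v v = d \<cdot>\<^sub>v v \<Longrightarrow> c = d"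
proof (rule ccontr)
  assume eq: "c \<cdot>\<^sub>v v = d \<cdot>\<^sub>v v" and "c \<noteq> d"
  have "v = 0\<^sub>v n"
  proof (rule eq_vecI)
    fix i assume "i < dim_vec (0\<^sub>v n :: complex vec)"
    then have "i < n" by simp
    then have "c * v $ i = d * v $ i" using arg_cong[OF eq, of "\<lambda>u. u $ i"] v(1) by simp
    then show "v $ i = 0\<^sub>v n $ i" using \<open>c \<noteq> d\<close> \<open>i < n\<close> by simp
  qed (use v(1) in auto)
  then show False using v(2) by simp
qed

lemma \<mu>1: "\<mu> \<one> = 1"
  using eig[OF A1] v(1) smult_v_cancel[of "\<mu> \<one>" 1] \<rho>1 by simp

lemma \<mu>m: assumes "a \<in> A" "b \<in> A" shows "\<mu> (a \<otimes> b) = \<mu> a * \<mu> b"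
proof (rule smult_v_cancel)
  note c = \<rho>c[OF Ac[OF assms(1)]] \<rho>c[OF Ac[OF assms(2)]]
  have "\<mu> (a \<otimes> b) \<cdot>\<^sub>v v = \<rho> (a \<otimes> b) *\<^sub>v v" using eig[OF Am[OF assms]] by simp
  also have "\<dots> = \<rho> a *\<^sub>v (\<rho> b *\<^sub>v v)"
    unfolding \<rho>m[OF Ac[OF assms(1)] Ac[OF assms(2)]] by (rule assoc_mult_mat_vec[OF c v(1)])
  also have "\<dots> = \<mu> b \<cdot>\<^sub>v (\<rho> a *\<^sub>v v)" unfolding eig[OF assms(2)] by (rule mult_mat_vec[OF c(1) v(1)])
  also have "\<dots> = (\<mu> a * \<mu> b) \<cdot>\<^sub>v v"
    unfolding eig[OF assms(1)] by (simp add: smult_smult_assoc mult.commute)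
  finally show "\<mu> (a \<otimes> b) \<cdot>\<^sub>v v = (\<mu> a * \<mu> b) \<cdot>\<^sub>v v" .
qed

lemma \<mu>i: assumes "a \<in> A" shows "\<mu> (inv a) * \<mu> a = 1"
  using \<mu>m[OF Ai[OF assms] assms] \<mu>1 Ac[OF assms] by simp

definition T where "T = {g \<in> carrier G. \<forall>a\<in>A. \<mu> (g \<otimes> a \<otimes> inv g) = \<mu> a}"

lemma T_subgroup: "subgroup T G"
proof (rule subgroup.intro)
  fix g h assume g: "g \<in> T" and h: "h \<in> T"
  then have c: "g \<in> carrier G" "h \<in> carrier G" by (auto simp: T_def)
  have "\<mu> (g \<otimes> h \<otimes> a \<otimes> inv (g \<otimes> h)) = \<mu> a" if a: "a \<in> A" for a
  proof -
    have "g \<otimes> h \<otimes> a \<otimes> inv (g \<otimes> h) = g \<otimes> (h \<otimes> a \<otimes> inv h) \<otimes> inv g"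
      using c Ac[OF a] by (simp add: word_simps)
    then show ?thesis using g h a Aconj[OF c(2) a] by (simp add: T_def)
  qed
  then show "g \<otimes> h \<in> T" using c by (simp add: T_def)
next
  show "\<one> \<in> T" using Ac by (simp add: T_def)
next
  fix g assume g: "g \<in> T"
  then have c: "g \<in> carrier G" by (auto simp: T_def)
  have "\<mu> (inv g \<otimes> a \<otimes> inv (inv g)) = \<mu> a" if a: "a \<in> A" for a
  proof -
    have b: "inv g \<otimes> a \<otimes> inv (inv g) \<in> A" using Aconj[of "inv g"] c a by blast
    have "g \<otimes> (inv g \<otimes> a \<otimes> inv (inv g)) \<otimes> inv g = a" using c Ac[OF a] by (simp add: word_simps)
    then show ?thesis using g b by (force simp: T_def)
  qed
  then show "inv g \<in> T" using c by (simp add: T_def)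
qed (auto simp: T_def)

text \<open>The averaging projection onto the weight space of \<open>\<mu>\<close>.\<close>

definition P where "P = inverse (of_nat (card A)) \<cdot>\<^sub>m msum n (\<lambda>a. inverse (\<mu> a) \<cdot>\<^sub>m \<rho> a) A"

lemma Pc: "P \<in> carrier_mat n n" by (simp add: P_def)

lemma A_translate: "b \<in> A \<Longrightarrow> bij_betw (\<lambda>a. b \<otimes> a) A A"
  by (rule bij_betw_byWitness[of _ "\<lambda>a. inv b \<otimes> a"])
    (use Am Ai Ac in \<open>auto simp: m_assoc[symmetric]\<close>)

lemma \<rho>_P: assumes b: "b \<in> A" shows "\<rho> b * P = \<mu> b \<cdot>\<^sub>m P"
proof -
  let ?F = "\<lambda>a. inverse (\<mu> a) \<cdot>\<^sub>m \<rho> a"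
  have Fc: "?F a \<in> carrier_mat n n" if "a \<in> A" for a using \<rho>c[OF Ac[OF that]] by simp
  have "\<rho> b * msum n ?F A = msum n (\<lambda>a. \<rho> b * ?F a) A"
    by (rule mult_msum[OF \<rho>c[OF Ac[OF b]] Fc])
  also have "\<dots> = msum n (\<lambda>a. \<mu> b \<cdot>\<^sub>m ?F (b \<otimes> a)) A"
  proof (rule msum_cong)
    fix a assume a: "a \<in> A"
    have "\<mu> b \<noteq> 0" using \<mu>i[OF b] by auto
    then show "\<rho> b * ?F a = \<mu> b \<cdot>\<^sub>m ?F (b \<otimes> a)"
      using \<rho>m[OF Ac[OF b] Ac[OF a]] \<rho>c[OF Ac[OF a]] \<rho>c[OF Ac[OF b]] \<mu>m[OF b a]
      by (auto simp: sq_smult[of _ n] intro!: eq_matI)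
  qed
  also have "\<dots> = msum n (\<lambda>a. \<mu> b \<cdot>\<^sub>m ?F a) A"
    by (rule msum_reindex[OF A_translate[OF b], of n "\<lambda>a. \<mu> b \<cdot>\<^sub>m ?F a"])
  also have "\<dots> = \<mu> b \<cdot>\<^sub>m msum n ?F A"
    by (intro eq_matI) (auto simp: msum_def sum_distrib_left carrier_matD[OF \<rho>c[OF Ac]] intro!: sum.cong)
  finally show ?thesis
    unfolding P_def using \<rho>c[OF Ac[OF b]] by (auto simp: sq_smult[of _ n] mult.left_commute intro!: eq_matI)
qed

lemma card_A: "(of_nat (card A) :: complex) \<noteq> 0" using finA A1 by auto

lemma conj_P:
  assumes g: "g \<in> carrier G"
  shows "\<rho> g * P * \<rho> (inv g) = inverse (of_nat (card A)) \<cdot>\<^sub>m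
    msum n (\<lambda>a. inverse (\<mu> (inv g \<otimes> a \<otimes> g)) \<cdot>\<^sub>m \<rho> a) A"
proof -
  let ?F = "\<lambda>a. inverse (\<mu> a) \<cdot>\<^sub>m \<rho> a"
  note gc = \<rho>c[OF g] \<rho>c[OF inv_closed[OF g]]
  have Fc: "?F a \<in> carrier_mat n n" if "a \<in> A" for a using \<rho>c[OF Ac[OF that]] by simp
  have bij: "bij_betw (\<lambda>a. g \<otimes> a \<otimes> inv g) A A"
    by (rule bij_betw_byWitness[of _ "\<lambda>a. inv g \<otimes> a \<otimes> inv (inv g)"])
      (use g Ac Aconj[OF g] Aconj[OF inv_closed[OF g]] in \<open>auto simp: word_simps\<close>)
  have m: "\<rho> g * msum n ?F A = msum n (\<lambda>a. \<rho> g * ?F a) A"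
    by (rule mult_msum[OF gc(1) Fc])
  have "\<rho> g * msum n ?F A * \<rho> (inv g) = msum n (\<lambda>a. \<rho> g * ?F a) A * \<rho> (inv g)"
    unfolding m by (rule refl)
  also have "\<dots> = msum n (\<lambda>a. \<rho> g * ?F a * \<rho> (inv g)) A"
    by (rule msum_mult[OF gc(2) sq_closed[OF gc(1) Fc]])
  also have "\<dots> = msum n (\<lambda>a. inverse (\<mu> (inv g \<otimes> (g \<otimes> a \<otimes> inv g) \<otimes> g)) \<cdot>\<^sub>m \<rho> (g \<otimes> a \<otimes> inv g)) A"
  proof (rule msum_cong)
    fix a assume a: "a \<in> A"
    have "inv g \<otimes> (g \<otimes> a \<otimes> inv g) \<otimes> g = a" using g Ac[OF a] by (simp add: word_simps)
    moreover have "\<rho> (g \<otimes> a \<otimes> inv g) = \<rho> g * \<rho> a * \<rho> (inv g)"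
      using g Ac[OF a] \<rho>m by simp
    ultimately show "\<rho> g * ?F a * \<rho> (inv g)
        = inverse (\<mu> (inv g \<otimes> (g \<otimes> a \<otimes> inv g) \<otimes> g)) \<cdot>\<^sub>m \<rho> (g \<otimes> a \<otimes> inv g)"
      using gc \<rho>c[OF Ac[OF a]] by (simp add: sq_smult[of _ n] sq_closed[of _ n] del: assoc_mult_mat)
  qed
  also have "\<dots> = msum n (\<lambda>a. inverse (\<mu> (inv g \<otimes> a \<otimes> g)) \<cdot>\<^sub>m \<rho> a) A"
    by (rule msum_reindex[OF bij, of n "\<lambda>a. inverse (\<mu> (inv g \<otimes> a \<otimes> g)) \<cdot>\<^sub>m \<rho> a"])
  finally show ?thesis
    unfolding P_def using gc by (simp add: sq_smult[of _ n] sq_closed[of _ n] del: assoc_mult_mat)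
qed

lemma T_commutes_P:
  assumes g: "g \<in> T"
  shows "\<rho> g * P * \<rho> (inv g) = P" "\<rho> g * P = P * \<rho> g"
proof -
  have gc: "g \<in> carrier G" using g by (simp add: T_def)
  have "\<mu> (inv g \<otimes> a \<otimes> g) = \<mu> a" if a: "a \<in> A" for a
    using subgroup.m_inv_closed[OF T_subgroup g] a gc unfolding T_def by simp
  then have eq: "msum n (\<lambda>a. inverse (\<mu> (inv g \<otimes> a \<otimes> g)) \<cdot>\<^sub>m \<rho> a) A = msum n (\<lambda>a. inverse (\<mu> a) \<cdot>\<^sub>m \<rho> a) A"
    by (intro msum_cong) simp
  show 1: "\<rho> g * P * \<rho> (inv g) = P" unfolding conj_P[OF gc] eq by (rule P_def[symmetric])
  note c = \<rho>c[OF gc] \<rho>c[OF inv_closed[OF gc]]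
  have "\<rho> g * P = \<rho> g * P * (\<rho> (inv g) * \<rho> g)"
    unfolding mrep_inv(2)[OF rep gc] by (rule right_mult_one_mat[OF sq_closed[OF c(1) Pc], symmetric])
  also have "\<dots> = \<rho> g * P * \<rho> (inv g) * \<rho> g"
    by (rule sq_assoc[OF sq_closed[OF c(1) Pc] c(2) c(1), symmetric])
  finally show "\<rho> g * P = P * \<rho> g" unfolding 1 .
qed

lemma A_subset_T: "A \<subseteq> T"
proof
  fix b assume b: "b \<in> A"
  have "b \<otimes> a \<otimes> inv b = a" if a: "a \<in> A" for a
    using abel[OF b a] Ac[OF a] Ac[OF b] by (simp add: m_assoc)
  then show "b \<in> T" using Ac[OF b] by (simp add: T_def)
qed

lemma P_square: "P * P = P"
proof -
  let ?F = "\<lambda>a. inverse (\<mu> a) \<cdot>\<^sub>m \<rho> a"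
  have Fc: "?F a \<in> carrier_mat n n" if "a \<in> A" for a using \<rho>c[OF Ac[OF that]] by simp
  have "msum n ?F A * P = msum n (\<lambda>a. ?F a * P) A" by (rule msum_mult[OF Pc Fc])
  also have "\<dots> = msum n (\<lambda>a. P) A"
  proof (rule msum_cong)
    fix a assume a: "a \<in> A"
    have "\<mu> a \<noteq> 0" using \<mu>i[OF a] by auto
    then show "?F a * P = P"
      using sq_smult(1)[OF \<rho>c[OF Ac[OF a]] Pc] \<rho>_P[OF a] by (auto intro!: eq_matI)
  qed
  also have "\<dots> = of_nat (card A) \<cdot>\<^sub>m P" using Pc by (auto simp: msum_def intro!: eq_matI)
  finally have eq: "msum n ?F A * P = of_nat (card A) \<cdot>\<^sub>m P" .
  have "P * P = inverse (of_nat (card A)) \<cdot>\<^sub>m (msum n ?F A * P)"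
    using sq_smult(1)[OF msum_carrier Pc, of _ ?F A] by (simp only: P_def)
  also have "\<dots> = P" unfolding eq using card_A by (auto intro!: eq_matI)
  finally show ?thesis .
qed

text \<open>\<open>P\<close> fixes \<open>v\<close>, as each summand
  \<open>inverse (\<mu> a) \<cdot>\<^sub>m \<rho> a\<close> does.\<close>

lemma P_nonzero: "P \<noteq> 0\<^sub>m n n"
proof
  assume P0: "P = 0\<^sub>m n n"
  have vdim: "dim_vec v = n" using v(1) by auto
  have "v = 0\<^sub>v n"
  proof (rule eq_vecI)
    fix i assume "i < dim_vec (0\<^sub>v n :: complex vec)"
    then have i: "i < n" by simp
    have "0 = (P *\<^sub>v v) $ i" unfolding P0 using i v(1) by simp
    also have "\<dots> = (\<Sum>j<n. (inverse (of_nat (card A)) * (\<Sum>a\<in>A. inverse (\<mu> a) * \<rho> a $$ (i,j))) * v $ j)"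
      using i vdim \<rho>c[OF Ac] carrier_matD[OF \<rho>c[OF Ac]]
      by (auto simp: P_def msum_def scalar_prod_def atLeast0LessThan intro!: sum.cong)
    also have "\<dots> = inverse (of_nat (card A)) * (\<Sum>j<n. \<Sum>a\<in>A. inverse (\<mu> a) * (\<rho> a $$ (i,j) * v $ j))"
      by (simp add: sum_distrib_left sum_distrib_right mult.assoc)
    also have "(\<Sum>j<n. \<Sum>a\<in>A. inverse (\<mu> a) * (\<rho> a $$ (i,j) * v $ j))
        = (\<Sum>a\<in>A. \<Sum>j<n. inverse (\<mu> a) * (\<rho> a $$ (i,j) * v $ j))" by (rule sum.swap)
    also have "\<dots> = (\<Sum>a\<in>A. v $ i)"
    proof (rule sum.cong[OF refl])
      fix a assume a: "a \<in> A"
      have "(\<Sum>j<n. \<rho> a $$ (i,j) * v $ j) = (\<rho> a *\<^sub>v v) $ i"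
        using \<rho>c[OF Ac[OF a]] i vdim by (auto simp: scalar_prod_def atLeast0LessThan)
      also have "\<dots> = \<mu> a * v $ i" unfolding eig[OF a] using i vdim by simp
      finally have e: "(\<Sum>j<n. \<rho> a $$ (i,j) * v $ j) = \<mu> a * v $ i" .
      have "\<mu> a \<noteq> 0" using \<mu>i[OF a] by auto
      then show "(\<Sum>j<n. inverse (\<mu> a) * (\<rho> a $$ (i,j) * v $ j)) = v $ i"
        unfolding sum_distrib_left[symmetric] e by simp
    qed
    also have "inverse (of_nat (card A)) * \<dots> = v $ i" using card_A by simp
    finally show "v $ i = 0\<^sub>v n $ i" using i by simp
  qed (use vdim in simp)
  then show False using v(2) by simp
qed

text \<open>Orthogonality of projections for different weights. For an \<open>a\<close> that
  separates the weights, inserting \<open>\<rho>\<close> of its conjugate \<open>?b\<close> between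
  the factors multiplies the product by \<open>\<mu> a\<close> from the left and by
  \<open>\<mu> ?b\<close> from the right.\<close>

lemma conj_P_P:
  assumes g: "g \<in> carrier G" and nT: "g \<notin> T"
  shows "\<rho> g * P * \<rho> (inv g) * P = 0\<^sub>m n n"
proof -
  let ?S = "\<rho> g * P * \<rho> (inv g)"
  obtain a where a: "a \<in> A" "\<mu> (g \<otimes> a \<otimes> inv g) \<noteq> \<mu> a" using g nT unfolding T_def by blast
  let ?b = "g \<otimes> a \<otimes> inv g"
  have b: "?b \<in> A" using Aconj[OF g a(1)] .
  note c = \<rho>c[OF g] \<rho>c[OF inv_closed[OF g]] \<rho>c[OF Ac[OF a(1)]] \<rho>c[OF Ac[OF b]] Pc
  have Sc: "?S \<in> carrier_mat n n" using c by (auto intro: sq_closed)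
  have "?S * \<rho> ?b = \<rho> g * (P * \<rho> a) * \<rho> (inv g)"
  proof -
    have ib: "inv g \<otimes> ?b = a \<otimes> inv g" using g Ac[OF a(1)] by (simp add: word_simps)
    have "?S * \<rho> ?b = \<rho> g * P * (\<rho> (inv g) * \<rho> ?b)" by (rule sq_assoc[OF sq_closed[OF c(1) c(5)] c(2) c(4)])
    also have "\<rho> (inv g) * \<rho> ?b = \<rho> a * \<rho> (inv g)"
      using \<rho>m[of "inv g" ?b] \<rho>m[of a "inv g"] g Ac[OF a(1)] Ac[OF b] ib by simp
    finally show ?thesis using c by (simp add: sq_assoc[of _ n] sq_closed[of _ n] del: assoc_mult_mat)
  qed
  also have "P * \<rho> a = \<mu> a \<cdot>\<^sub>m P"
    using T_commutes_P(2)[of a] A_subset_T a(1) \<rho>_P[OF a(1)] by auto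
  finally have 1: "?S * \<rho> ?b = \<mu> a \<cdot>\<^sub>m ?S"
    using c by (simp add: sq_smult[of _ n] sq_closed[of _ n] del: assoc_mult_mat)
  have "?S * (\<rho> ?b * P) = \<mu> ?b \<cdot>\<^sub>m (?S * P)" unfolding \<rho>_P[OF b] by (rule sq_smult(2)[OF Sc Pc])
  moreover have "?S * (\<rho> ?b * P) = \<mu> a \<cdot>\<^sub>m (?S * P)"
    using sq_assoc[OF Sc c(4) Pc] sq_smult(1)[OF Sc Pc, of "\<mu> a"] unfolding 1 by simp
  ultimately have eq: "\<mu> ?b \<cdot>\<^sub>m (?S * P) = \<mu> a \<cdot>\<^sub>m (?S * P)" by simp
  show ?thesis
  proof (rule mat_eqI[of _ n n])
    fix i j assume ij: "i < n" "j < n"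
    have "\<mu> ?b * (?S * P) $$ (i,j) = \<mu> a * (?S * P) $$ (i,j)"
      using arg_cong[OF eq, of "\<lambda>M. M $$ (i,j)"] ij carrier_matD[OF sq_closed[OF Sc Pc]] by simp
    then show "(?S * P) $$ (i,j) = 0\<^sub>m n n $$ (i,j)" using a(2) ij by simp
  qed (use Pc Sc in auto)
qed

text \<open>The \<open>G\<close>-conjugates of \<open>P\<close> sum to a scalar matrix by Schur's lemma; multiplying by \<open>P\<close> identifies
  the scalar as \<open>card T\<close>, and then one takes traces.\<close>
lemma degree_factor:
  obtains t m where "t * card T = card (carrier G)" "n = t * m" "mat_trace P = of_nat m"
proof -
  let ?S = "msum n (\<lambda>g. \<rho> g * P * \<rho> (inv g)) (carrier G)"
  have Fc: "\<rho> g * P * \<rho> (inv g) \<in> carrier_mat n n" if "g \<in> carrier G" for g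
    using that by (intro sq_closed Pc \<rho>c inv_closed)
  have com: "\<rho> h * ?S = ?S * \<rho> h" if h: "h \<in> carrier G" for h
  proof -
    have bij: "bij_betw (\<lambda>g. h \<otimes> g) (carrier G) (carrier G)"
      by (rule bij_betw_byWitness[of _ "\<lambda>g. inv h \<otimes> g"]) (use h in \<open>auto simp: word_simps\<close>)
    have "\<rho> h * ?S = msum n (\<lambda>g. \<rho> h * (\<rho> g * P * \<rho> (inv g))) (carrier G)"
      by (rule mult_msum[OF \<rho>c[OF h] Fc])
    also have "\<dots> = msum n (\<lambda>g. \<rho> (h \<otimes> g) * P * \<rho> (inv (h \<otimes> g)) * \<rho> h) (carrier G)"
    proof (rule msum_cong)
      fix g assume g: "g \<in> carrier G"
      note c = \<rho>c[OF h] \<rho>c[OF g] \<rho>c[OF inv_closed[OF g]] \<rho>c[OF m_closed[OF h g]] Pc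
        \<rho>c[OF inv_closed[OF m_closed[OF h g]]]
      have e: "inv (h \<otimes> g) \<otimes> h = inv g" using g h by (simp add: word_simps)
      have e': "\<rho> (inv (h \<otimes> g)) * \<rho> h = \<rho> (inv g)"
        using \<rho>m[of "inv (h \<otimes> g)" h] g h unfolding e by simp
      have "\<rho> h * (\<rho> g * P * \<rho> (inv g)) = \<rho> h * \<rho> g * P * \<rho> (inv g)"
        using c by (simp add: sq_assoc[of _ n] sq_closed[of _ n] del: assoc_mult_mat)
      also have "\<dots> = \<rho> (h \<otimes> g) * P * (\<rho> (inv (h \<otimes> g)) * \<rho> h)"
        unfolding e' \<rho>m[OF h g] by (rule refl)
      also have "\<dots> = \<rho> (h \<otimes> g) * P * \<rho> (inv (h \<otimes> g)) * \<rho> h"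
        by (rule sq_assoc[OF sq_closed[OF c(4,5)] c(6,1), symmetric])
      finally show "\<rho> h * (\<rho> g * P * \<rho> (inv g)) = \<rho> (h \<otimes> g) * P * \<rho> (inv (h \<otimes> g)) * \<rho> h" .
    qed
    also have "\<dots> = msum n (\<lambda>g. \<rho> g * P * \<rho> (inv g) * \<rho> h) (carrier G)"
      by (rule msum_reindex[OF bij, of n "\<lambda>g. \<rho> g * P * \<rho> (inv g) * \<rho> h"])
    also have "\<dots> = ?S * \<rho> h" by (rule msum_mult[OF \<rho>c[OF h] Fc, symmetric])
    finally show ?thesis .
  qed
  obtain c where c: "?S = c \<cdot>\<^sub>m 1\<^sub>m n" by (rule schur_scalar[OF irr msum_carrier com])
  have "?S * P = msum n (\<lambda>g. \<rho> g * P * \<rho> (inv g) * P) (carrier G)" by (rule msum_mult[OF Pc Fc])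
  also have "\<dots> = msum n (\<lambda>g. if g \<in> T then P else 0\<^sub>m n n) (carrier G)"
    using T_commutes_P(1) P_square conj_P_P by (intro msum_cong) auto
  also have "\<dots> = of_nat (card T) \<cdot>\<^sub>m P"
  proof (rule eq_matI)
    fix i j assume "i < dim_row (of_nat (card T) \<cdot>\<^sub>m P)" "j < dim_col (of_nat (card T) \<cdot>\<^sub>m P)"
    then have ij: "i < n" "j < n" using Pc by auto
    have "(\<Sum>g\<in>carrier G. (if g \<in> T then P else 0\<^sub>m n n) $$ (i,j)) = (\<Sum>g\<in>carrier G. if g \<in> T then P $$ (i,j) else 0)"
      using ij by (intro sum.cong) auto
    also have "\<dots> = (\<Sum>g\<in>T. P $$ (i,j))"
      using fin subgroup.subset[OF T_subgroup] by (intro sum.mono_neutral_cong_right) auto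
    finally show "msum n (\<lambda>g. if g \<in> T then P else 0\<^sub>m n n) (carrier G) $$ (i,j) = (of_nat (card T) \<cdot>\<^sub>m P) $$ (i,j)"
      using ij Pc by (simp add: msum_def)
  qed (use Pc in \<open>auto simp: msum_def\<close>)
  finally have "c \<cdot>\<^sub>m P = of_nat (card T) \<cdot>\<^sub>m P"
    unfolding c using sq_smult(1)[OF one_carrier_mat Pc] Pc by simp
  moreover obtain i j where ij: "i < n" "j < n" "P $$ (i,j) \<noteq> 0"
  proof (rule ccontr)
    assume "\<not> thesis"
    then have "\<And>i j. i < n \<Longrightarrow> j < n \<Longrightarrow> P $$ (i,j) = 0" using that by blast
    then have "P = 0\<^sub>m n n" using Pc by (intro eq_matI) auto
    then show False using P_nonzero by simp
  qed
  ultimately have "(c \<cdot>\<^sub>m P) $$ (i,j) = (of_nat (card T) \<cdot>\<^sub>m P) $$ (i,j)" by simp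
  then have cT: "c = of_nat (card T)" using ij Pc by simp
  obtain m where m: "mat_trace P = of_nat m" using idempotent_mat[OF Pc P_square] by blast
  have "c * of_nat n = mat_trace ?S"
    unfolding c by (simp add: mat_trace_smult[of _ n] mat_trace_one)
  also have "\<dots> = (\<Sum>g\<in>carrier G. mat_trace (\<rho> g * P * \<rho> (inv g)))" by (rule mat_trace_msum[OF Fc])
  also have "\<dots> = (\<Sum>g\<in>carrier G. mat_trace P)"
  proof (rule sum.cong[OF refl])
    fix g assume g: "g \<in> carrier G"
    show "mat_trace (\<rho> g * P * \<rho> (inv g)) = mat_trace P"
      by (rule mat_trace_conj[OF \<rho>c[OF g] Pc \<rho>c[OF inv_closed[OF g]] mrep_inv(2)[OF rep g]])
  qed
  finally have "(of_nat (card T * n) :: complex) = of_nat (card (carrier G) * m)" unfolding cT m by simp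
  then have eq: "card T * n = card (carrier G) * m" by (simp only: of_nat_eq_iff)
  obtain t where t: "t * card T = card (carrier G)"
    using lagrange_finite[OF fin T_subgroup] by (auto simp: Coset.order_def)
  have "card T \<noteq> 0"
    using fin subgroup.one_closed[OF T_subgroup] subgroup.subset[OF T_subgroup]
    by (metis card_0_eq empty_iff finite_subset)
  moreover have "card T * n = card T * (t * m)" using eq unfolding t[symmetric] by (simp add: mult_ac)
  ultimately have "n = t * m" by simp
  then show ?thesis using that[OF t _ m] by blast
qed

lemma K_subset_T: "K \<subseteq> T"
proof -
  obtain t m where t: "t * card T = card (carrier G)" "n = t * m" by (rule degree_factor)
  have "0 < m" using t(2) n0 by (cases m) auto
  then have "t \<le> n" using t(2) by simp
  then show ?thesis using small_index_contains_K[OF T_subgroup t(1)] by blast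
qed

end

lemma (in minimal_rep) weight_exists:
  assumes A: "A \<lhd> G" and abel: "\<And>a b. a \<in> A \<Longrightarrow> b \<in> A \<Longrightarrow> a \<otimes> b = b \<otimes> a"
  obtains \<mu> v where "weight G n \<rho> A \<mu> v"
proof -
  have Ac: "a \<in> carrier G" if "a \<in> A" for a
    using subgroup.mem_carrier[OF normal_imp_subgroup[OF A] that] .
  have "\<exists>v\<in>carrier_vec n. v \<noteq> 0\<^sub>v n \<and> (\<forall>a\<in>A. \<exists>c. \<rho> a *\<^sub>v v = c \<cdot>\<^sub>v v)"
  proof (rule common_eigenvector[OF n0])
    fix a b assume ab: "a \<in> A" "b \<in> A"
    show "\<rho> a * \<rho> b = \<rho> b * \<rho> a"
      using \<rho>m[OF Ac[OF ab(1)] Ac[OF ab(2)]] \<rho>m[OF Ac[OF ab(2)] Ac[OF ab(1)]] abel[OF ab] by simp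
  qed (use \<rho>c Ac in blast)
  then obtain v where v: "v \<in> carrier_vec n" "v \<noteq> 0\<^sub>v n" "\<forall>a\<in>A. \<exists>c. \<rho> a *\<^sub>v v = c \<cdot>\<^sub>v v" by blast
  then obtain \<mu> where "\<forall>a\<in>A. \<rho> a *\<^sub>v v = \<mu> a \<cdot>\<^sub>v v" by metis
  then have "weight G n \<rho> A \<mu> v"
    by (intro weight.intro minimal_rep_axioms weight_axioms.intro) (use A abel v in auto)
  then show ?thesis by (rule that)
qed

lemma (in minimal_rep) abelian_normal_centralized:
  assumes A: "A \<lhd> G" and abel: "\<And>a b. a \<in> A \<Longrightarrow> b \<in> A \<Longrightarrow> a \<otimes> b = b \<otimes> a"
    and k: "k \<in> K" and a: "a \<in> A"
  shows "k \<otimes> a = a \<otimes> k"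
proof -
  obtain \<mu> v where "weight G n \<rho> A \<mu> v" using weight_exists[OF A abel] by blast
  then interpret weight G n \<rho> A \<mu> v .
  \<comment> \<open>This set is closed under conjugation, and \<open>\<mu>\<close> is 1 on it
    because \<open>K\<close> fixes \<open>\<mu>\<close>; so it fixes \<open>v\<close>, and
    \<open>fixing_trivial\<close> applies.\<close>
  define S where "S = {comm k a | k a. k \<in> K \<and> a \<in> A}"
  have Kc: "k \<in> carrier G" if "k \<in> K" for k using that K_carrier by blast
  have Sc: "S \<subseteq> carrier G" unfolding S_def using Kc Ac comm_closed by blast
  have Sconj: "g \<otimes> x \<otimes> inv g \<in> S" if g: "g \<in> carrier G" and x: "x \<in> S" for g x
  proof -
    obtain k a where "k \<in> K" "a \<in> A" "x = comm k a" using x unfolding S_def by blast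
    then show ?thesis
      unfolding S_def using comm_conj[OF g Kc Ac] K_conj[OF _ g] Aconj[OF g] by blast
  qed
  have "\<rho> x *\<^sub>v v = v" if x: "x \<in> S" for x
  proof -
    obtain k a where ka: "k \<in> K" "a \<in> A" "x = comm k a" using x unfolding S_def by blast
    let ?b = "k \<otimes> a \<otimes> inv k"
    have b: "?b \<in> A" using Aconj[OF Kc[OF ka(1)] ka(2)] .
    have "\<mu> ?b = \<mu> a" using ka K_subset_T unfolding T_def by blast
    then have "\<mu> (?b \<otimes> inv a) = 1" using \<mu>m[OF b Ai[OF ka(2)]] \<mu>i[OF ka(2)] by (simp add: mult.commute)
    then show ?thesis
      using eig[OF Am[OF b Ai[OF ka(2)]]] v(1) unfolding ka(3) comm_def by simp
  qed
  then have "comm k a = \<one>"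
    using fixing_trivial[OF Sc Sconj v] k a unfolding S_def by blast
  then show ?thesis using comm_eq_one_iff[OF Kc[OF k] Ac[OF a]] by simp
qed

lemma (in odd_form) coset_representatives:
  obtains q s where "q * card R = card M" "\<And>i. i < q \<Longrightarrow> s i \<in> M"
    "\<And>i j. i < q \<Longrightarrow> j < q \<Longrightarrow> inv (s i) \<otimes> s j \<in> R \<longleftrightarrow> i = j"
proof -
  let ?H = "G\<lparr>carrier := M\<rparr>"
  have H: "group ?H" using subgroup.subgroup_is_group[OF M is_group] .
  have inv: "inv\<^bsub>?H\<^esub> x = inv x" if "x \<in> M" for x by (rule m_inv_consistent[OF M that])
  have "subgroup R ?H"
  proof (rule subgroup.intro)
    show "R \<subseteq> carrier ?H" using RM by auto
    show "\<one>\<^bsub>?H\<^esub> \<in> R" using R1 by simp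
    fix x assume x: "x \<in> R"
    show "inv\<^bsub>?H\<^esub> x \<in> R" unfolding inv[OF RM[OF x]] by (rule R_inv[OF x])
    fix y assume y: "y \<in> R"
    have "\<beta> (x \<otimes> y) z = 1" if "z \<in> M" for z
      using form_add_left[OF RM[OF x] RM[OF y] that] R_left[OF x that] R_left[OF y that] by simp
    then show "x \<otimes>\<^bsub>?H\<^esub> y \<in> R" unfolding R_def using Mm[OF RM[OF x] RM[OF y]] by simp
  qed
  then obtain q s where q: "q * card R = card (carrier ?H)" and s: "\<And>i. i < q \<Longrightarrow> s i \<in> carrier ?H"
    and u: "\<And>g. g \<in> carrier ?H \<Longrightarrow> \<exists>!i. i < q \<and> inv\<^bsub>?H\<^esub> (s i) \<otimes>\<^bsub>?H\<^esub> g \<in> R"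
    using group.left_transversal[OF H, of R] finM by auto
  have sM: "s i \<in> M" if "i < q" for i using s[OF that] by simp
  have main: "inv (s i) \<otimes> s j \<in> R \<longleftrightarrow> i = j" if ij: "i < q" "j < q" for i j
  proof
    have u': "\<exists>!i. i < q \<and> inv\<^bsub>?H\<^esub> (s i) \<otimes> s j \<in> R" using u[of "s j"] sM[OF ij(2)] by simp
    have jj: "inv\<^bsub>?H\<^esub> (s j) \<otimes> s j \<in> R"
      unfolding inv[OF sM[OF ij(2)]] using R1 Mc[OF sM[OF ij(2)]] by simp
    assume "inv (s i) \<otimes> s j \<in> R"
    then have "inv\<^bsub>?H\<^esub> (s i) \<otimes> s j \<in> R" unfolding inv[OF sM[OF ij(1)]] .
    then show "i = j" using u' jj ij by blast
  next
    assume "i = j"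
    then show "inv (s i) \<otimes> s j \<in> R" using R1 Mc[OF sM[OF ij(2)]] by simp
  qed
  show ?thesis by (rule that[OF _ sM main]) (use q in auto)
qed

context group
begin

lemma relative_centralizer_normal:
  assumes L: "L \<lhd> G" and S: "S \<subseteq> carrier G" "\<And>g x. g \<in> carrier G \<Longrightarrow> x \<in> S \<Longrightarrow> g \<otimes> x \<otimes> inv g \<in> S"
  shows "{z \<in> L. \<forall>x\<in>S. x \<otimes> z = z \<otimes> x} \<lhd> G" (is "?C \<lhd> G")
proof -
  note sL = normal_imp_subgroup[OF L]
  have Lc: "z \<in> carrier G" if "z \<in> L" for z using subgroup.mem_carrier[OF sL that] .
  have Sc: "x \<in> carrier G" if "x \<in> S" for x using S(1) that by blast
  have "subgroup ?C G"
  proof (rule subgroup.intro)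
    show "?C \<subseteq> carrier G" using Lc by blast
    show "\<one> \<in> ?C" using subgroup.one_closed[OF sL] Sc by simp
  next
    fix y z assume yz: "y \<in> ?C" "z \<in> ?C"
    have "x \<otimes> (y \<otimes> z) = y \<otimes> z \<otimes> x" if x: "x \<in> S" for x
    proof -
      have c: "x \<in> carrier G" "y \<in> carrier G" "z \<in> carrier G" using yz Lc Sc[OF x] by auto
      have "x \<otimes> (y \<otimes> z) = (x \<otimes> y) \<otimes> z" using c by (simp add: m_assoc)
      also have "\<dots> = y \<otimes> (x \<otimes> z)" using yz x c by (simp add: m_assoc)
      also have "\<dots> = y \<otimes> z \<otimes> x" using yz x c by (simp add: m_assoc)
      finally show ?thesis .
    qed
    then show "y \<otimes> z \<in> ?C" using yz subgroup.m_closed[OF sL] by simp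
  next
    fix z assume z: "z \<in> ?C"
    have "x \<otimes> inv z = inv z \<otimes> x" if x: "x \<in> S" for x
    proof -
      have c: "x \<in> carrier G" "z \<in> carrier G" using z Lc Sc[OF x] by auto
      have "inv z \<otimes> (x \<otimes> z) \<otimes> inv z = inv z \<otimes> (z \<otimes> x) \<otimes> inv z" using z x by simp
      then show ?thesis using c by (simp add: word_simps)
    qed
    then show "inv z \<in> ?C" using z subgroup.m_inv_closed[OF sL] by simp
  qed
  moreover have "g \<otimes> z \<otimes> inv g \<in> ?C" if g: "g \<in> carrier G" and z: "z \<in> ?C" for g z
  proof -
    have "x \<otimes> (g \<otimes> z \<otimes> inv g) = g \<otimes> z \<otimes> inv g \<otimes> x" if x: "x \<in> S" for x
    proof -
      let ?y = "inv g \<otimes> x \<otimes> inv (inv g)"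
      have c: "x \<in> carrier G" "z \<in> carrier G" using z Lc Sc[OF x] by auto
      have "?y \<in> S" by (rule S(2)[OF inv_closed[OF g] x])
      then have "?y \<otimes> z = z \<otimes> ?y" using z by simp
      then have "g \<otimes> (?y \<otimes> z) \<otimes> inv g = g \<otimes> (z \<otimes> ?y) \<otimes> inv g" by simp
      then show ?thesis using c g by (simp add: word_simps)
    qed
    then show ?thesis using z normal.inv_op_closed2[OF L g] by simp
  qed
  ultimately show ?thesis unfolding normal_inv_iff by blast
qed

end

section \<open>The derived subgroup has class at most two\<close>

context minimal_rep
begin

definition Z where "Z = {z \<in> K. \<forall>k\<in>K. k \<otimes> z = z \<otimes> k}"

lemma Kc: "k \<in> K \<Longrightarrow> k \<in> carrier G" using K_carrier by blast

lemma K_subgroup: "subgroup K G" using normal_imp_subgroup[OF derived_self_is_normal] .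

lemma Z_normal: "Z \<lhd> G"
  unfolding Z_def by (rule relative_centralizer_normal[OF derived_self_is_normal K_carrier K_conj])

lemma ZK: "z \<in> Z \<Longrightarrow> z \<in> K" and Z_commute: "z \<in> Z \<Longrightarrow> k \<in> K \<Longrightarrow> k \<otimes> z = z \<otimes> k"
  by (auto simp: Z_def)

lemma abelian_normal_in_Z:
  assumes A: "A \<lhd> G" "A \<subseteq> K" and abel: "\<And>a b. a \<in> A \<Longrightarrow> b \<in> A \<Longrightarrow> a \<otimes> b = b \<otimes> a"
  shows "A \<subseteq> Z"
  using abelian_normal_centralized[OF A(1) abel] A(2) unfolding Z_def by blast

lemma class_two_section_central:
  assumes oddn: "odd n" and MG: "M \<lhd> G" and MK: "M \<subseteq> K"
    and MM: "\<And>x y. x \<in> M \<Longrightarrow> y \<in> M \<Longrightarrow> comm x y \<in> Z"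
    and k0: "k0 \<in> K" and x0: "x0 \<in> M"
  shows "comm k0 x0 \<in> Z"
proof -
  obtain \<mu> v where "weight G n \<rho> Z \<mu> v"
    by (rule weight_exists[OF Z_normal]) (use Z_commute ZK in blast)
  then interpret weight G n \<rho> Z \<mu> v .
  obtain t m where t: "t * card T = card (carrier G)" "n = t * m" and trP: "mat_trace P = of_nat m"
    by (rule degree_factor)
  have m: "odd m" "0 < m" using oddn t(2) by (auto simp: odd_pos)
  note Msub = normal_imp_subgroup[OF MG]
  have Mc: "x \<in> carrier G" if "x \<in> M" for x using subgroup.mem_carrier[OF Msub that] .
  have MT: "x \<in> T" if "x \<in> M" for x using that MK K_subset_T by blast
  have Mi: "inv x \<in> M" if "x \<in> M" for x using subgroup.m_inv_closed[OF Msub that] .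
  have Mm: "x \<otimes> y \<in> M" if "x \<in> M" "y \<in> M" for x y using subgroup.m_closed[OF Msub that] .
  have Mconj: "g \<otimes> x \<otimes> inv g \<in> M" if "g \<in> carrier G" "x \<in> M" for g x
    using normal.inv_op_closed2[OF MG that] .
  have commM: "comm k x \<in> M" if "k \<in> K" "x \<in> M" for k x
    unfolding comm_def using Mm[OF Mconj[OF Kc[OF that(1)] that(2)] Mi[OF that(2)]] .
  define \<beta> where "\<beta> x y = \<mu> (comm x y)" for x y
  \<comment> \<open>The determinant on the weight space. It is multiplicative on \<open>M\<close>,
    since \<open>M \<subseteq> K \<subseteq> T\<close> commutes with \<open>P\<close>, and so it is
    1 on commutators; a commutator acts there as a scalar, whose \<open>m\<close>-th power is
    therefore 1.\<close>
  define D where "D w = det (P * w + (1\<^sub>m n - P))" for w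
  have Dm: "D (\<rho> (x \<otimes> y)) = D (\<rho> x) * D (\<rho> y)" if "x \<in> M" "y \<in> M" for x y
    unfolding D_def \<rho>m[OF Mc[OF that(1)] Mc[OF that(2)]]
    by (rule det_on_idempotent_mult[OF Pc P_square \<rho>c[OF Mc[OF that(1)]]
          T_commutes_P(2)[OF MT[OF that(1)], symmetric] \<rho>c[OF Mc[OF that(2)]]])
  have D1: "D (\<rho> \<one>) = 1"
  proof -
    have "P * 1\<^sub>m n + (1\<^sub>m n - P) = 1\<^sub>m n" using Pc by (auto intro!: eq_matI)
    then show ?thesis unfolding D_def \<rho>1 by simp
  qed
  have Di: "D (\<rho> x) * D (\<rho> (inv x)) = 1" if "x \<in> M" for x
    using Dm[OF that Mi[OF that]] D1 Mc[OF that] by simp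
  have root: "\<beta> x y ^ m = 1" if xy: "x \<in> M" "y \<in> M" for x y
  proof -
    have cz: "comm x y \<in> Z" using MM[OF xy] .
    obtain a where a: "mat_trace P = of_nat a" "\<And>c. det (c \<cdot>\<^sub>m P + (1\<^sub>m n - P)) = c ^ a"
      using idempotent_mat[OF Pc P_square] by blast
    have "(of_nat a :: complex) = of_nat m" using a(1) trP by simp
    then have am: "a = m" by (simp only: of_nat_eq_iff)
    have "P * \<rho> (comm x y) = \<mu> (comm x y) \<cdot>\<^sub>m P"
      using T_commutes_P(2)[of "comm x y"] A_subset_T cz \<rho>_P[OF cz] by auto
    then have "\<beta> x y ^ m = D (\<rho> (comm x y))" by (simp only: D_def \<beta>_def a(2) am)
    also have "\<dots> = D (\<rho> x) * D (\<rho> y) * D (\<rho> (inv x)) * D (\<rho> (inv y))"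
      unfolding comm_def using Dm xy Mm Mi by simp
    also have "\<dots> = (D (\<rho> x) * D (\<rho> (inv x))) * (D (\<rho> y) * D (\<rho> (inv y)))" by (simp only: mult_ac)
    finally show ?thesis using Di xy by simp
  qed
  interpret F: odd_form G M \<beta> m
  proof (intro odd_form.intro odd_form_axioms.intro group_axioms)
    show "subgroup M G" by (rule Msub)
    show "finite M" using fin subgroup.subset[OF Msub] finite_subset by blast
    show "odd m" by (rule m(1))
    show "\<beta> x y ^ m = 1" if "x \<in> M" "y \<in> M" for x y by (rule root[OF that])
    show "\<beta> x y * \<beta> y x = 1" if "x \<in> M" "y \<in> M" for x y
      using \<mu>i[OF MM[OF that]] comm_inv[OF Mc[OF that(1)] Mc[OF that(2)]]
      unfolding \<beta>_def by (simp add: mult.commute)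
    show "\<beta> (x \<otimes> y) z = \<beta> x z * \<beta> y z" if xyz: "x \<in> M" "y \<in> M" "z \<in> M" for x y z
    proof -
      note c = Mc[OF xyz(1)] Mc[OF xyz(2)] Mc[OF xyz(3)]
      note cc = MM[OF xyz(2,3)]
      have "comm (x \<otimes> y) z = (x \<otimes> comm y z) \<otimes> (z \<otimes> inv x \<otimes> inv z)"
        using c by (simp add: comm_def word_simps)
      also have "x \<otimes> comm y z = comm y z \<otimes> x" using Z_commute[OF cc] MK xyz(1) by blast
      also have "comm y z \<otimes> x \<otimes> (z \<otimes> inv x \<otimes> inv z) = comm y z \<otimes> comm x z"
        using c comm_closed[OF c(2,3)] by (simp add: comm_def m_assoc)
      finally show ?thesis unfolding \<beta>_def using \<mu>m[OF cc MM[OF xyz(1,3)]] by (simp add: mult.commute)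
    qed
  qed
  \<comment> \<open>The argument of \<open>heis_trace\<close> on the weight space; here conjugation
    by \<open>y\<close> produces \<open>\<beta> y z\<close> itself and not its square.\<close>
  have trace0: "mat_trace (\<rho> z * P) = 0" if z: "z \<in> M" "z \<notin> F.R" for z
  proof -
    obtain y where y: "y \<in> M" "\<beta> z y \<noteq> 1" using z unfolding F.R_def by blast
    have y1: "\<beta> y z \<noteq> 1" using F.form_swap[OF z(1) y(1)] y(2) by auto
    note c = \<rho>c[OF Mc[OF y(1)]] \<rho>c[OF Mc[OF z(1)]] \<rho>c[OF Mc[OF Mi[OF y(1)]]] Pc
    let ?c = "comm y z"
    have cz: "?c \<in> Z" using MM[OF y(1) z(1)] .
    have e: "y \<otimes> z \<otimes> inv y = z \<otimes> ?c"
    proof -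
      have "z \<otimes> ?c = ?c \<otimes> z" using Z_commute[OF cz] MK z(1) by blast
      then show ?thesis using Mc[OF y(1)] Mc[OF z(1)] by (simp add: comm_def word_simps)
    qed
    have "mat_trace (\<rho> z * P) = mat_trace (\<rho> y * (\<rho> z * P) * \<rho> (inv y))"
      using mat_trace_conj[OF c(1) sq_closed[OF c(2,4)] c(3)] mrep_inv(2)[OF rep Mc[OF y(1)]] by simp
    also have "\<rho> y * (\<rho> z * P) * \<rho> (inv y) = \<rho> y * \<rho> z * (P * \<rho> (inv y))"
      using c by (simp add: sq_assoc[of _ n] sq_closed[of _ n] del: assoc_mult_mat)
    also have "\<dots> = \<rho> y * \<rho> z * \<rho> (inv y) * P"
      unfolding T_commutes_P(2)[OF MT[OF Mi[OF y(1)]], symmetric]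
      by (rule sq_assoc[OF sq_closed[OF c(1,2)] c(3,4), symmetric])
    also have "\<rho> y * \<rho> z * \<rho> (inv y) = \<rho> z * \<rho> ?c"
      using \<rho>m Mc y(1) z(1) Mi e Ac[OF cz] by (metis Mm)
    also have "\<rho> z * \<rho> ?c * P = \<beta> y z \<cdot>\<^sub>m (\<rho> z * P)"
      unfolding sq_assoc[OF c(2) \<rho>c[OF Ac[OF cz]] c(4)] \<rho>_P[OF cz] \<beta>_def by (rule sq_smult(2)[OF c(2,4)])
    finally have "mat_trace (\<rho> z * P) = \<beta> y z * mat_trace (\<rho> z * P)"
      by (simp add: mat_trace_smult[OF sq_closed[OF c(2,4)]])
    then have "(\<beta> y z - 1) * mat_trace (\<rho> z * P) = 0" by (simp add: algebra_simps)
    then show ?thesis using y1 by simp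
  qed
  obtain e W J where e0: "0 < e" and ee: "e * e * card F.R = card M" and W: "mrep (G\<lparr>carrier := T\<rparr>) e W"
    and J: "J \<in> carrier_mat e e" "\<forall>g\<in>T. W g * J = J * W g" "1 < e \<longrightarrow> (\<forall>c. J \<noteq> c \<cdot>\<^sub>m 1\<^sub>m e)"
    and ker: "\<forall>g\<in>T. W g = 1\<^sub>m e \<longrightarrow> (\<forall>x\<in>M. g \<otimes> x \<otimes> inv g \<otimes> inv x \<in> F.R)"
  proof (rule F.weil_representation[OF T_subgroup])
    fix g x assume "g \<in> T" "x \<in> M"
    then show "g \<otimes> x \<otimes> inv g \<in> M" using Mconj by (simp add: T_def)
  next
    fix g x y assume g: "g \<in> T" and xy: "x \<in> M" "y \<in> M"
    have gc: "g \<in> carrier G" using g by (simp add: T_def)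
    show "\<beta> (g \<otimes> x \<otimes> inv g) (g \<otimes> y \<otimes> inv g) = \<beta> x y"
      unfolding \<beta>_def comm_conj[OF gc Mc[OF xy(1)] Mc[OF xy(2)], symmetric]
      using g MM[OF xy] by (simp add: T_def)
  qed
  have em: "e \<le> m"
  proof -
    obtain q s where q: "q * card F.R = card M" and s: "\<And>i. i < q \<Longrightarrow> s i \<in> M"
      and su: "\<And>i j. i < q \<Longrightarrow> j < q \<Longrightarrow> inv (s i) \<otimes> s j \<in> F.R \<longleftrightarrow> i = j"
      using F.coset_representatives by blast
    have "q = e * e" using q ee F.cardR by (metis mult_right_cancel less_not_refl)
    \<comment> \<open>The families \<open>A\<close> and \<open>B\<close> are dual under the trace:
      distinct representatives give an element outside \<open>R\<close>, where \<open>trace0\<close>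
      applies, and the factor \<open>inverse (of_nat m)\<close> offsets the trace \<open>m\<close>
      of \<open>P\<close>.\<close>
    define A where "A i = inverse (of_nat m) \<cdot>\<^sub>m (\<rho> (s i) * P)" for i
    define B where "B i = \<rho> (inv (s i)) * P" for i
    have PgP: "P * (\<rho> g * P) = \<rho> g * P" "\<rho> g * P * P = \<rho> g * P" if "g \<in> M" for g
    proof -
      note gc = \<rho>c[OF Mc[OF that]]
      show 1: "\<rho> g * P * P = \<rho> g * P" unfolding sq_assoc[OF gc Pc Pc] P_square ..
      have "P * (\<rho> g * P) = P * \<rho> g * P" by (rule sq_assoc[OF Pc gc Pc, symmetric])
      then show "P * (\<rho> g * P) = \<rho> g * P" unfolding T_commutes_P(2)[OF MT[OF that], symmetric] 1 .
    qed
    have "q \<le> m * m"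
    proof (rule dual_family_bound[OF Pc P_square trP, of q A B])
      fix i assume i: "i < q"
      note c = \<rho>c[OF Mc[OF s[OF i]]] \<rho>c[OF Mc[OF Mi[OF s[OF i]]]]
      show "A i \<in> carrier_mat n n" "B i \<in> carrier_mat n n"
        unfolding A_def B_def using c Pc by (auto intro: sq_closed)
      show "P * A i = A i" "A i * P = A i"
        unfolding A_def sq_smult[OF Pc sq_closed[OF c(1) Pc]] sq_smult[OF sq_closed[OF c(1) Pc] Pc]
          PgP[OF s[OF i]] by (rule refl)+
      show "P * B i = B i" "B i * P = B i"
        unfolding B_def by (rule PgP[OF Mi[OF s[OF i]]])+
    next
      fix i j assume ij: "i < q" "j < q"
      let ?z = "inv (s i) \<otimes> s j"
      have z: "?z \<in> M" using Mm[OF Mi[OF s[OF ij(1)]] s[OF ij(2)]] .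
      note c = \<rho>c[OF Mc[OF Mi[OF s[OF ij(1)]]]] \<rho>c[OF Mc[OF s[OF ij(2)]]]
      have "B i * A j = inverse (of_nat m) \<cdot>\<^sub>m (\<rho> (inv (s i)) * P * (\<rho> (s j) * P))"
        unfolding A_def B_def by (rule sq_smult(2)[OF sq_closed[OF c(1) Pc] sq_closed[OF c(2) Pc]])
      also have "\<rho> (inv (s i)) * P * (\<rho> (s j) * P) = \<rho> (inv (s i)) * (P * (\<rho> (s j) * P))"
        by (rule sq_assoc[OF c(1) Pc sq_closed[OF c(2) Pc]])
      also have "\<dots> = \<rho> (inv (s i)) * \<rho> (s j) * P"
        unfolding PgP[OF s[OF ij(2)]] by (rule sq_assoc[OF c Pc, symmetric])
      also have "\<dots> = \<rho> ?z * P" using \<rho>m[OF Mc[OF Mi[OF s[OF ij(1)]]] Mc[OF s[OF ij(2)]]] by simp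
      finally have tr: "mat_trace (B i * A j) = inverse (of_nat m) * mat_trace (\<rho> ?z * P)"
        using mat_trace_smult[OF sq_closed[OF \<rho>c[OF Mc[OF z]] Pc]] by simp
      show "mat_trace (B i * A j) = (if i = j then 1 else 0)"
      proof (cases "i = j")
        case True
        then have "?z = \<one>" using Mc[OF s[OF ij(2)]] by simp
        then show ?thesis using tr True \<rho>1 Pc trP m(2) by simp
      next
        case False
        then show ?thesis using tr trace0[OF z] su[OF ij] by simp
      qed
    qed
    then have "e\<^sup>2 \<le> m\<^sup>2" using \<open>q = e * e\<close> by (simp add: power2_eq_square)
    then show ?thesis by (rule power2_le_imp_le) simp
  qed
  \<comment> \<open>For \<open>e > 1\<close> the Weil representation is reducible and
    \<open>K\<close> acts trivially on it. For \<open>e = 1\<close> the radical is all of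
    \<open>M\<close>, and the claim is empty.\<close>
  have cR: "comm k x \<in> F.R" if k: "k \<in> K" and x: "x \<in> M" for k x
  proof (cases "1 < e")
    case True
    have "t * e \<le> n" unfolding t(2) using em by simp
    then have "W k = 1\<^sub>m e"
      using subgroup_mrep_trivial(2)[OF T_subgroup t(1) W e0 _ J(1) _ _ k] J(2,3) True by blast
    then show ?thesis using ker k x K_subset_T unfolding comm_def by blast
  next
    case False
    then have "e = 1" using e0 by simp
    then have "card F.R = card M" using ee by simp
    then have "F.R = M" using F.finM F.RM by (intro card_subset_eq) auto
    then show ?thesis using commM[OF k x] by simp
  qed
  \<comment> \<open>The weight \<open>\<mu>\<close> is 1 on these double commutators by
    \<open>cR\<close>, and they are permuted by conjugation; so they are all trivial and
    \<open>comm k x\<close> centralizes \<open>M\<close>.\<close>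
  define S where "S = {comm (comm k x) y | k x y. k \<in> K \<and> x \<in> M \<and> y \<in> M}"
  have Sc: "S \<subseteq> carrier G" unfolding S_def using comm_closed Mc commM by blast
  have Sconj: "g \<otimes> u \<otimes> inv g \<in> S" if g: "g \<in> carrier G" and u: "u \<in> S" for g u
  proof -
    obtain k x y where kxy: "k \<in> K" "x \<in> M" "y \<in> M" "u = comm (comm k x) y" using u unfolding S_def by blast
    have "g \<otimes> u \<otimes> inv g = comm (comm (g \<otimes> k \<otimes> inv g) (g \<otimes> x \<otimes> inv g)) (g \<otimes> y \<otimes> inv g)"
      unfolding kxy(4) using comm_conj[OF g Mc[OF commM[OF kxy(1,2)]] Mc[OF kxy(3)]]
        comm_conj[OF g Kc[OF kxy(1)] Mc[OF kxy(2)]] by simp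
    then show ?thesis unfolding S_def using K_conj[OF kxy(1) g] Mconj[OF g] kxy by blast
  qed
  have "\<rho> u *\<^sub>v v = v" if u: "u \<in> S" for u
  proof -
    obtain k x y where kxy: "k \<in> K" "x \<in> M" "y \<in> M" "u = comm (comm k x) y" using u unfolding S_def by blast
    have "\<mu> u = 1" using F.R_left[OF cR[OF kxy(1,2)] kxy(3)] unfolding \<beta>_def kxy(4) .
    then show ?thesis using eig[of u] MM[OF commM[OF kxy(1,2)] kxy(3)] v(1) unfolding kxy(4) by simp
  qed
  then have one: "comm (comm k x) y = \<one>" if "k \<in> K" "x \<in> M" "y \<in> M" for k x y
    using fixing_trivial[OF Sc Sconj v] that unfolding S_def by blast
  \<comment> \<open>The centre of \<open>M\<close> is abelian and normal in \<open>G\<close>, hence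
    contained in \<open>Z\<close>; it remains to see that \<open>comm k0 x0\<close> lies in
    it.\<close>
  let ?ZM = "{z \<in> M. \<forall>x\<in>M. x \<otimes> z = z \<otimes> x}"
  have "?ZM \<subseteq> Z"
  proof (rule abelian_normal_in_Z)
    show "?ZM \<lhd> G"
      by (rule relative_centralizer_normal[OF MG subgroup.subset[OF Msub] Mconj])
    show "?ZM \<subseteq> K" using MK by blast
    show "a \<otimes> b = b \<otimes> a" if "a \<in> ?ZM" "b \<in> ?ZM" for a b using that by blast
  qed
  moreover have "comm k0 x0 \<in> ?ZM"
  proof (intro CollectI conjI ballI)
    show kx: "comm k0 x0 \<in> M" by (rule commM[OF k0 x0])
    fix y assume y: "y \<in> M"
    show "y \<otimes> comm k0 x0 = comm k0 x0 \<otimes> y"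
      using one[OF k0 x0 y] comm_eq_one_iff[OF Mc[OF kx] Mc[OF y]] by metis
  qed
  ultimately show ?thesis by blast
qed

lemma derived_comm:
  assumes "x \<in> H" "y \<in> H" shows "comm x y \<in> derived G H"
  unfolding derived_def comm_def by (rule generate.incl) (use assms in blast)

text \<open>The subgroup \<open>C\<close> below is the centralizer in \<open>K\<close> of the second centre of \<open>K\<close>. If it were not
  central, the last term of its derived series outside \<open>Z\<close> would lie in the second centre, hence be
  abelian, hence be central.\<close>
lemma comm_K_central:
  assumes oddn: "odd n" and solv: "solvable G" and kl: "k \<in> K" "l \<in> K"
  shows "comm k l \<in> Z"
proof -
  define Z2 where "Z2 = {x \<in> K. \<forall>k\<in>K. comm k x \<in> Z}"
  define C where "C = {c \<in> K. \<forall>x\<in>Z2. x \<otimes> c = c \<otimes> x}"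
  have Z2c: "Z2 \<subseteq> carrier G" unfolding Z2_def using Kc by blast
  have Z2conj: "g \<otimes> x \<otimes> inv g \<in> Z2" if g: "g \<in> carrier G" and x: "x \<in> Z2" for g x
  proof -
    have xK: "x \<in> K" using x by (simp add: Z2_def)
    have "comm k (g \<otimes> x \<otimes> inv g) \<in> Z" if k: "k \<in> K" for k
    proof -
      let ?l = "inv g \<otimes> k \<otimes> inv (inv g)"
      have l: "?l \<in> K" using K_conj[OF k inv_closed[OF g]] .
      have "g \<otimes> ?l \<otimes> inv g = k" using g Kc[OF k] by (simp add: word_simps)
      then have "comm k (g \<otimes> x \<otimes> inv g) = g \<otimes> comm ?l x \<otimes> inv g"
        using comm_conj[OF g Kc[OF l] Kc[OF xK]] by simp
      moreover have "comm ?l x \<in> Z" using x l by (simp add: Z2_def)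
      ultimately show ?thesis using normal.inv_op_closed2[OF Z_normal g] by simp
    qed
    then show ?thesis using K_conj[OF xK g] by (simp add: Z2_def)
  qed
  have CG: "C \<lhd> G" unfolding C_def by (rule relative_centralizer_normal[OF derived_self_is_normal Z2c Z2conj])
  note Csub = normal_imp_subgroup[OF CG]
  have CK: "C \<subseteq> K" by (auto simp: C_def)
  have CZ: "C \<subseteq> Z"
  proof (rule ccontr)
    assume nCZ: "\<not> C \<subseteq> Z"
    define D where "D i = (derived G ^^ i) C" for i
    have D0: "D 0 = C" and DS: "D (Suc i) = derived G (D i)" for i by (auto simp: D_def)
    have DG: "D i \<lhd> G" for i by (induction i) (use CG D0 DS derived_is_normal in auto)
    have DC: "D i \<subseteq> C" for i
    proof (induction i)
      case (Suc i)
      show ?case unfolding DS by (rule derived_incl[OF Suc Csub])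
    qed (simp add: D0)
    obtain N where N: "D N = {\<one>}"
      using solvable_imp_trivial_derived_seq[OF solvable_subgroup[OF Csub solv]] unfolding D_def by blast
    have "D N \<subseteq> Z" unfolding N using subgroup.one_closed[OF normal_imp_subgroup[OF Z_normal]] by simp
    \<comment> \<open>Here the derived series of \<open>C\<close> enters \<open>Z\<close>: the
      commutators within \<open>D i\<close> lie in \<open>Z\<close>, which is the hypothesis of
      \<open>class_two_section_central\<close>.\<close>
    then obtain i where i: "\<not> D i \<subseteq> Z" "D (Suc i) \<subseteq> Z"
      using nCZ D0 by (induction N) auto
    have DK: "D i \<subseteq> K" using DC CK by blast
    have "comm x y \<in> Z" if "x \<in> D i" "y \<in> D i" for x y
      using derived_comm[OF that] i(2) unfolding DS by blast
    then have "comm k x \<in> Z" if "k \<in> K" "x \<in> D i" for k x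
      using class_two_section_central[OF oddn DG DK] that by blast
    then have DZ2: "D i \<subseteq> Z2" using DK unfolding Z2_def by blast
    have "x \<otimes> y = y \<otimes> x" if "x \<in> D i" "y \<in> D i" for x y
      using that DZ2 DC[of i] unfolding C_def by blast
    then have "D i \<subseteq> Z" using abelian_normal_in_Z[OF DG DK] by blast
    then show False using i(1) by simp
  qed
  \<comment> \<open>Commutators of \<open>K\<close> centralize its second centre: moving
    \<open>x\<close> past \<open>k\<close> or \<open>l\<close> costs a central factor, so moving it
    past \<open>k \<otimes> l\<close> and past \<open>l \<otimes> k\<close> costs the same factor
    \<open>z2 \<otimes> z1\<close>, which cancels in the quotient.\<close>
  have "x \<otimes> comm k l = comm k l \<otimes> x" if x: "x \<in> Z2" for x
  proof -
    have xK: "x \<in> K" using x by (simp add: Z2_def)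
    define z1 where "z1 = comm k x"
    define z2 where "z2 = comm l x"
    have z: "z1 \<in> Z" "z2 \<in> Z" using x kl by (auto simp: Z2_def z1_def z2_def)
    note c = Kc[OF kl(1)] Kc[OF kl(2)] Kc[OF xK] Kc[OF ZK[OF z(1)]] Kc[OF ZK[OF z(2)]]
    have kx: "k \<otimes> x = z1 \<otimes> (x \<otimes> k)" unfolding z1_def comm_def using c by (simp add: word_simps)
    have lx: "l \<otimes> x = z2 \<otimes> (x \<otimes> l)" unfolding z2_def comm_def using c by (simp add: word_simps)
    have z12: "z1 \<otimes> z2 = z2 \<otimes> z1" using Z_commute[OF z(2) ZK[OF z(1)]] .
    have "k \<otimes> l \<otimes> x = (k \<otimes> z2) \<otimes> (x \<otimes> l)" using c lx by (simp add: m_assoc)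
    also have "\<dots> = z2 \<otimes> (k \<otimes> x) \<otimes> l" unfolding Z_commute[OF z(2) kl(1)] using c by (simp add: m_assoc)
    also have "\<dots> = z2 \<otimes> z1 \<otimes> x \<otimes> (k \<otimes> l)" unfolding kx using c by (simp add: m_assoc)
    finally have 1: "k \<otimes> l \<otimes> x = z2 \<otimes> z1 \<otimes> x \<otimes> (k \<otimes> l)" .
    have "l \<otimes> k \<otimes> x = (l \<otimes> z1) \<otimes> (x \<otimes> k)" using c kx by (simp add: m_assoc)
    also have "\<dots> = z1 \<otimes> (l \<otimes> x) \<otimes> k" unfolding Z_commute[OF z(1) kl(2)] using c by (simp add: m_assoc)
    also have "\<dots> = z1 \<otimes> z2 \<otimes> x \<otimes> (l \<otimes> k)" unfolding lx using c by (simp add: m_assoc)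
    finally have 2: "l \<otimes> k \<otimes> x = z2 \<otimes> z1 \<otimes> x \<otimes> (l \<otimes> k)" unfolding z12 .
    let ?w = "z2 \<otimes> z1" and ?a = "k \<otimes> l" and ?b = "l \<otimes> k"
    have ca: "?w \<in> carrier G" "?a \<in> carrier G" "?b \<in> carrier G" using c by auto
    have "?w \<in> Z" using subgroup.m_closed[OF normal_imp_subgroup[OF Z_normal]] z by blast
    have aK: "?a \<otimes> inv ?b \<in> K"
      using kl subgroup.m_closed[OF K_subgroup] subgroup.m_inv_closed[OF K_subgroup] by blast
    have cab: "comm k l = ?a \<otimes> inv ?b" using c by (simp add: comm_def word_simps)
    have bx: "inv ?b \<otimes> ?w \<otimes> x = x \<otimes> inv ?b"
    proof -
      have "inv ?b \<otimes> ?w \<otimes> x = inv ?b \<otimes> (?w \<otimes> x \<otimes> ?b) \<otimes> inv ?b"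
        using ca c(3) by (simp add: m_assoc del: inv_mult_group)
      also have "\<dots> = inv ?b \<otimes> (?b \<otimes> x) \<otimes> inv ?b" unfolding 2 ..
      also have "\<dots> = x \<otimes> inv ?b" using ca c(3) cancel_inv_left[OF ca(3) c(3)] by simp
      finally show ?thesis .
    qed
    have "?w \<otimes> (comm k l \<otimes> x) = (?w \<otimes> (?a \<otimes> inv ?b)) \<otimes> x"
      unfolding cab using ca c(3) by (simp add: m_assoc)
    also have "\<dots> = ?a \<otimes> inv ?b \<otimes> ?w \<otimes> x" unfolding Z_commute[OF \<open>?w \<in> Z\<close> aK] ..
    also have "\<dots> = ?a \<otimes> (inv ?b \<otimes> ?w \<otimes> x)" using ca c(3) by (simp add: m_assoc)
    also have "\<dots> = (?a \<otimes> x) \<otimes> inv ?b" unfolding bx using ca c(3) by (simp add: m_assoc)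
    also have "\<dots> = ?w \<otimes> (x \<otimes> comm k l)" unfolding 1 cab using ca c(3) by (simp add: m_assoc)
    finally show ?thesis using ca c comm_closed[OF c(1,2)] by simp
  qed
  moreover have "comm k l \<in> K"
    using kl derived_comm[of k "carrier G" l] Kc by blast
  ultimately have "comm k l \<in> C" by (simp add: C_def)
  then show ?thesis using CZ by blast
qed

text \<open>The series starts with \<open>K\<close> at index 0, so \<open>comm_K_central\<close>
  puts the term of index 1 inside the centre \<open>Z\<close> and the term of index 2 is
  trivial.\<close>

lemma derived_subgroup_nilpotent:
  assumes "odd n" "solvable G"
  shows "nilpotent (G\<lparr>carrier := K\<rparr>)"
proof -
  let ?H = "G\<lparr>carrier := K\<rparr>"
  have H: "group ?H" using subgroup.subgroup_is_group[OF K_subgroup is_group] .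
  have inv: "inv\<^bsub>?H\<^esub> x = inv x" if "x \<in> K" for x by (rule m_inv_consistent[OF K_subgroup that])
  have ZH: "subgroup Z ?H"
    by (rule subgroup.intro) (use normal_imp_subgroup[OF Z_normal] ZK inv in
      \<open>auto intro: subgroup.m_closed subgroup.one_closed subgroup.m_inv_closed\<close>)
  have "lower_central ?H (Suc 0) \<subseteq> Z"
    unfolding lower_central.simps
    by (rule group.generate_subgroup_incl[OF H _ ZH])
      (use comm_K_central[OF assms] inv in \<open>auto simp: comm_def\<close>)
  then have sub: "(\<Union>x\<in>lower_central ?H (Suc 0). \<Union>y\<in>carrier ?H.
      {x \<otimes>\<^bsub>?H\<^esub> y \<otimes>\<^bsub>?H\<^esub> inv\<^bsub>?H\<^esub> x \<otimes>\<^bsub>?H\<^esub> inv\<^bsub>?H\<^esub> y}) \<subseteq> {\<one>\<^bsub>?H\<^esub>}"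
  proof -
    have "x \<otimes> y \<otimes> inv\<^bsub>?H\<^esub> x \<otimes> inv\<^bsub>?H\<^esub> y = \<one>" if x: "x \<in> Z" and y: "y \<in> K" for x y
      using comm_eq_one_iff[OF Kc[OF ZK[OF x]] Kc[OF y]] Z_commute[OF x y] inv[OF ZK[OF x]] inv[OF y]
      by (simp add: comm_def)
    then show ?thesis using \<open>lower_central ?H (Suc 0) \<subseteq> Z\<close> by auto
  qed
  have "lower_central ?H (Suc (Suc 0)) \<subseteq> {\<one>\<^bsub>?H\<^esub>}"
    unfolding lower_central.simps(2)[of _ "Suc 0"]
    by (rule group.generate_subgroup_incl[OF H sub group.triv_subgroup[OF H]])
  moreover have "\<one>\<^bsub>?H\<^esub> \<in> lower_central ?H (Suc (Suc 0))"
    unfolding lower_central.simps(2)[of _ "Suc 0"] by (rule generate.one)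
  ultimately have "lower_central ?H (Suc (Suc 0)) = {\<one>\<^bsub>?H\<^esub>}" by blast
  then show ?thesis unfolding nilpotent_def using H by blast
qed

end

section \<open>From characters to representations\<close>

lemma char_degree_eq:
  assumes "group G" "irreducible_rep G d \<tau>"
  shows "char_degree G (character G \<tau>) = d"
proof -
  interpret group G by fact
  have "mrep G d \<tau>" using assms(2) by (simp add: irreducible_mrep)
  then have "character G \<tau> \<one>\<^bsub>G\<^esub> = of_nat d"
    by (simp add: character_def mrepD(2) mat_trace_one)
  then show ?thesis unfolding char_degree_def by (auto intro!: the_equality)
qed

theorem theoremB:
  fixes G :: "('a, 'b) monoid_scheme" and \<chi> :: "'a \<Rightarrow> complex"
  assumes "group G" and "finite (carrier G)" and "solvable G"
    and "minimal_character G \<chi>" and "faithful_character G \<chi>"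
    and "odd (char_degree G \<chi>)"
  shows "nilpotent_by_abelian G"
proof -
  interpret group G by fact
  obtain n \<rho> where irr: "irreducible_rep G n \<rho>" and \<chi>: "\<chi> = character G \<rho>"
    using assms(4) unfolding minimal_character_def Irr_def by blast
  have deg: "char_degree G \<chi> = n" unfolding \<chi> by (rule char_degree_eq[OF assms(1) irr])
  \<comment> \<open>The bound on character degrees becomes a bound on degrees of representations,
    since the character of an irreducible representation of degree \<open>d\<close> has degree
    \<open>d\<close>.\<close>
  have large: "n \<le> d" if "irreducible_rep G d \<tau>" "1 < d" for d \<tau>
  proof -
    have d: "char_degree G (character G \<tau>) = d" by (rule char_degree_eq[OF assms(1) that(1)])
    have "n = min_nonlinear_degree G" using assms(4) deg unfolding minimal_character_def by simp
    also have "\<dots> \<le> d"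
      unfolding min_nonlinear_degree_def by (rule Least_le) (use that d in \<open>force simp: Irr_def\<close>)
    finally show ?thesis .
  qed
  have rep: "mrep G n \<rho>" using irr by (simp add: irreducible_mrep)
  \<comment> \<open>The kernel of a representation is contained in the kernel of its character, and
    the latter is trivial here.\<close>
  have faith: "g = \<one>\<^bsub>G\<^esub>" if "g \<in> carrier G" "\<rho> g = 1\<^sub>m n" for g
  proof -
    have "g \<in> char_kernel G \<chi>"
      unfolding char_kernel_def \<chi> character_def using that mrepD(2)[OF rep] by simp
    then show ?thesis using assms(5) unfolding faithful_character_def by simp
  qed
  interpret minimal_rep G n \<rho>
    by unfold_locales (use assms(2) large irr faith in auto)
  have "nilpotent (G\<lparr>carrier := K\<rparr>)"
    using derived_subgroup_nilpotent assms(3,6) deg by simp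
  then show ?thesis
    unfolding nilpotent_by_abelian_def using derived_self_is_normal derived_quot_is_comm_group by blast
qed

end
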